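(* If a continuous function $f\colon X\to\mathbb{R}$ on a topological space is $\mathcal{H}^\bullet$-tame, then the functor $h(f)\colon\mathbb{M}^\circ\to\mathrm{vect}_K$ is sequentially continuous.
   Context: Strip. $\mathbb{M}=\{(x,y)\in\mathbb{R}^2:-\pi\le x+y\le\pi\}$ with the Euclidean topology, ordered by $(x,y)\preceq(x',y')$ iff $x\ge x'$ and $y\le y'$. $T(x,y)=(-\pi-y,\pi-x)$ is an automorphism of $\mathbb{M}$. $D=\{(x,y)\in\mathbb{M}:0\le x-y<2\pi\}$ is a fundamental domain for $\langle T\rangle\cong\mathbb{Z}$. For $u=(x,y)\in\mathbb{M}$ put $\rho_1(u)=\{t\in\mathbb{R}:-\pi-y<\arctan t<\pi-x\}$, $\rho_0(u)=\{t\in\mathbb{R}:\arctan t<y\text{ or }\arctan t>x\}$ and $\rho(u)=(\rho_1(u),\rho_0(u))$, a pair of open subsets of $\mathbb{R}$ with $\rho_0(u)\subseteq\rho_1(u)$. $K$ is a fixed field and $\mathcal{H}^\bullet$ is a cohomology theory (on pairs of spaces) with values in the category of $\mathbb{Z}$-graded $K$-vector spaces, which sends weak equivalences to isomorphisms. A continuous $f\colon X\to\mathbb{R}$ is $\mathcal{H}^\bullet$-tame if $\dim_K\mathcal{H}^n(f^{-1}(I))<\infty$ for every $n\in\mathbb{Z}$ and every open interval $I\subseteq\mathbb{R}$ (bounded or unbounded). In that case $h(f)$, defined next, takes values in the category $\mathrm{vect}_K$ of finite-dimensional $K$-vector spaces; $\mathrm{Vect}_K$ denotes the category of all $K$-vector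 spaces, and $\mathbb{M}^\circ$ the opposite of the poset $\mathbb{M}$ viewed as a category. The functor $h(f)$. With $f^{-1}(U,V)=(f^{-1}(U),f^{-1}(V))$, the contravariant functor $h(f)$ on $\mathbb{M}$ is: $h(f)(u)=\mathcal{H}^n(f^{-1}(\rho(T^n(u))))$ for $u\in T^{-n}(D)$. For $u\preceq v$ the internal map $h(f)(u\preceq v)\colon h(f)(v)\to h(f)(u)$ is: the map induced by inclusion if $u,v\in T^{-n}(D)$ for some $n$; if $u\in T^{-n}(D)$, $v\in T^{-n+1}(D)$ and $v\preceq T(u)$, put $p=T^{n-1}(v)=(x,y)$ and $w=T^n(u)=(x',y')$, so that the rectangle with lower right corner $p$, upper left corner $w$, lower left corner $v_1=(x',y)$ and upper right corner $v_2=(x,y')$ lies in $D$ and $\rho(v_1)\cup\rho(v_2)=\rho(w)$, $\rho(v_1)\cap\rho(v_2)=\rho(p)$ componentwise; the internal map is then the differential $\mathcal{H}^{n-1}(f^{-1}(\rho(p)))\to\mathcal{H}^n(f^{-1}(\rho(w)))$ of the relative Mayer–Vietoris sequence of the pairs $f^{-1}(\rho(v_1)),f^{-1}(\rho(v_2))$ (one fixed sign convention); in all other cases it is $0$. A contravariant functor $F\colon\mathbb{M}^\circ\to\mathrm{Vect}_K$ is sequentially continuous if for any increasing sequence $(u_k)_{k\ge1}$ in $\mathbb{M}$ (i.e. $u_k\preceq u_{k+1}$) converging to $u\in\mathbb{M}$, the natural map $F(u)\to\varprojlim_kF(u_k)$ is an isomorphism. *)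

theory Defs
  imports "HOL-Analysis.Analysis"
begin

section \<open>Weak equivalences\<close>

definition cube :: "nat \<Rightarrow> (nat \<Rightarrow> real) topology" where
  "cube n = product_topology (\<lambda>_. top_of_set {0..1}) {..<n}"

definition cube_boundary :: "nat \<Rightarrow> (nat \<Rightarrow> real) set" where
  "cube_boundary n = {t \<in> topspace (cube n). \<exists>i<n. t i = 0 \<or> t i = 1}"

definition spheroids :: "nat \<Rightarrow> 'a topology \<Rightarrow> 'a \<Rightarrow> ((nat \<Rightarrow> real) \<Rightarrow> 'a) set" where
  "spheroids n X x = {g. continuous_map (cube n) X g \<and> g ` cube_boundary n \<subseteq> {x}}"

definition spheroid_homotopic ::
    "nat \<Rightarrow> 'a topology \<Rightarrow> 'a \<Rightarrow> (((nat \<Rightarrow> real) \<Rightarrow> 'a) \<times> ((nat \<Rightarrow> real) \<Rightarrow> 'a)) set" where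
  "spheroid_homotopic n X x = {(g, g'). g \<in> spheroids n X x \<and> g' \<in> spheroids n X x \<and>
     homotopic_with (\<lambda>k. k ` cube_boundary n \<subseteq> {x}) (cube n) X g g'}"

text \<open>The underlying set of the homotopy group of degree \<open>n\<close>.  The cube of dimension \<open>0\<close> is a point
  with empty boundary, so for \<open>n = 0\<close> this is the set of path components.\<close>

definition homotopy_classes :: "nat \<Rightarrow> 'a topology \<Rightarrow> 'a \<Rightarrow> ((nat \<Rightarrow> real) \<Rightarrow> 'a) set set" where
  "homotopy_classes n X x = spheroids n X x // spheroid_homotopic n X x"

definition induced_on_classes ::
    "nat \<Rightarrow> 'b topology \<Rightarrow> 'b \<Rightarrow> ('a \<Rightarrow> 'b) \<Rightarrow> ((nat \<Rightarrow> real) \<Rightarrow> 'a) set \<Rightarrow> ((nat \<Rightarrow> real) \<Rightarrow> 'b) set" where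
  "induced_on_classes n Y y f c = (\<Union>g\<in>c. spheroid_homotopic n Y y `` {f \<circ> g})"

text \<open>The induced maps are group homomorphisms for \<open>n \<ge> 1\<close>, so they are isomorphisms iff they are
  bijective.  The condition on empty spaces is the part of bijectivity on path components that
  is not seen by quantifying over base points of \<open>X\<close>.\<close>

definition weak_equivalence :: "'a topology \<Rightarrow> 'b topology \<Rightarrow> ('a \<Rightarrow> 'b) \<Rightarrow> bool" where
  "weak_equivalence X Y f \<longleftrightarrow> continuous_map X Y f \<and>
     (topspace X = {} \<longrightarrow> topspace Y = {}) \<and>
     (\<forall>n. \<forall>x\<in>topspace X. bij_betw (induced_on_classes n Y (f x) f)
        (homotopy_classes n X x) (homotopy_classes n Y (f x)))"

section \<open>Cohomology theories on pairs of spaces\<close>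

text \<open>All spaces have their points in one type \<open>'u\<close>, which plays the role of a universe, and all
  cohomology spaces are linear subspaces of one \<open>'k\<close>-vector space \<open>'v\<close>.  A pair \<open>(X, A)\<close> is a
  topology \<open>X\<close> with \<open>A \<subseteq> topspace X\<close>; the space \<open>A\<close> itself is \<open>subtopology X A\<close>.

  \<^item> \<open>cohom h n X A\<close> is the degree \<open>n\<close> part of the cohomology of \<open>(X, A)\<close>;
  \<^item> \<open>induced h n X A Y B f\<close> is the map from the cohomology of \<open>(Y, B)\<close> to that of \<open>(X, A)\<close>
    induced by a map of pairs \<open>f\<close> from \<open>(X, A)\<close> to \<open>(Y, B)\<close>;
  \<^item> \<open>connect h n X A\<close> is the connecting map from the cohomology of \<open>A\<close> in degree \<open>n\<close> to that
    of \<open>(X, A)\<close> in degree \<open>n + 1\<close>.\<close>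

record ('k, 'v, 'u) cohomology_data =
  scale :: "'k \<Rightarrow> 'v \<Rightarrow> 'v"
  cohom :: "int \<Rightarrow> 'u topology \<Rightarrow> 'u set \<Rightarrow> 'v set"
  induced :: "int \<Rightarrow> 'u topology \<Rightarrow> 'u set \<Rightarrow> 'u topology \<Rightarrow> 'u set \<Rightarrow> ('u \<Rightarrow> 'u) \<Rightarrow> 'v \<Rightarrow> 'v"
  connect :: "int \<Rightarrow> 'u topology \<Rightarrow> 'u set \<Rightarrow> 'v \<Rightarrow> 'v"

definition linear_between ::
    "('k \<Rightarrow> 'v \<Rightarrow> 'v) \<Rightarrow> 'v::ab_group_add set \<Rightarrow> 'v set \<Rightarrow> ('v \<Rightarrow> 'v) \<Rightarrow> bool" where
  "linear_between s V W \<phi> \<longleftrightarrow> \<phi> ` V \<subseteq> W \<and> (\<forall>a\<in>V. \<forall>b\<in>V. \<phi> (a + b) = \<phi> a + \<phi> b) \<and>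
     (\<forall>c. \<forall>a\<in>V. \<phi> (s c a) = s c (\<phi> a))"

definition finite_dimensional ::
    "('k::field \<Rightarrow> 'v \<Rightarrow> 'v) \<Rightarrow> 'v::ab_group_add set \<Rightarrow> bool" where
  "finite_dimensional s V \<longleftrightarrow> (\<exists>B. finite B \<and> module.span s B = V)"

definition pair_map ::
    "'a topology \<Rightarrow> 'a set \<Rightarrow> 'b topology \<Rightarrow> 'b set \<Rightarrow> ('a \<Rightarrow> 'b) \<Rightarrow> bool" where
  "pair_map X A Y B f \<longleftrightarrow> A \<subseteq> topspace X \<and> B \<subseteq> topspace Y \<and> continuous_map X Y f \<and> f ` A \<subseteq> B"

text \<open>The Eilenberg--Steenrod axioms without the dimension axiom, but with additivity for arbitrary
  disjoint unions, together with invariance under weak equivalences.  Additivity is stated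
  internally: a disjoint union is a space partitioned into open subsets.\<close>

locale cohomology_theory =
  fixes h :: "('k::field, 'v::ab_group_add, 'u) cohomology_data"
  assumes vector_space: "vector_space (scale h)"
    and subspace: "A \<subseteq> topspace X \<Longrightarrow> module.subspace (scale h) (cohom h n X A)"
    and induced_linear: "pair_map X A Y B f \<Longrightarrow>
      linear_between (scale h) (cohom h n Y B) (cohom h n X A) (induced h n X A Y B f)"
    and induced_id: "A \<subseteq> topspace X \<Longrightarrow> a \<in> cohom h n X A \<Longrightarrow> induced h n X A X A id a = a"
    and induced_comp: "pair_map X A Y B f \<Longrightarrow> pair_map Y B W C g \<Longrightarrow> a \<in> cohom h n W C \<Longrightarrow>
      induced h n X A W C (g \<circ> f) a = induced h n X A Y B f (induced h n Y B W C g a)"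
    and connect_linear: "A \<subseteq> topspace X \<Longrightarrow>
      linear_between (scale h) (cohom h n (subtopology X A) {}) (cohom h (n + 1) X A) (connect h n X A)"
    and connect_natural: "pair_map X A Y B f \<Longrightarrow> a \<in> cohom h n (subtopology Y B) {} \<Longrightarrow>
      connect h n X A (induced h n (subtopology X A) {} (subtopology Y B) {} f a) =
      induced h (n + 1) X A Y B f (connect h n Y B a)"
    and exact_absolute: "A \<subseteq> topspace X \<Longrightarrow>
      induced h n X {} X A id ` cohom h n X A =
      {a \<in> cohom h n X {}. induced h n (subtopology X A) {} X {} id a = 0}"
    and exact_subspace: "A \<subseteq> topspace X \<Longrightarrow>
      induced h n (subtopology X A) {} X {} id ` cohom h n X {} =
      {a \<in> cohom h n (subtopology X A) {}. connect h n X A a = 0}"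
    and exact_relative: "A \<subseteq> topspace X \<Longrightarrow>
      connect h n X A ` cohom h n (subtopology X A) {} =
      {a \<in> cohom h (n + 1) X A. induced h (n + 1) X {} X A id a = 0}"
    and homotopy: "pair_map X A Y B f \<Longrightarrow> pair_map X A Y B g \<Longrightarrow>
      homotopic_with (\<lambda>k. k ` A \<subseteq> B) X Y f g \<Longrightarrow> a \<in> cohom h n Y B \<Longrightarrow>
      induced h n X A Y B f a = induced h n X A Y B g a"
    and excision: "A \<subseteq> topspace X \<Longrightarrow> Z \<subseteq> A \<Longrightarrow> X closure_of Z \<subseteq> X interior_of A \<Longrightarrow>
      bij_betw (induced h n (subtopology X (topspace X - Z)) (A - Z) X A id)
        (cohom h n X A) (cohom h n (subtopology X (topspace X - Z)) (A - Z))"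
    and additivity: "A \<subseteq> topspace X \<Longrightarrow> (\<And>U. U \<in> \<U> \<Longrightarrow> openin X U) \<Longrightarrow> pairwise disjnt \<U> \<Longrightarrow>
      \<Union>\<U> = topspace X \<Longrightarrow>
      bij_betw (\<lambda>a. \<lambda>U\<in>\<U>. induced h n (subtopology X U) (A \<inter> U) X A id a)
        (cohom h n X A) (\<Pi>\<^sub>E U\<in>\<U>. cohom h n (subtopology X U) (A \<inter> U))"
    and weak_equivalence: "pair_map X A Y B f \<Longrightarrow> weak_equivalence X Y f \<Longrightarrow>
      weak_equivalence (subtopology X A) (subtopology Y B) f \<Longrightarrow>
      bij_betw (induced h n X A Y B f) (cohom h n Y B) (cohom h n X A)"

definition tame :: "('k::field, 'v::ab_group_add, 'u) cohomology_data \<Rightarrow> 'u topology \<Rightarrow> ('u \<Rightarrow> real) \<Rightarrow> bool" where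
  "tame h X f \<longleftrightarrow> (\<forall>n I. open I \<and> is_interval I \<longrightarrow>
     finite_dimensional (scale h) (cohom h n (subtopology X {x \<in> topspace X. f x \<in> I}) {}))"

section \<open>The relative Mayer--Vietoris differential\<close>

text \<open>In the notation below, all pairs consist of subsets of a common space \<open>Y\<close>.\<close>

definition restriction ::
    "('k, 'v, 'u) cohomology_data \<Rightarrow> int \<Rightarrow> 'u topology \<Rightarrow> 'u set \<Rightarrow> 'u set \<Rightarrow> 'u set \<Rightarrow> 'u set \<Rightarrow> 'v \<Rightarrow> 'v" where
  "restriction h n Y P Q P' Q' = induced h n (subtopology Y P') Q' (subtopology Y P) Q id"

text \<open>The connecting map of a triple \<open>R \<subseteq> Q \<subseteq> P\<close>, from the cohomology of \<open>(Q, R)\<close> to that of \<open>(P, Q)\<close>.\<close>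

definition triple_connect ::
    "('k, 'v, 'u) cohomology_data \<Rightarrow> int \<Rightarrow> 'u topology \<Rightarrow> 'u set \<Rightarrow> 'u set \<Rightarrow> 'u set \<Rightarrow> 'v \<Rightarrow> 'v" where
  "triple_connect h n Y P Q R = connect h n (subtopology Y P) Q \<circ> restriction h n Y Q R Q {}"

text \<open>The product of \<open>X\<close> with the real line, realised as a space with points in \<open>'u\<close> by means of an
  injection \<open>code\<close>.  The choice of the injection does not matter up to homeomorphism.\<close>

definition times_line :: "('u \<times> real \<Rightarrow> 'u) \<Rightarrow> 'u topology \<Rightarrow> 'u topology" where
  "times_line code X = pullback_topology (range code) (inv code) (prod_topology X euclideanreal)"

definition double_mapping_cylinder :: "'u set \<Rightarrow> 'u set \<Rightarrow> ('u \<times> real) set" where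
  "double_mapping_cylinder P Q = P \<times> {0} \<union> (P \<inter> Q) \<times> {0..1} \<union> Q \<times> {1}"

text \<open>Let \<open>(A\<^sub>1, B\<^sub>1)\<close> and \<open>(A\<^sub>2, B\<^sub>2)\<close> be pairs of open subsets of \<open>X\<close>, with componentwise intersection
  \<open>(C, E)\<close> and union \<open>(A, B)\<close>.  Let \<open>(N, M)\<close> be the pair of double mapping cylinders, whose
  projection to \<open>(A, B)\<close> induces isomorphisms in cohomology.  The Mayer--Vietoris sequence is the
  exact sequence of the triple \<open>M \<subseteq> M \<union> ends \<subseteq> N\<close>, where \<open>ends = A\<^sub>1 \<times> {0} \<union> A\<^sub>2 \<times> {1}\<close>:
  the cohomology of \<open>(M \<union> ends, M)\<close> is the direct sum of those of the pairs \<open>(A\<^sub>i, B\<^sub>i)\<close>,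
  and the cohomology of \<open>(N, M \<union> ends)\<close> is, by excision, that of \<open>(C, E) \<times> ([0,1], {0,1})\<close>,
  i.e. that of \<open>(C, E)\<close> with the degree shifted by the suspension isomorphism.  The differential
  is the suspension isomorphism, followed by restriction from \<open>(N, M \<union> ends)\<close> to \<open>(N, M)\<close>.
  Its sign is fixed by placing the first pair at \<open>0\<close>, the second at \<open>1\<close>, and by letting
  the suspension isomorphism use the end at \<open>1\<close>.\<close>

definition mv_differential ::
    "('k, 'v, 'u) cohomology_data \<Rightarrow> ('u \<times> real \<Rightarrow> 'u) \<Rightarrow> int \<Rightarrow> 'u topology \<Rightarrow>
     'u set \<times> 'u set \<Rightarrow> 'u set \<times> 'u set \<Rightarrow> 'v \<Rightarrow> 'v" where
  "mv_differential h code n X = (\<lambda>(A\<^sub>1, B\<^sub>1) (A\<^sub>2, B\<^sub>2).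
    let A = A\<^sub>1 \<union> A\<^sub>2; B = B\<^sub>1 \<union> B\<^sub>2; C = A\<^sub>1 \<inter> A\<^sub>2; E = B\<^sub>1 \<inter> B\<^sub>2;
        Y = times_line code X;
        proj = fst \<circ> inv code;
        N = code ` double_mapping_cylinder A\<^sub>1 A\<^sub>2;
        M = code ` double_mapping_cylinder B\<^sub>1 B\<^sub>2;
        ends = code ` (A\<^sub>1 \<times> {0} \<union> A\<^sub>2 \<times> {1});
        S = code ` (C \<times> {0..1});
        S' = code ` (C \<times> {0, 1} \<union> E \<times> {0..1});
        S\<^sub>0 = code ` (C \<times> {0} \<union> E \<times> {0..1});
        C\<^sub>1 = code ` (C \<times> {1});
        E\<^sub>1 = code ` (E \<times> {1});
        suspension =
          triple_connect h n Y S S' S\<^sub>0 \<circ>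
          inv_into (cohom h n (subtopology Y S') S\<^sub>0) (restriction h n Y S' S\<^sub>0 C\<^sub>1 E\<^sub>1) \<circ>
          induced h n (subtopology Y C\<^sub>1) E\<^sub>1 (subtopology X C) E proj
    in inv_into (cohom h (n + 1) (subtopology X A) B)
         (induced h (n + 1) (subtopology Y N) M (subtopology X A) B proj) \<circ>
       restriction h (n + 1) Y N (M \<union> ends) N M \<circ>
       inv_into (cohom h (n + 1) (subtopology Y N) (M \<union> ends))
         (restriction h (n + 1) Y N (M \<union> ends) S S') \<circ>
       suspension)"

section \<open>The strip\<close>

definition strip :: "(real \<times> real) set" where
  "strip = {(x, y). - pi \<le> x + y \<and> x + y \<le> pi}"

definition strip_le :: "real \<times> real \<Rightarrow> real \<times> real \<Rightarrow> bool" (infix \<open>\<preceq>\<close> 50) where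
  "u \<preceq> v \<longleftrightarrow> fst u \<ge> fst v \<and> snd u \<le> snd v"

definition T :: "real \<times> real \<Rightarrow> real \<times> real" where
  "T = (\<lambda>(x, y). (- pi - y, pi - x))"

definition T_power :: "int \<Rightarrow> real \<times> real \<Rightarrow> real \<times> real" where
  "T_power n = (if 0 \<le> n then T ^^ nat n else inv T ^^ nat (- n))"

definition fundamental_domain :: "(real \<times> real) set" where
  "fundamental_domain = {(x, y) \<in> strip. 0 \<le> x - y \<and> x - y < 2 * pi}"

text \<open>The integer \<open>n\<close> such that \<open>u\<close> lies in the image of the fundamental domain under the power
  \<open>-n\<close> of \<open>T\<close>.\<close>

definition tile :: "real \<times> real \<Rightarrow> int" where
  "tile u = (THE n. u \<in> T_power (- n) ` fundamental_domain)"

definition rho1 :: "real \<times> real \<Rightarrow> real set" where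
  "rho1 = (\<lambda>(x, y). {t. - pi - y < arctan t \<and> arctan t < pi - x})"

definition rho0 :: "real \<times> real \<Rightarrow> real set" where
  "rho0 = (\<lambda>(x, y). {t. arctan t < y \<or> arctan t > x})"

section \<open>Contravariant functors on the strip\<close>

text \<open>A contravariant functor is given by its values \<open>F u\<close>, subspaces of the \<open>'k\<close>-vector space \<open>'v\<close>,
  and its internal maps \<open>\<phi> u v\<close> from \<open>F v\<close> to \<open>F u\<close> for \<open>u \<preceq> v\<close>.\<close>

definition strip_functor ::
    "('k::field \<Rightarrow> 'v \<Rightarrow> 'v) \<Rightarrow> (real \<times> real \<Rightarrow> 'v::ab_group_add set) \<Rightarrow>
     (real \<times> real \<Rightarrow> real \<times> real \<Rightarrow> 'v \<Rightarrow> 'v) \<Rightarrow> bool" where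
  "strip_functor s F \<phi> \<longleftrightarrow>
     (\<forall>u\<in>strip. module.subspace s (F u)) \<and>
     (\<forall>u\<in>strip. \<forall>v\<in>strip. u \<preceq> v \<longrightarrow> linear_between s (F v) (F u) (\<phi> u v)) \<and>
     (\<forall>u\<in>strip. \<forall>a\<in>F u. \<phi> u u a = a) \<and>
     (\<forall>u\<in>strip. \<forall>v\<in>strip. \<forall>w\<in>strip. u \<preceq> v \<longrightarrow> v \<preceq> w \<longrightarrow>
        (\<forall>a\<in>F w. \<phi> u v (\<phi> v w a) = \<phi> u w a))"

definition strip_functor_vect ::
    "('k::field \<Rightarrow> 'v \<Rightarrow> 'v) \<Rightarrow> (real \<times> real \<Rightarrow> 'v::ab_group_add set) \<Rightarrow>
     (real \<times> real \<Rightarrow> real \<times> real \<Rightarrow> 'v \<Rightarrow> 'v) \<Rightarrow> bool" where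
  "strip_functor_vect s F \<phi> \<longleftrightarrow> strip_functor s F \<phi> \<and> (\<forall>u\<in>strip. finite_dimensional s (F u))"

definition inverse_limit ::
    "(real \<times> real \<Rightarrow> 'v set) \<Rightarrow> (real \<times> real \<Rightarrow> real \<times> real \<Rightarrow> 'v \<Rightarrow> 'v) \<Rightarrow>
     (nat \<Rightarrow> real \<times> real) \<Rightarrow> (nat \<Rightarrow> 'v) set" where
  "inverse_limit F \<phi> u =
     {c. (\<forall>k. c k \<in> F (u k)) \<and> (\<forall>j k. j \<le> k \<longrightarrow> \<phi> (u j) (u k) (c k) = c j)}"

text \<open>The natural map to the inverse limit is linear, so it is an isomorphism iff it is bijective.\<close>

definition sequentially_continuous ::
    "(real \<times> real \<Rightarrow> 'v set) \<Rightarrow> (real \<times> real \<Rightarrow> real \<times> real \<Rightarrow> 'v \<Rightarrow> 'v) \<Rightarrow> bool" where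
  "sequentially_continuous F \<phi> \<longleftrightarrow>
     (\<forall>u l. (\<forall>k. u k \<in> strip \<and> u k \<preceq> u (Suc k)) \<and> l \<in> strip \<and> u \<longlonglongrightarrow> l \<longrightarrow>
        bij_betw (\<lambda>a k. \<phi> (u k) l a) (F l) (inverse_limit F \<phi> u))"

section \<open>Relative interlevel set cohomology\<close>

definition preimage_pair :: "'u topology \<Rightarrow> ('u \<Rightarrow> real) \<Rightarrow> real \<times> real \<Rightarrow> 'u set \<times> 'u set" where
  "preimage_pair X f u = ({x \<in> topspace X. f x \<in> rho1 u}, {x \<in> topspace X. f x \<in> rho0 u})"

definition h_space ::
    "('k, 'v, 'u) cohomology_data \<Rightarrow> 'u topology \<Rightarrow> ('u \<Rightarrow> real) \<Rightarrow> real \<times> real \<Rightarrow> 'v set" where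
  "h_space h X f u =
     (let n = tile u; (A, B) = preimage_pair X f (T_power n u) in cohom h n (subtopology X A) B)"

definition h_map ::
    "('k, 'v::zero, 'u) cohomology_data \<Rightarrow> ('u \<times> real \<Rightarrow> 'u) \<Rightarrow> 'u topology \<Rightarrow> ('u \<Rightarrow> real) \<Rightarrow>
     real \<times> real \<Rightarrow> real \<times> real \<Rightarrow> 'v \<Rightarrow> 'v" where
  "h_map h code X f u v = (let n = tile u in
     if tile v = n then
       (let (A, B) = preimage_pair X f (T_power n v);
            (A', B') = preimage_pair X f (T_power n u)
        in restriction h n X A B A' B')
     else if tile v = n - 1 \<and> v \<preceq> T u then
       (let (x, y) = T_power (n - 1) v; (x', y') = T_power n u
        in mv_differential h code (n - 1) X
             (preimage_pair X f (x', y)) (preimage_pair X f (x, y')))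
     else (\<lambda>_. 0))"

end

theory Submission
  imports Defs
begin

text \<open>Inside one tile of the strip, the functor consists of cohomology groups of pairs of preimages of
  open sets, and an increasing sequence in the strip gives increasing sequences of open sets.  The
  union of such a sequence is homotopy equivalent to its telescope, as the sets are pulled back from
  the line, and a Mayer--Vietoris argument on the telescope yields Milnor's sequence.  Tameness makes
  all inverse systems finite-dimensional, so that every obstruction is an inverse system of nonempty
  finite-dimensional affine spaces; such a system has a thread because decreasing chains of affine
  subspaces are stationary.  Tiles are half-open in the right direction, so that an increasing
  sequence eventually lies in the tile of its limit.

  Functoriality needs three properties of the Mayer--Vietoris differential: it is natural, it is
  killed by restriction to either pair of the cover, and it kills restrictions from these pairs.\<close>

section \<open>Inverse systems of finite-dimensional affine spaces\<close>

text \<open>Inverse limits are not exact in general. Instead of proving exactness for the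
  finite-dimensional ones and applying a five lemma, the passage from spaces to pairs is a diagram
  chase in which every choice is made for all stages at once, as a thread in the system of all
  admissible choices. The differential is a composite that contains inverses of isomorphisms. It is
  handled as a relation between classes in which only restrictions, projections and connecting maps
  occur, and such a relation restricts to smaller covers. Excision also asks for room around the
  excised set, which the end slices of a mapping cylinder lack, so they are first thickened to
  collars. In the functoriality proof, the delicate case is that two consecutive differentials
  compose to zero. There the first one is factored through an intermediate corner of the second
  rectangle; the width 2 pi of the fundamental domain ensures that this is possible for at least one
  of the two corners.\<close>

locale affine_system = vector_space scale
  for scale :: "'k::field \<Rightarrow> 'v::ab_group_add \<Rightarrow> 'v"
begin

text \<open>\<open>dim\<close> counts a basis and is 0 on infinite-dimensional spaces, so the finite
  spanning set is what makes it monotone. A basis of \<open>U\<close> is extended to one of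
  \<open>W\<close>; equal dimensions leave nothing to add.\<close>

lemma subspace_dim_le_finite_span:
  assumes "subspace U" "subspace W" "U \<subseteq> W" "W \<subseteq> span B" "finite B"
  shows "dim U \<le> dim W" and "dim U = dim W \<Longrightarrow> U = W"
proof -
  obtain C where C: "C \<subseteq> U" "independent C" "U \<subseteq> span C"
    using maximal_independent_subset by blast
  obtain E where E: "C \<subseteq> E" "E \<subseteq> W" "independent E" "W \<subseteq> span E"
    using maximal_independent_subset_extend[of C W] C(1,2) assms(3) by blast
  have finE: "finite E"
    using independent_span_bound[of B E] assms(4,5) E by blast
  have dW: "dim W = card E"
    using basis_card_eq_dim[of E W] E by simp
  have dU: "dim U = card C"
    using basis_card_eq_dim[of C U] C by simp
  show "dim U \<le> dim W"
    using dW dU card_mono[OF finE E(1)] by simp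
  show "U = W" if "dim U = dim W"
  proof -
    have "C = E"
      using card_subset_eq[OF finE E(1)] that dW dU by simp
    moreover have "span C \<subseteq> U"
      using span_minimal C(1) assms(1) by blast
    ultimately show ?thesis
      using E(4) assms(3) by blast
  qed
qed

text \<open>Three points are used because closure under lines through two points is an empty
  condition over the field with two elements. The empty set qualifies, hence the separate
  nonemptiness assumptions below.\<close>

definition affine_subset :: "'v set \<Rightarrow> bool" where
  "affine_subset S \<longleftrightarrow> (\<forall>x\<in>S. \<forall>y\<in>S. \<forall>z\<in>S. \<forall>c. scale c (x - y) + z \<in> S)"

definition directions :: "'v set \<Rightarrow> 'v set" where
  "directions S = {x - y |x y. x \<in> S \<and> y \<in> S}"

lemma subspace_directions:
  assumes "affine_subset S" "S \<noteq> {}"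
  shows "subspace (directions S)"
proof (rule subspaceI)
  show "0 \<in> directions S"
    using assms(2) by (force simp: directions_def)
next
  fix u v assume "u \<in> directions S" "v \<in> directions S"
  then obtain x y z w where *: "u = x - y" "v = z - w" "x \<in> S" "y \<in> S" "z \<in> S" "w \<in> S"
    unfolding directions_def by blast
  have "scale 1 (x - y) + z \<in> S"
    using assms(1) * unfolding affine_subset_def by blast
  then have "(x - y) + z \<in> S" by simp
  moreover have "u + v = (x - y + z) - w" using * by simp
  ultimately show "u + v \<in> directions S"
    unfolding directions_def using * by blast
next
  fix c u assume "u \<in> directions S"
  then obtain x y where *: "u = x - y" "x \<in> S" "y \<in> S"
    unfolding directions_def by blast
  have "scale c (x - y) + y \<in> S"
    using assms(1) * unfolding affine_subset_def by blast
  moreover have "scale c u = (scale c (x - y) + y) - y" using * by simp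
  ultimately show "scale c u \<in> directions S"
    unfolding directions_def using * by blast
qed

lemma affine_subset_eqI:
  assumes "affine_subset S" "S \<noteq> {}" "S \<subseteq> S'" "directions S' \<subseteq> directions S"
  shows "S = S'"
proof
  show "S' \<subseteq> S"
  proof
    fix t assume t: "t \<in> S'"
    obtain s where s: "s \<in> S" using assms(2) by blast
    have "t - s \<in> directions S"
      using t s assms(3,4) unfolding directions_def by blast
    then obtain x y where "t - s = x - y" "x \<in> S" "y \<in> S"
      unfolding directions_def by blast
    moreover from this have "scale 1 (x - y) + s \<in> S"
      using assms(1) s unfolding affine_subset_def by blast
    ultimately show "t \<in> S"
      by (metis diff_add_cancel scale_one)
  qed
qed (use assms in auto)

text \<open>The chain is governed by the dimensions of the direction spaces. Past a stage where this
  dimension is least the directions no longer change, and nested nonempty affine sets with equal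
  directions coincide.\<close>

lemma decreasing_affine_subsets_stabilise:
  fixes R :: "nat \<Rightarrow> 'v set"
  assumes "\<And>m. affine_subset (R m)" "\<And>m. R m \<noteq> {}" "\<And>m. R (Suc m) \<subseteq> R m"
    and "R 0 \<subseteq> span B" "finite B"
  shows "\<exists>M. \<forall>m. R M \<subseteq> R m"
proof -
  have mono: "R n \<subseteq> R m" if "m \<le> n" for m n
    using that assms(3) by (rule lift_Suc_antimono_le[rotated])
  define M where "M = (ARG_MIN (\<lambda>m. dim (directions (R m))) m. True)"
  have M: "dim (directions (R M)) \<le> dim (directions (R m))" for m
    unfolding M_def by (rule arg_min_nat_le) simp
  have sp: "directions (R m) \<subseteq> span B" for m
    using mono[of 0 m] assms(4) span_diff unfolding directions_def by blast
  have eq: "R m = R M" if "M \<le> m" for m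
  proof (rule affine_subset_eqI)
    have sub: "directions (R m) \<subseteq> directions (R M)"
      using mono[OF that] unfolding directions_def by blast
    note * = subspace_dim_le_finite_span[OF subspace_directions[OF assms(1,2)]
        subspace_directions[OF assms(1,2)] sub sp \<open>finite B\<close>]
    show "directions (R M) \<subseteq> directions (R m)"
      using * M[of m] by simp
  qed (use assms mono[OF that] in auto)
  have "R M \<subseteq> R m" for m
    using eq[of m] mono[of m M] by (cases "M \<le> m") auto
  then show ?thesis by blast
qed

text \<open>Mittag-Leffler argument: the images of later stages in a fixed stage are eventually
  stationary, and the transition maps are surjective between these stable images. The maps
  \<open>\<psi>\<close> are only affine, because the derived limit below is treated by translated
  restriction maps.\<close>

lemma affine_inverse_system_thread:
  fixes S :: "nat \<Rightarrow> 'v set" and \<psi> :: "nat \<Rightarrow> 'v \<Rightarrow> 'v"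
  assumes aff: "\<And>k. affine_subset (S k)" and ne: "\<And>k. S k \<noteq> {}"
    and fin: "\<And>k. \<exists>B. finite B \<and> S k \<subseteq> span B"
    and into: "\<And>k x. x \<in> S (Suc k) \<Longrightarrow> \<psi> k x \<in> S k"
    and lin: "\<And>k x y z c. x \<in> S (Suc k) \<Longrightarrow> y \<in> S (Suc k) \<Longrightarrow> z \<in> S (Suc k) \<Longrightarrow>
      \<psi> k (scale c (x - y) + z) = scale c (\<psi> k x - \<psi> k y) + \<psi> k z"
  shows "\<exists>a. \<forall>k. a k \<in> S k \<and> \<psi> k (a (Suc k)) = a k"
proof -
  \<comment> \<open>\<open>g m k\<close> is the image of \<open>S (k + m)\<close> in
    \<open>S k\<close>.\<close>
  define g where "g = rec_nat S (\<lambda>_ F k. \<psi> k ` F (Suc k))"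
  have g0: "g 0 k = S k" and gS: "g (Suc m) k = \<psi> k ` g m (Suc k)" for m k
    by (simp_all add: g_def)
  have sub: "g m k \<subseteq> S k" for m k
  proof (induction m arbitrary: k)
    case (Suc m) then show ?case using into by (force simp: gS)
  qed (simp add: g0)
  have dec: "g (Suc m) k \<subseteq> g m k" for m k
  proof (induction m arbitrary: k)
    case 0 then show ?case using sub[of 1 k] by (simp add: g0)
  next
    case (Suc m) then show ?case unfolding gS[of "Suc m"] gS[of m] by (rule image_mono)
  qed
  have affg: "affine_subset (g m k)" for m k
  proof (induction m arbitrary: k)
    case (Suc m)
    show ?case
      unfolding affine_subset_def gS
    proof (intro ballI allI)
      fix x' y' z' c
      assume "x' \<in> \<psi> k ` g m (Suc k)" "y' \<in> \<psi> k ` g m (Suc k)" "z' \<in> \<psi> k ` g m (Suc k)"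
      then obtain x y z where eq: "x' = \<psi> k x" "y' = \<psi> k y" "z' = \<psi> k z"
        and g: "x \<in> g m (Suc k)" "y \<in> g m (Suc k)" "z \<in> g m (Suc k)"
        by blast
      have "scale c (x - y) + z \<in> g m (Suc k)"
        using Suc.IH[of "Suc k"] g unfolding affine_subset_def by blast
      moreover have "\<psi> k (scale c (x - y) + z) = scale c (x' - y') + z'"
        unfolding eq using lin g sub by blast
      ultimately show "scale c (x' - y') + z' \<in> \<psi> k ` g m (Suc k)"
        by (metis image_eqI)
    qed
  qed (simp add: g0 aff)
  have neg: "g m k \<noteq> {}" for m k
    by (induction m arbitrary: k) (auto simp: g0 gS ne)
  define G where "G k = (\<Inter>m. g m k)" for k
  have stab: "\<exists>M. G k = g M k" for k
  proof -
    obtain B where B: "finite B" "S k \<subseteq> span B" using fin by blast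
    have "\<exists>M. \<forall>m. g M k \<subseteq> g m k"
      by (rule decreasing_affine_subsets_stabilise[where B = B])
        (use affg neg dec B in \<open>auto simp: g0\<close>)
    then show ?thesis unfolding G_def by blast
  qed
  \<comment> \<open>If the images in stage \<open>Suc k\<close> are stationary from depth
    \<open>M\<close> on, an element of stage \<open>k\<close> that comes from depth
    \<open>Suc M\<close> has a preimage of depth \<open>M\<close>, and that preimage is already
    stable.\<close>
  have surj: "\<exists>y. y \<in> G (Suc k) \<and> \<psi> k y = x" if "x \<in> G k" for k x
  proof -
    obtain M where "G (Suc k) = g M (Suc k)" using stab by blast
    moreover have "x \<in> g (Suc M) k" using that unfolding G_def by blast
    ultimately show ?thesis unfolding gS by blast
  qed
  obtain x0 where "x0 \<in> G 0" using stab[of 0] neg by force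
  then obtain a where "\<And>k. a k \<in> G k" "\<And>k. \<psi> k (a (Suc k)) = a k"
    using dependent_nat_choice[of "\<lambda>k x. x \<in> G k" "\<lambda>k x y. \<psi> k y = x"] surj by blast
  moreover have "G k \<subseteq> S k" for k unfolding G_def using g0 by blast
  ultimately show ?thesis by blast
qed

end

section \<open>Exact sequences, excision and additivity for pairs\<close>

lemma subtopology_nested: "Q \<subseteq> P \<Longrightarrow> subtopology (subtopology Y P) Q = subtopology Y Q"
  by (simp add: subtopology_subtopology inf.absorb2)

lemma bij_betw_onto: "bij_betw f A B \<Longrightarrow> b \<in> B \<Longrightarrow> \<exists>a\<in>A. f a = b"
  by (auto simp: bij_betw_def)

lemma bij_betw_eq: "bij_betw f A B \<Longrightarrow> a \<in> A \<Longrightarrow> a' \<in> A \<Longrightarrow> f a = f a' \<Longrightarrow> a = a'"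
  by (rule inj_onD[OF bij_betw_imp_inj_on])

lemma bij_betw_composite:
  assumes "bij_betw f A B" "bij_betw g B C" "\<And>a. a \<in> A \<Longrightarrow> g (f a) = k a"
  shows "bij_betw k A C"
proof -
  have "bij_betw (g \<circ> f) A C" by (rule bij_betw_trans[OF assms(1,2)])
  moreover have "bij_betw (g \<circ> f) A C = bij_betw k A C"
    by (rule bij_betw_cong) (simp add: assms(3))
  ultimately show ?thesis by simp
qed

lemma bij_betw_cancel:
  assumes "bij_betw f A B" "bij_betw k A C" "\<And>a. a \<in> A \<Longrightarrow> g (f a) = k a"
  shows "bij_betw g B C"
proof -
  have "bij_betw (g \<circ> f) A C = bij_betw k A C"
    by (rule bij_betw_cong) (simp add: assms(3))
  then show ?thesis
    using bij_betw_comp_iff[OF assms(1), of g C] assms(2) by simp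
qed

definition sub_pair :: "'u topology \<Rightarrow> 'u set \<Rightarrow> 'u set \<Rightarrow> 'u set \<Rightarrow> 'u set \<Rightarrow> bool" where
  "sub_pair Y P Q P' Q' \<longleftrightarrow> P \<subseteq> topspace Y \<and> Q \<subseteq> P \<and> P' \<subseteq> P \<and> Q' \<subseteq> Q \<and> Q' \<subseteq> P'"

lemma sub_pair_map: "sub_pair Y P Q P' Q' \<Longrightarrow> pair_map (subtopology Y P') Q' (subtopology Y P) Q id"
  unfolding sub_pair_def pair_map_def
  by (auto simp: continuous_map_in_subtopology intro!: continuous_map_from_subtopology)

lemma pair_map_empty: "pair_map X A Y B f \<Longrightarrow> pair_map X {} Y {} f"
  by (auto simp: pair_map_def)

lemma pair_map_sub: "pair_map X A Y B f \<Longrightarrow> pair_map (subtopology X A) {} (subtopology Y B) {} f"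
  by (auto simp: pair_map_def continuous_map_in_subtopology continuous_map_from_subtopology)

lemma pair_map_inner: "A \<subseteq> topspace X \<Longrightarrow> pair_map (subtopology X A) {} X {} id"
  and pair_map_outer: "A \<subseteq> topspace X \<Longrightarrow> pair_map X {} X A id"
  and pair_map_id: "A \<subseteq> topspace X \<Longrightarrow> pair_map X A X A id"
  by (auto simp: pair_map_def)

lemma pair_map_comp: "pair_map X A Y B f \<Longrightarrow> pair_map Y B Z C g \<Longrightarrow> pair_map X A Z C (g \<circ> f)"
  unfolding pair_map_def by (metis continuous_map_compose image_comp image_mono order_trans)

context cohomology_theory
begin

sublocale vs: affine_system "scale h"
  by (intro affine_system.intro vector_space)

abbreviation "res \<equiv> restriction h"
abbreviation "H n Y P Q \<equiv> cohom h n (subtopology Y P) Q"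

lemma cohom_zero: "A \<subseteq> topspace X \<Longrightarrow> 0 \<in> cohom h n X A"
  and cohom_add: "A \<subseteq> topspace X \<Longrightarrow> a \<in> cohom h n X A \<Longrightarrow> b \<in> cohom h n X A \<Longrightarrow> a + b \<in> cohom h n X A"
  and cohom_diff: "A \<subseteq> topspace X \<Longrightarrow> a \<in> cohom h n X A \<Longrightarrow> b \<in> cohom h n X A \<Longrightarrow> a - b \<in> cohom h n X A"
  and cohom_neg: "A \<subseteq> topspace X \<Longrightarrow> a \<in> cohom h n X A \<Longrightarrow> - a \<in> cohom h n X A"
  by (auto intro: subspace vs.subspace_0 vs.subspace_add vs.subspace_diff vs.subspace_neg vs.subspace_scale)

lemma linear_between_diff:
  assumes "linear_between (scale h) V W \<phi>" "vs.subspace V" "a \<in> V" "b \<in> V"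
  shows "\<phi> (a - b) = \<phi> a - \<phi> b"
proof -
  have "a - b \<in> V" using assms vs.subspace_diff by blast
  then have "\<phi> (a - b + b) = \<phi> (a - b) + \<phi> b"
    using assms(1,4) unfolding linear_between_def by blast
  then show ?thesis by simp
qed

lemma linear_between_zero:
  assumes "linear_between (scale h) V W \<phi>" "vs.subspace V"
  shows "\<phi> 0 = 0"
  using linear_between_diff[OF assms, of 0 0] vs.subspace_0[OF assms(2)] by simp

lemma linear_between_comp:
  assumes "linear_between (scale h) V W \<phi>" "linear_between (scale h) W Z \<psi>"
  shows "linear_between (scale h) V Z (\<psi> \<circ> \<phi>)"
  using assms unfolding linear_between_def image_subset_iff by simp

lemma linear_between_inv_into:
  assumes "linear_between (scale h) V W \<phi>" "vs.subspace V" "bij_betw \<phi> V W"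
  shows "linear_between (scale h) W V (inv_into V \<phi>)"
proof -
  note lb = assms(1)[unfolded linear_between_def]
  have inv: "inv_into V \<phi> w \<in> V" "\<phi> (inv_into V \<phi> w) = w" if "w \<in> W" for w
    using that assms(3) by (auto simp: bij_betw_def inv_into_into f_inv_into_f)
  have cancel: "inv_into V \<phi> (\<phi> v) = v" if "v \<in> V" for v
    using that assms(3) by (simp add: bij_betw_def)
  show ?thesis
    unfolding linear_between_def
  proof (intro conjI ballI allI)
    show "inv_into V \<phi> ` W \<subseteq> V" using inv by blast
    fix a assume a: "a \<in> W"
    {
      fix b assume b: "b \<in> W"
      have "\<phi> (inv_into V \<phi> a + inv_into V \<phi> b) = a + b"
        using lb inv a b by simp
      then show "inv_into V \<phi> (a + b) = inv_into V \<phi> a + inv_into V \<phi> b"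
        using cancel[of "inv_into V \<phi> a + inv_into V \<phi> b"] vs.subspace_add[OF assms(2)] inv a b by simp
    next
      fix c
      have "\<phi> (scale h c (inv_into V \<phi> a)) = scale h c a"
        using lb inv a by simp
      then show "inv_into V \<phi> (scale h c a) = scale h c (inv_into V \<phi> a)"
        using cancel[of "scale h c (inv_into V \<phi> a)"] vs.subspace_scale[OF assms(2)] inv a by simp
    }
  qed
qed

lemma induced_in: "pair_map X A Y B f \<Longrightarrow> a \<in> cohom h n Y B \<Longrightarrow> induced h n X A Y B f a \<in> cohom h n X A"
  using induced_linear[of X A Y B f n] unfolding linear_between_def by blast

lemma induced_add: "pair_map X A Y B f \<Longrightarrow> a \<in> cohom h n Y B \<Longrightarrow> b \<in> cohom h n Y B \<Longrightarrow>
    induced h n X A Y B f (a + b) = induced h n X A Y B f a + induced h n X A Y B f b"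
  using induced_linear[of X A Y B f n] unfolding linear_between_def by blast

lemma induced_scale: "pair_map X A Y B f \<Longrightarrow> a \<in> cohom h n Y B \<Longrightarrow>
    induced h n X A Y B f (scale h c a) = scale h c (induced h n X A Y B f a)"
  using induced_linear[of X A Y B f n] unfolding linear_between_def by blast

lemma induced_diff: "pair_map X A Y B f \<Longrightarrow> a \<in> cohom h n Y B \<Longrightarrow> b \<in> cohom h n Y B \<Longrightarrow>
    induced h n X A Y B f (a - b) = induced h n X A Y B f a - induced h n X A Y B f b"
  using linear_between_diff[OF induced_linear subspace] by (simp add: pair_map_def)

lemma induced_zero: "pair_map X A Y B f \<Longrightarrow> induced h n X A Y B f 0 = 0"
  using linear_between_zero[OF induced_linear subspace] by (simp add: pair_map_def)

lemma connect_in: "A \<subseteq> topspace X \<Longrightarrow> a \<in> cohom h n (subtopology X A) {} \<Longrightarrow> connect h n X A a \<in> cohom h (n + 1) X A"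
  using connect_linear[of A X n] unfolding linear_between_def by blast

lemma connect_diff: "A \<subseteq> topspace X \<Longrightarrow> a \<in> cohom h n (subtopology X A) {} \<Longrightarrow> b \<in> cohom h n (subtopology X A) {} \<Longrightarrow>
    connect h n X A (a - b) = connect h n X A a - connect h n X A b"
  using linear_between_diff[OF connect_linear subspace] by simp

lemma inner_outer_zero:
  assumes "A \<subseteq> topspace X" "a \<in> cohom h n X A"
  shows "induced h n (subtopology X A) {} X {} id (induced h n X {} X A id a) = 0"
proof -
  have "induced h n X {} X A id a \<in> induced h n X {} X A id ` cohom h n X A"
    using assms(2) by (rule imageI)
  then show ?thesis
    unfolding exact_absolute[OF assms(1)] by simp
qed

lemma lift_to_relative:
  assumes "A \<subseteq> topspace X" "a \<in> cohom h n X {}" "induced h n (subtopology X A) {} X {} id a = 0"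
  obtains b where "b \<in> cohom h n X A" "induced h n X {} X A id b = a"
proof -
  have "a \<in> induced h n X {} X A id ` cohom h n X A"
    unfolding exact_absolute[OF assms(1)] using assms(2,3) by simp
  then show thesis using that by (elim imageE) simp
qed

lemma connect_inner_zero:
  assumes "A \<subseteq> topspace X" "a \<in> cohom h n X {}"
  shows "connect h n X A (induced h n (subtopology X A) {} X {} id a) = 0"
proof -
  have "induced h n (subtopology X A) {} X {} id a \<in> induced h n (subtopology X A) {} X {} id ` cohom h n X {}"
    using assms(2) by (rule imageI)
  then show ?thesis
    unfolding exact_subspace[OF assms(1)] by simp
qed

lemma extend_from_subspace:
  assumes "A \<subseteq> topspace X" "a \<in> cohom h n (subtopology X A) {}" "connect h n X A a = 0"
  obtains b where "b \<in> cohom h n X {}" "induced h n (subtopology X A) {} X {} id b = a"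
proof -
  have "a \<in> induced h n (subtopology X A) {} X {} id ` cohom h n X {}"
    unfolding exact_subspace[OF assms(1)] using assms(2,3) by simp
  then show thesis using that by (elim imageE) simp
qed

lemma outer_connect_zero:
  assumes "A \<subseteq> topspace X" "a \<in> cohom h n (subtopology X A) {}"
  shows "induced h (n + 1) X {} X A id (connect h n X A a) = 0"
proof -
  have "connect h n X A a \<in> connect h n X A ` cohom h n (subtopology X A) {}"
    using assms(2) by (rule imageI)
  then show ?thesis
    unfolding exact_relative[OF assms(1)] by simp
qed

lemma lift_to_subspace:
  assumes "A \<subseteq> topspace X" "a \<in> cohom h n X A" "induced h n X {} X A id a = 0"
  obtains b where "b \<in> cohom h (n - 1) (subtopology X A) {}" "connect h (n - 1) X A b = a"
proof -
  have "a \<in> connect h (n - 1) X A ` cohom h (n - 1) (subtopology X A) {}"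
    unfolding exact_relative[OF assms(1)] using assms(2,3) by simp
  then show thesis using that by (elim imageE) simp
qed

lemma induced_outer:
  assumes "pair_map X A Y B f" "a \<in> cohom h n Y B"
  shows "induced h n X {} X A id (induced h n X A Y B f a) = induced h n X {} Y {} f (induced h n Y {} Y B id a)"
proof -
  have A: "A \<subseteq> topspace X" "B \<subseteq> topspace Y" using assms(1) by (auto simp: pair_map_def)
  show ?thesis
    using induced_comp[OF pair_map_outer[OF A(1)] assms]
      induced_comp[OF pair_map_empty[OF assms(1)] pair_map_outer[OF A(2)] assms(2)]
    by simp
qed

lemma induced_inner:
  assumes "pair_map X A Y B f" "a \<in> cohom h n Y {}"
  shows "induced h n (subtopology X A) {} X {} id (induced h n X {} Y {} f a) =
    induced h n (subtopology X A) {} (subtopology Y B) {} f (induced h n (subtopology Y B) {} Y {} id a)"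
proof -
  have A: "A \<subseteq> topspace X" "B \<subseteq> topspace Y" using assms(1) by (auto simp: pair_map_def)
  show ?thesis
    using induced_comp[OF pair_map_inner[OF A(1)] pair_map_empty[OF assms(1)] assms(2)]
      induced_comp[OF pair_map_sub[OF assms(1)] pair_map_inner[OF A(2)] assms(2)]
    by simp
qed

lemma bij_betw_induced_zero:
  assumes "bij_betw (induced h n X A Y B f) (cohom h n Y B) (cohom h n X A)" "pair_map X A Y B f"
    and "a \<in> cohom h n Y B" "induced h n X A Y B f a = 0"
  shows "a = 0"
proof -
  have "0 \<in> cohom h n Y B"
    using assms(2) by (intro cohom_zero) (simp add: pair_map_def)
  moreover have "induced h n X A Y B f a = induced h n X A Y B f 0"
    using induced_zero[OF assms(2)] assms(4) by simp
  ultimately show ?thesis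
    by (rule bij_betw_eq[OF assms(1,3)])
qed

lemma bij_betw_inducedI:
  assumes "pair_map X A Y B f"
    and "\<And>a. a \<in> cohom h n Y B \<Longrightarrow> induced h n X A Y B f a = 0 \<Longrightarrow> a = 0"
    and "\<And>b. b \<in> cohom h n X A \<Longrightarrow> \<exists>a\<in>cohom h n Y B. induced h n X A Y B f a = b"
  shows "bij_betw (induced h n X A Y B f) (cohom h n Y B) (cohom h n X A)"
proof -
  have B: "B \<subseteq> topspace Y" using assms(1) by (auto simp: pair_map_def)
  have "inj_on (induced h n X A Y B f) (cohom h n Y B)"
  proof (rule inj_onI)
    fix a b assume *: "a \<in> cohom h n Y B" "b \<in> cohom h n Y B" "induced h n X A Y B f a = induced h n X A Y B f b"
    then have "a - b = 0"
      using assms(2)[of "a - b"] induced_diff[OF assms(1)] cohom_diff[OF B] by simp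
    then show "a = b" by simp
  qed
  moreover have "induced h n X A Y B f ` cohom h n Y B = cohom h n X A"
  proof
    show "cohom h n X A \<subseteq> induced h n X A Y B f ` cohom h n Y B"
    proof
      fix b assume "b \<in> cohom h n X A"
      from assms(3)[OF this] show "b \<in> induced h n X A Y B f ` cohom h n Y B" by blast
    qed
  qed (rule image_subsetI, rule induced_in[OF assms(1)])
  ultimately show ?thesis
    by (rule bij_betw_imageI)
qed

text \<open>Chase in the ladder of the two long exact sequences. For injectivity, a class that dies
  is a connecting image of a class on \<open>B\<close>, which turns out to extend over
  \<open>Y\<close>. For surjectivity, a class is first matched after forgetting \<open>A\<close>;
  the error is a connecting image and is matched on the subspaces.\<close>

lemma five_lemma_pair:
  assumes pm: "pair_map X A Y B f"
    and abs: "\<And>n. bij_betw (induced h n X {} Y {} f) (cohom h n Y {}) (cohom h n X {})"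
    and sub: "\<And>n. bij_betw (induced h n (subtopology X A) {} (subtopology Y B) {} f)
      (cohom h n (subtopology Y B) {}) (cohom h n (subtopology X A) {})"
  shows "bij_betw (induced h n X A Y B f) (cohom h n Y B) (cohom h n X A)"
proof (rule bij_betw_inducedI[OF pm])
  have A: "A \<subseteq> topspace X" "B \<subseteq> topspace Y" using pm by (auto simp: pair_map_def)
  note pm0 = pair_map_empty[OF pm] and pms = pair_map_sub[OF pm]
  fix c assume c: "c \<in> cohom h n Y B" "induced h n X A Y B f c = 0"
  have "induced h n X {} Y {} f (induced h n Y {} Y B id c) = 0"
    using induced_outer[OF pm c(1)] c(2) induced_zero[OF pair_map_outer[OF A(1)]] by simp
  then have "induced h n Y {} Y B id c = 0"
    using bij_betw_induced_zero[OF abs pm0] induced_in[OF pair_map_outer[OF A(2)] c(1)] by blast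
  then obtain d where d: "d \<in> cohom h (n - 1) (subtopology Y B) {}" "connect h (n - 1) Y B d = c"
    using lift_to_subspace A(2) c(1) by blast
  let ?fd = "induced h (n - 1) (subtopology X A) {} (subtopology Y B) {} f d"
  have "connect h (n - 1) X A ?fd = 0"
    using connect_natural[OF pm d(1)] d(2) c(2) by simp
  then obtain e' where e': "e' \<in> cohom h (n - 1) X {}" "induced h (n - 1) (subtopology X A) {} X {} id e' = ?fd"
    using extend_from_subspace[OF A(1) induced_in[OF pms d(1)]] by blast
  then obtain e where e: "e \<in> cohom h (n - 1) Y {}" "induced h (n - 1) X {} Y {} f e = e'"
    using bij_betw_onto[OF abs e'(1)] by blast
  let ?re = "induced h (n - 1) (subtopology Y B) {} Y {} id e"
  have re: "?re \<in> cohom h (n - 1) (subtopology Y B) {}"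
    using induced_in[OF pair_map_inner[OF A(2)] e(1)] .
  have "induced h (n - 1) (subtopology X A) {} (subtopology Y B) {} f ?re = ?fd"
    using induced_inner[OF pm e(1)] e(2) e'(2) by simp
  then have "?re = d"
    by (rule bij_betw_eq[OF sub re d(1)])
  then show "c = 0"
    using connect_inner_zero[OF A(2) e(1)] d(2) by simp
next
  have A: "A \<subseteq> topspace X" "B \<subseteq> topspace Y" using pm by (auto simp: pair_map_def)
  note pm0 = pair_map_empty[OF pm] and pms = pair_map_sub[OF pm]
  fix c assume c: "c \<in> cohom h n X A"
  let ?jc = "induced h n X {} X A id c"
  have jc: "?jc \<in> cohom h n X {}" using induced_in[OF pair_map_outer[OF A(1)] c] .
  then obtain e where e: "e \<in> cohom h n Y {}" "induced h n X {} Y {} f e = ?jc"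
    using bij_betw_onto[OF abs jc] by blast
  have "induced h n (subtopology X A) {} (subtopology Y B) {} f
      (induced h n (subtopology Y B) {} Y {} id e) = 0"
    using induced_inner[OF pm e(1)] e(2) inner_outer_zero[OF A(1) c] by simp
  then have "induced h n (subtopology Y B) {} Y {} id e = 0"
    using bij_betw_induced_zero[OF sub pms] induced_in[OF pair_map_inner[OF A(2)] e(1)] by blast
  then obtain e1 where e1: "e1 \<in> cohom h n Y B" "induced h n Y {} Y B id e1 = e"
    using lift_to_relative[OF A(2) e(1)] by blast
  let ?g = "c - induced h n X A Y B f e1"
  have g: "?g \<in> cohom h n X A" using c cohom_diff[OF A(1)] induced_in[OF pm e1(1)] by blast
  have "induced h n X {} X A id ?g = 0"
    using induced_diff[OF pair_map_outer[OF A(1)] c induced_in[OF pm e1(1)]]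
      induced_outer[OF pm e1(1)] e(2) e1(2) by simp
  then obtain d' where d': "d' \<in> cohom h (n - 1) (subtopology X A) {}" "connect h (n - 1) X A d' = ?g"
    using lift_to_subspace[OF A(1) g] by blast
  then obtain d where d: "d \<in> cohom h (n - 1) (subtopology Y B) {}"
      "induced h (n - 1) (subtopology X A) {} (subtopology Y B) {} f d = d'"
    using bij_betw_onto[OF sub d'(1)] by blast
  let ?dd = "connect h (n - 1) Y B d"
  have dd: "?dd \<in> cohom h n Y B" using connect_in[OF A(2) d(1)] by simp
  have "induced h n X A Y B f ?dd = ?g"
    using connect_natural[OF pm d(1)] d(2) d'(2) by simp
  then have "induced h n X A Y B f (e1 + ?dd) = c"
    using induced_add[OF pm e1(1) dd] by simp
  then show "\<exists>a\<in>cohom h n Y B. induced h n X A Y B f a = c"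
    using cohom_add[OF A(2) e1(1) dd] by blast
qed

text \<open>Additivity for the partition of the empty space into no sets at all: the product of the
  empty family has a single element.\<close>

lemma cohom_empty:
  assumes "topspace X = {}" "a \<in> cohom h n X A" "A \<subseteq> topspace X"
  shows "a = 0"
proof -
  have "bij_betw (\<lambda>a. \<lambda>U\<in>{}. induced h n (subtopology X U) (A \<inter> U) X A id a)
        (cohom h n X A) (\<Pi>\<^sub>E U\<in>{}. cohom h n (subtopology X U) (A \<inter> U))"
    by (rule additivity) (use assms in auto)
  then have "inj_on (\<lambda>a. \<lambda>U\<in>{}. induced h n (subtopology X U) (A \<inter> U) X A id a) (cohom h n X A)"
    by (simp add: bij_betw_def)
  from inj_onD[OF this _ assms(2) cohom_zero[OF assms(3)]] show ?thesis
    by (simp add: restrict_def)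
qed

text \<open>The axiom speaks of a set of open subsets, the applications of indexed families.
  Disjointness lets two indices share a set only if it is empty, and then its cohomology vanishes,
  so it does not matter which index \<open>inv_into\<close> picks.\<close>

lemma
  fixes W :: "'i \<Rightarrow> 'u set"
  assumes A: "A \<subseteq> topspace X" and op: "\<And>i. i \<in> I \<Longrightarrow> openin X (W i)"
    and disj: "\<And>i j. i \<in> I \<Longrightarrow> j \<in> I \<Longrightarrow> i \<noteq> j \<Longrightarrow> W i \<inter> W j = {}"
    and cover: "(\<Union>i\<in>I. W i) = topspace X"
  shows additivity_ex: "(\<And>i. i \<in> I \<Longrightarrow> c i \<in> cohom h n (subtopology X (W i)) (A \<inter> W i)) \<Longrightarrow>
      \<exists>a\<in>cohom h n X A. \<forall>i\<in>I. induced h n (subtopology X (W i)) (A \<inter> W i) X A id a = c i"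
    and additivity_inj: "a \<in> cohom h n X A \<Longrightarrow>
      (\<And>i. i \<in> I \<Longrightarrow> induced h n (subtopology X (W i)) (A \<inter> W i) X A id a = 0) \<Longrightarrow> a = 0"
proof -
  let ?r = "\<lambda>U. induced h n (subtopology X U) (A \<inter> U) X A id"
  have bij: "bij_betw (\<lambda>a. \<lambda>U\<in>W ` I. ?r U a)
        (cohom h n X A) (\<Pi>\<^sub>E U\<in>W ` I. cohom h n (subtopology X U) (A \<inter> U))"
  proof (rule additivity[OF A])
    show "pairwise disjnt (W ` I)"
      using disj by (fastforce simp: pairwise_def disjnt_def)
  qed (use op cover in auto)
  have pm: "pair_map (subtopology X (W i)) (A \<inter> W i) X A id" if "i \<in> I" for i
    using A openin_subset[OF op[OF that]] by (auto simp: pair_map_def)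
  show "\<exists>a\<in>cohom h n X A. \<forall>i\<in>I. ?r (W i) a = c i"
    if c: "\<And>i. i \<in> I \<Longrightarrow> c i \<in> cohom h n (subtopology X (W i)) (A \<inter> W i)"
  proof -
    define g where "g = (\<lambda>U\<in>W ` I. c (inv_into I W U))"
    have g: "g \<in> (\<Pi>\<^sub>E U\<in>W ` I. cohom h n (subtopology X U) (A \<inter> U))"
      unfolding g_def
    proof (rule restrict_PiE_iff[THEN iffD2], rule ballI)
      fix U assume "U \<in> W ` I"
      then show "c (inv_into I W U) \<in> cohom h n (subtopology X U) (A \<inter> U)"
        using c[of "inv_into I W U"] by (simp add: inv_into_into f_inv_into_f)
    qed
    then obtain a where a: "a \<in> cohom h n X A" "(\<lambda>U\<in>W ` I. ?r U a) = g"
      using bij_betw_onto[OF bij g] by blast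
    have "?r (W i) a = c i" if i: "i \<in> I" for i
    proof -
      let ?j = "inv_into I W (W i)"
      have j: "?j \<in> I" "W ?j = W i" using i by (auto simp: inv_into_into f_inv_into_f)
      have eq: "?r (W i) a = c ?j"
        using fun_cong[OF a(2), of "W i"] i by (simp add: g_def)
      show ?thesis
      proof (cases "?j = i")
        case False
        then have "W i = {}" using disj[OF j(1) i] j(2) by simp
        then have "c i = 0" "?r (W i) a = 0"
          using cohom_empty[of "subtopology X (W i)" _ n "A \<inter> W i"] c[OF i] induced_in[OF pm[OF i] a(1)]
          by auto
        then show ?thesis by simp
      qed (use eq in simp)
    qed
    then show ?thesis using a by blast
  qed
  show "a = 0" if a: "a \<in> cohom h n X A" "\<And>i. i \<in> I \<Longrightarrow> ?r (W i) a = 0"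
  proof -
    have "(\<lambda>U\<in>W ` I. ?r U a) = (\<lambda>U\<in>W ` I. ?r U 0)"
      using a(2) induced_zero[OF pm] by (auto simp: restrict_def fun_eq_iff)
    then show ?thesis
      by (rule bij_betw_eq[OF bij a(1) cohom_zero[OF A]])
  qed
qed

section \<open>Restrictions between pairs of subsets of one space\<close>

lemma res_in: "sub_pair Y P Q P' Q' \<Longrightarrow> a \<in> H n Y P Q \<Longrightarrow> res n Y P Q P' Q' a \<in> H n Y P' Q'"
  unfolding restriction_def by (intro induced_in sub_pair_map)

lemma res_linear: "sub_pair Y P Q P' Q' \<Longrightarrow>
    linear_between (scale h) (H n Y P Q) (H n Y P' Q') (res n Y P Q P' Q')"
  unfolding restriction_def by (intro induced_linear sub_pair_map)

lemma res_add: "sub_pair Y P Q P' Q' \<Longrightarrow> a \<in> H n Y P Q \<Longrightarrow> b \<in> H n Y P Q \<Longrightarrow>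
    res n Y P Q P' Q' (a + b) = res n Y P Q P' Q' a + res n Y P Q P' Q' b"
  unfolding restriction_def by (intro induced_add sub_pair_map)

lemma res_diff: "sub_pair Y P Q P' Q' \<Longrightarrow> a \<in> H n Y P Q \<Longrightarrow> b \<in> H n Y P Q \<Longrightarrow>
    res n Y P Q P' Q' (a - b) = res n Y P Q P' Q' a - res n Y P Q P' Q' b"
  unfolding restriction_def by (intro induced_diff sub_pair_map)

lemma res_zero: "sub_pair Y P Q P' Q' \<Longrightarrow> res n Y P Q P' Q' 0 = 0"
  unfolding restriction_def by (intro induced_zero sub_pair_map)

lemma res_scale: "sub_pair Y P Q P' Q' \<Longrightarrow> a \<in> H n Y P Q \<Longrightarrow>
    res n Y P Q P' Q' (scale h c a) = scale h c (res n Y P Q P' Q' a)"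
  unfolding restriction_def by (intro induced_scale sub_pair_map)

lemma res_id: "P \<subseteq> topspace Y \<Longrightarrow> Q \<subseteq> P \<Longrightarrow> a \<in> H n Y P Q \<Longrightarrow> res n Y P Q P Q a = a"
  unfolding restriction_def by (intro induced_id) auto

lemma res_comp: "sub_pair Y P Q P' Q' \<Longrightarrow> sub_pair Y P' Q' P'' Q'' \<Longrightarrow> a \<in> H n Y P Q \<Longrightarrow>
    res n Y P' Q' P'' Q'' (res n Y P Q P' Q' a) = res n Y P Q P'' Q'' a"
  unfolding restriction_def using induced_comp[OF sub_pair_map sub_pair_map] by fastforce

lemma H_add: "Q \<subseteq> P \<Longrightarrow> P \<subseteq> topspace Y \<Longrightarrow> a \<in> H n Y P Q \<Longrightarrow> b \<in> H n Y P Q \<Longrightarrow> a + b \<in> H n Y P Q"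
  and H_diff: "Q \<subseteq> P \<Longrightarrow> P \<subseteq> topspace Y \<Longrightarrow> a \<in> H n Y P Q \<Longrightarrow> b \<in> H n Y P Q \<Longrightarrow> a - b \<in> H n Y P Q"
  and H_neg: "Q \<subseteq> P \<Longrightarrow> P \<subseteq> topspace Y \<Longrightarrow> a \<in> H n Y P Q \<Longrightarrow> - a \<in> H n Y P Q"
  and H_subspace: "Q \<subseteq> P \<Longrightarrow> P \<subseteq> topspace Y \<Longrightarrow> vs.subspace (H n Y P Q)"
  by (simp_all add: cohom_zero cohom_add cohom_diff cohom_neg subspace order_trans[of Q P "topspace Y"])

text \<open>In the long exact sequence of \<open>(P, P)\<close> the restriction to the subspace is
  the identity. So forgetting the subspace gives zero, the class is a connecting image, and the
  connecting map is zero as well.\<close>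

lemma res_self_zero:
  assumes "P \<subseteq> topspace Y" "a \<in> H n Y P P"
  shows "a = 0"
proof -
  let ?X = "subtopology Y P"
  have P: "P \<subseteq> topspace ?X" "subtopology ?X P = ?X"
    using assms by (auto simp: subtopology_subtopology)
  have j: "induced h n ?X {} ?X P id a \<in> cohom h n ?X {}"
    using induced_in[OF pair_map_outer[OF P(1)] assms(2)] .
  have "induced h n ?X {} ?X P id a = 0"
    using inner_outer_zero[OF P(1) assms(2)] j induced_id[of "{}" ?X] P(2) by simp
  then obtain b where b: "b \<in> cohom h (n - 1) ?X {}" "connect h (n - 1) ?X P b = a"
    using lift_to_subspace[OF P(1) assms(2)] P(2) by metis
  then show ?thesis
    using connect_inner_zero[OF P(1) b(1)] induced_id[OF _ b(1)] P(2) by simp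
qed

lemma connect_res:
  assumes "sub_pair Y P Q P' Q'" "a \<in> H n Y Q {}"
  shows "connect h n (subtopology Y P') Q' (res n Y Q {} Q' {} a) =
    res (n + 1) Y P Q P' Q' (connect h n (subtopology Y P) Q a)"
  using connect_natural[OF sub_pair_map[OF assms(1)], of a n] assms
  by (simp add: restriction_def subtopology_nested sub_pair_def)

text \<open>The open set \<open>G\<close> between the closed set \<open>Z\<close> and
  \<open>Q\<close> certifies that the closure of \<open>Z\<close> lies in the interior of
  \<open>Q\<close>.\<close>

lemma restriction_excision:
  assumes "Q \<subseteq> P" "P \<subseteq> topspace Y" "Z \<subseteq> G" "G \<subseteq> Q"
    and "openin (subtopology Y P) G" "closedin (subtopology Y P) Z"
  shows "bij_betw (res n Y P Q (P - Z) (Q - Z)) (H n Y P Q) (H n Y (P - Z) (Q - Z))"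
proof -
  let ?X = "subtopology Y P"
  have top: "topspace ?X = P" using assms(2) by auto
  have cl: "?X closure_of Z = Z" by (simp add: assms(6) closure_of_closedin)
  have "G \<subseteq> ?X interior_of Q" using assms(4,5) by (simp add: interior_of_maximal)
  then have "bij_betw (induced h n (subtopology ?X (topspace ?X - Z)) (Q - Z) ?X Q id)
        (cohom h n ?X Q) (cohom h n (subtopology ?X (topspace ?X - Z)) (Q - Z))"
    by (intro excision) (use assms top cl in auto)
  then show ?thesis
    unfolding restriction_def top by (simp add: subtopology_nested)
qed

lemma res_into_subset_zero:
  assumes "sub_pair Y P Q P' {}" "P' \<subseteq> Q" "a \<in> H n Y P Q"
  shows "res n Y P Q P' {} a = 0"
proof -
  have sp: "sub_pair Y P Q P' P'" "sub_pair Y P' P' P' {}"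
    using assms(1,2) by (auto simp: sub_pair_def)
  have "res n Y P Q P' P' a = 0"
    using res_self_zero[OF _ res_in[OF sp(1) assms(3)]] assms(1) by (auto simp: sub_pair_def)
  then show ?thesis
    using res_comp[OF sp assms(3)] res_zero[OF sp(2)] by simp
qed

section \<open>The long exact sequence of a pair, in terms of restrictions\<close>

context
  fixes Y :: "'u topology" and P Q :: "'u set"
  assumes PQ: "Q \<subseteq> P" "P \<subseteq> topspace Y"
begin

lemma topspace_pair: "topspace (subtopology Y P) = P" "Q \<subseteq> topspace (subtopology Y P)"
  using PQ by auto

lemma res_lift_to_relative:
  assumes "a \<in> H n Y P {}" "res n Y P {} Q {} a = 0"
  obtains b where "b \<in> H n Y P Q" "res n Y P Q P {} b = a"
  using lift_to_relative[OF topspace_pair(2) assms(1)] assms(2)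
  by (auto simp: restriction_def subtopology_nested PQ)

lemma connect_in_H:
  assumes "a \<in> H n Y Q {}"
  shows "connect h n (subtopology Y P) Q a \<in> H (n + 1) Y P Q"
  using connect_in[OF topspace_pair(2), of a n] assms by (simp add: subtopology_nested PQ)

lemma res_extend_from_subspace:
  assumes "a \<in> H n Y Q {}" "connect h n (subtopology Y P) Q a = 0"
  obtains b where "b \<in> H n Y P {}" "res n Y P {} Q {} b = a"
  using extend_from_subspace[OF topspace_pair(2), of a n] assms
  by (auto simp: restriction_def subtopology_nested PQ)

lemma connect_res_zero:
  assumes "b \<in> H n Y P {}"
  shows "connect h n (subtopology Y P) Q (res n Y P {} Q {} b) = 0"
  using connect_inner_zero[OF topspace_pair(2) assms]
  by (simp add: restriction_def subtopology_nested PQ)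

lemma res_connect_zero:
  assumes "a \<in> H n Y Q {}"
  shows "res (n + 1) Y P Q P {} (connect h n (subtopology Y P) Q a) = 0"
  using outer_connect_zero[OF topspace_pair(2), of a n] assms
  by (simp add: restriction_def subtopology_nested PQ)

lemma res_lift_to_subspace:
  assumes "a \<in> H n Y P Q" "res n Y P Q P {} a = 0"
  obtains b where "b \<in> H (n - 1) Y Q {}" "connect h (n - 1) (subtopology Y P) Q b = a"
  using lift_to_subspace[OF topspace_pair(2) assms(1)] assms(2)
  by (auto simp: restriction_def subtopology_nested PQ)

end

section \<open>Absolute Mayer-Vietoris for two open sets\<close>

context
  fixes Y :: "'u topology" and U V :: "'u set"
  assumes opU: "openin Y U" and opV: "openin Y V"
begin

lemma open_cover_sub_pairs:
  shows "U \<union> V \<subseteq> topspace Y"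
    and "sub_pair Y (U \<union> V) V U (U \<inter> V)" and "sub_pair Y (U \<union> V) {} U {}"
    and "sub_pair Y (U \<union> V) {} V {}" and "sub_pair Y U {} (U \<inter> V) {}"
    and "sub_pair Y V {} (U \<inter> V) {}" and "sub_pair Y (U \<union> V) V (U \<union> V) {}"
    and "sub_pair Y U (U \<inter> V) U {}"
  using openin_subset[OF opU] openin_subset[OF opV] by (auto simp: sub_pair_def)

text \<open>Here \<open>V - U\<close> is excised: it is closed in the union because \<open>U\<close>
  is open, and \<open>V\<close> itself is the open set around it.\<close>

lemma open_cover_excision:
  "bij_betw (res n Y (U \<union> V) V U (U \<inter> V)) (H n Y (U \<union> V) V) (H n Y U (U \<inter> V))"
proof -
  have "bij_betw (res n Y (U \<union> V) V (U \<union> V - (V - U)) (V - (V - U)))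
     (H n Y (U \<union> V) V) (H n Y (U \<union> V - (V - U)) (V - (V - U)))"
  proof (rule restriction_excision[where G = V])
    show "openin (subtopology Y (U \<union> V)) V"
      using opV by (simp add: openin_subtopology_Un openin_open_subtopology opU openin_Un)
    have "openin (subtopology Y (U \<union> V)) U"
      using opU opV by (simp add: openin_open_subtopology openin_Un)
    then have "closedin (subtopology Y (U \<union> V)) (topspace (subtopology Y (U \<union> V)) - U)"
      by blast
    moreover have "topspace (subtopology Y (U \<union> V)) - U = V - U"
      using open_cover_sub_pairs(1) by auto
    ultimately show "closedin (subtopology Y (U \<union> V)) (V - U)" by simp
  qed (use open_cover_sub_pairs(1) in auto)
  moreover have "U \<union> V - (V - U) = U" "V - (V - U) = U \<inter> V" by auto
  ultimately show ?thesis by simp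
qed

lemma open_cover_excision_zero:
  assumes "a \<in> H n Y (U \<union> V) V" "res n Y (U \<union> V) V U (U \<inter> V) a = 0"
  shows "a = 0"
  using bij_betw_induced_zero[OF open_cover_excision[unfolded restriction_def]
      sub_pair_map[OF open_cover_sub_pairs(2)] assms(1)] assms(2)
  by (simp add: restriction_def)

text \<open>The obstruction to extending \<open>b\<close> over the union is its connecting class,
  which by excision can be tested on \<open>U\<close>. There it is the connecting class of the
  common restriction, and this vanishes because \<open>a\<close> extends it. The extension so found
  is corrected on \<open>U\<close> by a class relative to \<open>V\<close>, which does not affect
  its restriction to \<open>V\<close>.\<close>

lemma mayer_vietoris_glue:
  assumes a: "a \<in> H n Y U {}" and b: "b \<in> H n Y V {}"
    and eq: "res n Y U {} (U \<inter> V) {} a = res n Y V {} (U \<inter> V) {} b"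
  obtains c where "c \<in> H n Y (U \<union> V) {}" "res n Y (U \<union> V) {} U {} c = a" "res n Y (U \<union> V) {} V {} c = b"
proof -
  note sp = open_cover_sub_pairs
  have top: "V \<subseteq> U \<union> V" "U \<union> V \<subseteq> topspace Y" "U \<inter> V \<subseteq> U" "U \<subseteq> topspace Y"
    using sp(1) by auto
  let ?d = "connect h n (subtopology Y (U \<union> V)) V b"
  have "res (n + 1) Y (U \<union> V) V U (U \<inter> V) ?d = 0"
    using connect_res[OF sp(2) b] eq connect_res_zero[OF top(3,4) a] by simp
  then have "?d = 0"
    using open_cover_excision_zero connect_in_H[OF top(1,2) b] by blast
  then obtain c0 where c0: "c0 \<in> H n Y (U \<union> V) {}" "res n Y (U \<union> V) {} V {} c0 = b"
    using res_extend_from_subspace[OF top(1,2) b] by blast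
  let ?c0U = "res n Y (U \<union> V) {} U {} c0"
  have c0U: "?c0U \<in> H n Y U {}" by (rule res_in[OF sp(3) c0(1)])
  have e: "?c0U - a \<in> H n Y U {}" using H_diff[OF _ top(4) c0U a] by simp
  have "res n Y U {} (U \<inter> V) {} (?c0U - a) = 0"
    using res_diff[OF sp(5) c0U a] res_comp[OF sp(3,5) c0(1)] res_comp[OF sp(4,6) c0(1)] c0(2) eq
    by simp
  then obtain e1 where e1: "e1 \<in> H n Y U (U \<inter> V)" "res n Y U (U \<inter> V) U {} e1 = ?c0U - a"
    using res_lift_to_relative[OF top(3,4) e] by blast
  obtain e2 where e2: "e2 \<in> H n Y (U \<union> V) V" "res n Y (U \<union> V) V U (U \<inter> V) e2 = e1"
    using bij_betw_onto[OF open_cover_excision e1(1)] by blast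
  let ?e3 = "res n Y (U \<union> V) V (U \<union> V) {} e2"
  have e3: "?e3 \<in> H n Y (U \<union> V) {}" by (rule res_in[OF sp(7) e2(1)])
  have U: "res n Y (U \<union> V) {} U {} ?e3 = ?c0U - a"
    using res_comp[OF sp(7,3) e2(1)] res_comp[OF sp(2,8) e2(1)] e1(2) e2(2) by simp
  have "sub_pair Y (U \<union> V) V V {}" using sp(1) by (auto simp: sub_pair_def)
  then have V: "res n Y (U \<union> V) {} V {} ?e3 = 0"
    using res_comp[OF sp(7,4) e2(1)] res_into_subset_zero[OF _ _ e2(1), of V] by simp
  show thesis
  proof (rule that)
    show "c0 - ?e3 \<in> H n Y (U \<union> V) {}"
      using H_diff[OF _ top(2) c0(1) e3] by simp
    show "res n Y (U \<union> V) {} U {} (c0 - ?e3) = a"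
      using res_diff[OF sp(3) c0(1) e3] U by simp
    show "res n Y (U \<union> V) {} V {} (c0 - ?e3) = b"
      using res_diff[OF sp(4) c0(1) e3] V c0(2) by simp
  qed
qed

text \<open>A class that vanishes on both sets comes, in the Mayer-Vietoris sequence, from the
  overlap in degree \<open>n - 1\<close>. By \<open>surj\<close> every class there is a difference
  of restrictions, and these go to zero.\<close>

lemma mayer_vietoris_injective:
  assumes surj: "\<And>d. d \<in> H (n - 1) Y (U \<inter> V) {} \<Longrightarrow> \<exists>a\<in>H (n - 1) Y U {}. \<exists>b\<in>H (n - 1) Y V {}.
      d = res (n - 1) Y U {} (U \<inter> V) {} a - res (n - 1) Y V {} (U \<inter> V) {} b"
    and c: "c \<in> H n Y (U \<union> V) {}" "res n Y (U \<union> V) {} U {} c = 0" "res n Y (U \<union> V) {} V {} c = 0"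
  shows "c = 0"
proof -
  note sp = open_cover_sub_pairs
  have top: "V \<subseteq> U \<union> V" "U \<union> V \<subseteq> topspace Y" "U \<inter> V \<subseteq> U" "U \<subseteq> topspace Y" "V \<subseteq> topspace Y"
    using sp(1) by auto
  obtain c1 where c1: "c1 \<in> H n Y (U \<union> V) V" "res n Y (U \<union> V) V (U \<union> V) {} c1 = c"
    using res_lift_to_relative[OF top(1,2) c(1,3)] by blast
  let ?c1U = "res n Y (U \<union> V) V U (U \<inter> V) c1"
  have "res n Y U (U \<inter> V) U {} ?c1U = 0"
    using res_comp[OF sp(7,3) c1(1)] res_comp[OF sp(2,8) c1(1)] c1(2) c(2) by simp
  then obtain d where d: "d \<in> H (n - 1) Y (U \<inter> V) {}" "connect h (n - 1) (subtopology Y U) (U \<inter> V) d = ?c1U"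
    using res_lift_to_subspace[OF top(3,4) res_in[OF sp(2) c1(1)]] by blast
  obtain a b where ab: "a \<in> H (n - 1) Y U {}" "b \<in> H (n - 1) Y V {}"
      "d = res (n - 1) Y U {} (U \<inter> V) {} a - res (n - 1) Y V {} (U \<inter> V) {} b"
    using surj[OF d(1)] by blast
  let ?\<delta>U = "connect h (n - 1) (subtopology Y U) (U \<inter> V)"
  let ?\<delta> = "connect h (n - 1) (subtopology Y (U \<union> V)) V"
  let ?aW = "res (n - 1) Y U {} (U \<inter> V) {} a" and ?bW = "res (n - 1) Y V {} (U \<inter> V) {} b"
  have W: "?aW \<in> H (n - 1) Y (U \<inter> V) {}" "?bW \<in> H (n - 1) Y (U \<inter> V) {}"
    using res_in[OF sp(5) ab(1)] res_in[OF sp(6) ab(2)] by auto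
  have WU: "U \<inter> V \<subseteq> topspace (subtopology Y U)" using top by auto
  have nested: "subtopology (subtopology Y U) (U \<inter> V) = subtopology Y (U \<inter> V)"
    by (simp add: subtopology_nested)
  have db: "?\<delta> b \<in> H n Y (U \<union> V) V" using connect_in_H[OF top(1,2) ab(2)] by simp
  have mdb: "- ?\<delta> b \<in> H n Y (U \<union> V) V" by (rule H_neg[OF top(1,2) db])
  \<comment> \<open>The term from \<open>a\<close> drops out because \<open>a\<close> lives on all
    of \<open>U\<close>; the term from \<open>b\<close> is the restriction of a connecting class on
    the union.\<close>
  have "?\<delta>U d = ?\<delta>U ?aW - ?\<delta>U ?bW"
    unfolding ab(3) by (rule connect_diff[OF WU]) (use W nested in simp_all)
  also have "\<dots> = - res n Y (U \<union> V) V U (U \<inter> V) (?\<delta> b)"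
    using connect_res_zero[OF top(3,4) ab(1)] connect_res[OF sp(2) ab(2)] by simp
  finally have "res n Y (U \<union> V) V U (U \<inter> V) (c1 + ?\<delta> b) = 0"
    using res_add[OF sp(2) c1(1) db] d(2) by simp
  then have "c1 + ?\<delta> b = 0"
    using open_cover_excision_zero H_add[OF top(1,2) c1(1) db] by blast
  then have "c + res n Y (U \<union> V) V (U \<union> V) {} (?\<delta> b) = 0"
    using res_add[OF sp(7) c1(1) db] res_zero[OF sp(7)] c1(2) by simp
  then show "c = 0"
    using res_connect_zero[OF top(1,2) ab(2)] by simp
qed

end

end

section \<open>Subspaces of the product with the line\<close>

locale cylinder_theory = cohomology_theory h
  for h :: "('k::field, 'v::ab_group_add, 'u) cohomology_data" +
  fixes code :: "'u \<times> real \<Rightarrow> 'u" and X :: "'u topology"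
  assumes inj_code: "inj code"
begin

abbreviation "Y \<equiv> times_line code X"
abbreviation "cyl P \<equiv> code ` P"
abbreviation "proj \<equiv> fst \<circ> inv code"
abbreviation "height \<equiv> snd \<circ> inv code"

lemma inv_code [simp]: "inv code (code z) = z"
  using inj_code by simp

lemma topspace_Y: "topspace Y = cyl (topspace X \<times> UNIV)"
  unfolding times_line_def topspace_pullback_topology by force

lemma cyl_subset_topspace: "P \<subseteq> topspace X \<times> UNIV \<Longrightarrow> cyl P \<subseteq> topspace Y"
  unfolding topspace_Y by blast

lemma topspace_cyl: "P \<subseteq> topspace X \<times> UNIV \<Longrightarrow> topspace (subtopology Y (cyl P)) = cyl P"
  using cyl_subset_topspace by auto

lemma continuous_map_inv_code: "continuous_map Y (prod_topology X euclideanreal) (inv code)"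
proof -
  have "continuous_map Y (prod_topology X euclideanreal) (id \<circ> inv code)"
    unfolding times_line_def by (rule continuous_map_pullback) (rule continuous_map_id)
  then show ?thesis by simp
qed

lemma continuous_map_proj: "continuous_map Y X proj"
  using continuous_map_compose[OF continuous_map_inv_code continuous_map_fst] .

lemma continuous_map_height: "continuous_map Y euclideanreal height"
  using continuous_map_compose[OF continuous_map_inv_code continuous_map_snd] .

lemma continuous_map_code:
  assumes "continuous_map W X a" "continuous_map W euclideanreal t"
  shows "continuous_map W Y (\<lambda>w. code (a w, t w))"
  unfolding times_line_def
proof (rule continuous_map_pullback')
  show "continuous_map W (prod_topology X euclideanreal) (inv code \<circ> (\<lambda>w. code (a w, t w)))"
    using assms by (simp add: o_def continuous_map_pairwise)
qed auto

lemma continuous_map_into_cyl: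
  assumes "continuous_map W X a" "continuous_map W euclideanreal t"
    and "\<And>w. w \<in> topspace W \<Longrightarrow> (a w, t w) \<in> P"
  shows "continuous_map W (subtopology Y (cyl P)) (\<lambda>w. code (a w, t w))"
  using continuous_map_code[OF assms(1,2)] assms(3) by (auto simp: continuous_map_in_subtopology)

lemma openin_cyl:
  assumes "P \<subseteq> topspace X \<times> UNIV" "openin X U" "open S"
  shows "openin (subtopology Y (cyl P)) (cyl {(a, t) \<in> P. a \<in> U \<and> t \<in> S})"
proof -
  have "openin Y {z \<in> topspace Y. proj z \<in> U}" "openin Y {z \<in> topspace Y. height z \<in> S}"
    using openin_continuous_map_preimage[OF continuous_map_proj assms(2)]
      openin_continuous_map_preimage[OF continuous_map_height] assms(3) by auto
  then have op: "openin Y ({z \<in> topspace Y. proj z \<in> U} \<inter> {z \<in> topspace Y. height z \<in> S})"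
    by (rule openin_Int)
  have eq: "cyl {(a, t) \<in> P. a \<in> U \<and> t \<in> S} =
      cyl P \<inter> ({z \<in> topspace Y. proj z \<in> U} \<inter> {z \<in> topspace Y. height z \<in> S})"
  proof (rule set_eqI, rule iffI)
    fix z assume "z \<in> cyl {(a, t) \<in> P. a \<in> U \<and> t \<in> S}"
    then obtain a t where z: "z = code (a, t)" "(a, t) \<in> P" "a \<in> U" "t \<in> S" by blast
    moreover have "z \<in> topspace Y" using z(1,2) assms(1) unfolding topspace_Y by blast
    ultimately show "z \<in> cyl P \<inter> ({z \<in> topspace Y. proj z \<in> U} \<inter> {z \<in> topspace Y. height z \<in> S})"
      by simp
  next
    fix z assume z: "z \<in> cyl P \<inter> ({z \<in> topspace Y. proj z \<in> U} \<inter> {z \<in> topspace Y. height z \<in> S})"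
    then obtain a t where "z = code (a, t)" "(a, t) \<in> P" by auto
    then show "z \<in> cyl {(a, t) \<in> P. a \<in> U \<and> t \<in> S}" using z by simp
  qed
  show ?thesis
    unfolding eq by (rule openin_subtopology_Int2[OF op])
qed

lemma cyl_diff: "cyl P - cyl Q = cyl (P - Q)"
  using inj_code by (simp add: image_set_diff)

lemma cyl_Int: "cyl P \<inter> cyl Q = cyl (P \<inter> Q)"
  using inj_code by (simp add: image_Int)

lemma closedin_cyl:
  assumes "P \<subseteq> topspace X \<times> UNIV" "openin X U" "open S"
  shows "closedin (subtopology Y (cyl P)) (cyl {(a, t) \<in> P. \<not> (a \<in> U \<and> t \<in> S)})"
proof -
  let ?O = "cyl {(a, t) \<in> P. a \<in> U \<and> t \<in> S}"
  have "closedin (subtopology Y (cyl P)) (topspace (subtopology Y (cyl P)) - ?O)"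
    using openin_cyl[OF assms] by blast
  moreover have "topspace (subtopology Y (cyl P)) - ?O = cyl {(a, t) \<in> P. \<not> (a \<in> U \<and> t \<in> S)}"
    unfolding topspace_cyl[OF assms(1)] cyl_diff by (rule arg_cong[where f = cyl]) auto
  ultimately show ?thesis by simp
qed

text \<open>Straight-line homotopy in the real coordinate over fixed points of \<open>X\<close>; the
  vertical segments to the new height have to stay in \<open>P\<close> and in
  \<open>Q\<close>.\<close>

lemma slide_homotopic:
  assumes P: "P \<subseteq> topspace X \<times> UNIV" "Q \<subseteq> P"
    and \<phi>: "continuous_map (subtopology Y (cyl P)) euclideanreal \<phi>"
    and segP: "\<And>a t \<tau>. (a, t) \<in> P \<Longrightarrow> 0 \<le> \<tau> \<Longrightarrow> \<tau> \<le> 1 \<Longrightarrow> (a, (1 - \<tau>) * t + \<tau> * \<phi> (code (a, t))) \<in> P"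
    and segQ: "\<And>a t \<tau>. (a, t) \<in> Q \<Longrightarrow> 0 \<le> \<tau> \<Longrightarrow> \<tau> \<le> 1 \<Longrightarrow> (a, (1 - \<tau>) * t + \<tau> * \<phi> (code (a, t))) \<in> Q"
  shows "homotopic_with (\<lambda>k. k ` cyl Q \<subseteq> cyl Q) (subtopology Y (cyl P)) (subtopology Y (cyl P))
    id (\<lambda>z. code (proj z, \<phi> z))"
proof -
  let ?Z = "subtopology Y (cyl P)"
  let ?I = "top_of_set {0..1::real}"
  have top: "topspace ?Z = cyl P" by (rule topspace_cyl[OF P(1)])
  \<comment> \<open>A homotopy is recorded by its values on the space alone, so the predicate on
    maps has to ignore values elsewhere.\<close>
  have cong: "(k ` cyl Q \<subseteq> cyl Q) = (k' ` cyl Q \<subseteq> cyl Q)"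
    if "\<And>z. z \<in> topspace ?Z \<Longrightarrow> k z = k' z" for k k' :: "'u \<Rightarrow> 'u"
  proof -
    have "k z = k' z" if "z \<in> cyl Q" for z
      using \<open>\<And>z. z \<in> topspace ?Z \<Longrightarrow> k z = k' z\<close>[of z] that P(2) unfolding top by blast
    then show ?thesis by auto
  qed
  define F where "F = (\<lambda>p. code (proj (snd p), (1 - fst p) * height (snd p) + fst p * \<phi> (snd p)))"
  have snd: "continuous_map (prod_topology ?I ?Z) ?Z snd"
    and fst': "continuous_map (prod_topology ?I ?Z) euclideanreal fst"
    by (rule continuous_map_snd, rule continuous_map_into_fulltopology[OF continuous_map_fst])
  have "continuous_map (prod_topology ?I ?Z) ?Z F"
    unfolding F_def
  proof (rule continuous_map_into_cyl)
    show "continuous_map (prod_topology ?I ?Z) X (\<lambda>p. proj (snd p))"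
      using continuous_map_compose[OF snd continuous_map_from_subtopology[OF continuous_map_proj]]
      by (simp add: o_def)
    have "continuous_map (prod_topology ?I ?Z) euclideanreal (\<lambda>p. height (snd p))"
      using continuous_map_compose[OF snd continuous_map_from_subtopology[OF continuous_map_height]]
      by (simp add: o_def)
    moreover have "continuous_map (prod_topology ?I ?Z) euclideanreal (\<lambda>p. \<phi> (snd p))"
      using continuous_map_compose[OF snd \<phi>] by (simp add: o_def)
    ultimately show "continuous_map (prod_topology ?I ?Z) euclideanreal
        (\<lambda>p. (1 - fst p) * height (snd p) + fst p * \<phi> (snd p))"
      using fst' by (intro continuous_intros) auto
    fix p assume "p \<in> topspace (prod_topology ?I ?Z)"
    then obtain \<tau> a t where "p = (\<tau>, code (a, t))" "0 \<le> \<tau>" "\<tau> \<le> 1" "(a, t) \<in> P"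
      unfolding topspace_prod_topology top by auto
    then show "(proj (snd p), (1 - fst p) * height (snd p) + fst p * \<phi> (snd p)) \<in> P"
      using segP by simp
  qed
  moreover have "F (0, z) = id z" "F (1, z) = code (proj z, \<phi> z)" if "z \<in> topspace ?Z" for z
    using that unfolding top F_def by auto
  moreover have "(\<lambda>z. F (\<tau>, z)) ` cyl Q \<subseteq> cyl Q" if "\<tau> \<in> {0..1}" for \<tau>
    using that segQ unfolding F_def by auto
  ultimately show ?thesis
    by (subst homotopic_with[OF cong]) blast+
qed

section \<open>Pulling back along the projection, and deformations in the real coordinate\<close>

definition pull :: "int \<Rightarrow> 'u set \<Rightarrow> 'u set \<Rightarrow> ('u \<times> real) set \<Rightarrow> ('u \<times> real) set \<Rightarrow> 'v \<Rightarrow> 'v" where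
  "pull n A B P Q = induced h n (subtopology Y (cyl P)) (cyl Q) (subtopology X A) B proj"

definition over :: "'u set \<Rightarrow> 'u set \<Rightarrow> ('u \<times> real) set \<Rightarrow> ('u \<times> real) set \<Rightarrow> bool" where
  "over A B P Q \<longleftrightarrow> A \<subseteq> topspace X \<and> B \<subseteq> A \<and> P \<subseteq> A \<times> UNIV \<and> Q \<subseteq> P \<and> Q \<subseteq> B \<times> UNIV"

lemma over_pair_map:
  assumes "over A B P Q"
  shows "pair_map (subtopology Y (cyl P)) (cyl Q) (subtopology X A) B proj"
proof -
  have P: "P \<subseteq> topspace X \<times> UNIV" using assms unfolding over_def by blast
  show ?thesis
    unfolding pair_map_def topspace_cyl[OF P]
    using assms continuous_map_from_subtopology[OF continuous_map_proj, of "cyl P"] cyl_subset_topspace[OF P]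
    by (auto simp: over_def continuous_map_in_subtopology)
qed

lemma over_sub_pair:
  assumes "over A B P Q" "P' \<subseteq> P" "Q' \<subseteq> Q" "Q' \<subseteq> P'"
  shows "sub_pair Y (cyl P) (cyl Q) (cyl P') (cyl Q')"
proof -
  have "P \<subseteq> topspace X \<times> UNIV" "Q \<subseteq> P" using assms unfolding over_def by blast+
  then show ?thesis
    using assms cyl_subset_topspace unfolding sub_pair_def by blast
qed

lemma pull_in: "over A B P Q \<Longrightarrow> a \<in> H n X A B \<Longrightarrow> pull n A B P Q a \<in> H n Y (cyl P) (cyl Q)"
  unfolding pull_def by (intro induced_in over_pair_map)

lemma pull_linear: "over A B P Q \<Longrightarrow>
    linear_between (scale h) (H n X A B) (H n Y (cyl P) (cyl Q)) (pull n A B P Q)"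
  unfolding pull_def by (intro induced_linear over_pair_map)

lemma pull_zero: "over A B P Q \<Longrightarrow> pull n A B P Q 0 = 0"
  unfolding pull_def by (intro induced_zero over_pair_map)

lemma pull_diff: "over A B P Q \<Longrightarrow> a \<in> H n X A B \<Longrightarrow> b \<in> H n X A B \<Longrightarrow>
    pull n A B P Q (a - b) = pull n A B P Q a - pull n A B P Q b"
  unfolding pull_def by (intro induced_diff over_pair_map)

lemma res_pull:
  assumes "over A B P Q" "P' \<subseteq> P" "Q' \<subseteq> Q" "Q' \<subseteq> P'" "a \<in> H n X A B"
  shows "res n Y (cyl P) (cyl Q) (cyl P') (cyl Q') (pull n A B P Q a) = pull n A B P' Q' a"
  using induced_comp[OF sub_pair_map[OF over_sub_pair[OF assms(1-4)]] over_pair_map[OF assms(1)] assms(5)]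
  unfolding pull_def restriction_def by simp

lemma pull_res:
  assumes "over A' B' P Q" "sub_pair X A B A' B'" "a \<in> H n X A B"
  shows "pull n A' B' P Q (res n X A B A' B' a) = pull n A B P Q a"
  using induced_comp[OF over_pair_map[OF assms(1)] sub_pair_map[OF assms(2)] assms(3)]
  unfolding pull_def restriction_def by simp

definition fiberwise_convex :: "('u \<times> real) set \<Rightarrow> bool" where
  "fiberwise_convex P \<longleftrightarrow> (\<forall>a t t' s. (a, t) \<in> P \<longrightarrow> (a, t') \<in> P \<longrightarrow> t \<le> s \<longrightarrow> s \<le> t' \<longrightarrow> (a, s) \<in> P)"

lemma fiberwise_convex_segment:
  assumes "fiberwise_convex P" "(a, t) \<in> P" "(a, t') \<in> P" "0 \<le> \<tau>" "\<tau> \<le> 1"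
  shows "(a, (1 - \<tau>) * t + \<tau> * t') \<in> P"
proof (cases "t \<le> t'")
  case True
  then have "t \<le> (1 - \<tau>) * t + \<tau> * t'" "(1 - \<tau>) * t + \<tau> * t' \<le> t'"
    using convex_bound_le[of t t' t' "1 - \<tau>" \<tau>] mult_left_mono[OF True assms(4)] assms(4,5)
    by (auto simp: algebra_simps)
  then show ?thesis
    using assms(1-3) unfolding fiberwise_convex_def by blast
next
  case False
  then have "t' \<le> (1 - \<tau>) * t + \<tau> * t'" "(1 - \<tau>) * t + \<tau> * t' \<le> t"
    using convex_bound_le[of t t t' "1 - \<tau>" \<tau>] mult_left_mono[of t' t "1 - \<tau>"] assms(4,5)
    by (auto simp: algebra_simps)
  then show ?thesis
    using assms(1-3) unfolding fiberwise_convex_def by blast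
qed

text \<open>The section \<open>s\<close> makes \<open>proj\<close> a homotopy equivalence of pairs:
  \<open>proj\<close> after the section is the identity, and the section after \<open>proj\<close>
  is deformed to the identity along the convex fibres. That the section maps \<open>B\<close> into
  \<open>Q\<close> makes it a map of pairs.\<close>

lemma pull_bij:
  assumes ov: "over A B P Q"
    and s: "continuous_map (subtopology X A) euclideanreal s"
    and sP: "\<And>a. a \<in> A \<Longrightarrow> (a, s a) \<in> P" and sQ: "\<And>a. a \<in> B \<Longrightarrow> (a, s a) \<in> Q"
    and conv: "fiberwise_convex P" "fiberwise_convex Q"
  shows "bij_betw (pull n A B P Q) (H n X A B) (H n Y (cyl P) (cyl Q))"
proof -
  note pm = over_pair_map[OF ov]
  have ov': "A \<subseteq> topspace X" "B \<subseteq> A" "P \<subseteq> A \<times> UNIV" "Q \<subseteq> P" "Q \<subseteq> B \<times> UNIV"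
    using ov unfolding over_def by auto
  have P: "P \<subseteq> topspace X \<times> UNIV" using ov' by blast
  have topA: "topspace (subtopology X A) = A" using ov' by auto
  let ?\<sigma> = "\<lambda>a. code (a, s a)"
  have pm\<sigma>: "pair_map (subtopology X A) B (subtopology Y (cyl P)) (cyl Q) ?\<sigma>"
    unfolding pair_map_def topspace_cyl[OF P] topA
  proof (intro conjI)
    show "continuous_map (subtopology X A) (subtopology Y (cyl P)) ?\<sigma>"
      by (rule continuous_map_into_cyl) (use s sP ov' in \<open>auto intro: continuous_map_from_subtopology\<close>)
  qed (use ov' sQ in auto)
  have id: "proj \<circ> ?\<sigma> = id" by auto
  have homot: "homotopic_with (\<lambda>k. k ` cyl Q \<subseteq> cyl Q) (subtopology Y (cyl P)) (subtopology Y (cyl P))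
      id (\<lambda>z. code (proj z, (s \<circ> proj) z))"
  proof (rule slide_homotopic[OF P ov'(4)])
    show "continuous_map (subtopology Y (cyl P)) euclideanreal (s \<circ> proj)"
      using pm s unfolding pair_map_def by (blast intro: continuous_map_compose)
    show "(a, (1 - \<tau>) * t + \<tau> * (s \<circ> proj) (code (a, t))) \<in> P"
      if "(a, t) \<in> P" "0 \<le> \<tau>" "\<tau> \<le> 1" for a t \<tau>
      using fiberwise_convex_segment[OF conv(1) that(1) _ that(2,3), of "s a"] sP[of a] that(1) ov'(3) by auto
    show "(a, (1 - \<tau>) * t + \<tau> * (s \<circ> proj) (code (a, t))) \<in> Q"
      if "(a, t) \<in> Q" "0 \<le> \<tau>" "\<tau> \<le> 1" for a t \<tau>
      using fiberwise_convex_segment[OF conv(2) that(1) _ that(2,3), of "s a"] sQ[of a] that(1) ov'(5) by auto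
  qed
  have eq: "(\<lambda>z. code (proj z, (s \<circ> proj) z)) = ?\<sigma> \<circ> proj" by auto
  have pmid: "pair_map (subtopology Y (cyl P)) (cyl Q) (subtopology Y (cyl P)) (cyl Q) id"
    using over_sub_pair[OF ov] ov'(4) by (intro sub_pair_map) simp
  have Q: "cyl Q \<subseteq> topspace (subtopology Y (cyl P))"
    using topspace_cyl[OF P] ov'(4) by blast
  show ?thesis
    unfolding pull_def
  proof (rule bij_betw_inducedI[OF pm])
    fix a assume a: "a \<in> H n X A B" "induced h n (subtopology Y (cyl P)) (cyl Q) (subtopology X A) B proj a = 0"
    have "a = induced h n (subtopology X A) B (subtopology X A) B (proj \<circ> ?\<sigma>) a"
      unfolding id using induced_id[of B "subtopology X A"] a(1) topA ov'(1,2) by auto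
    also have "\<dots> = 0"
      using induced_comp[OF pm\<sigma> pm a(1)] a(2) induced_zero[OF pm\<sigma>] by simp
    finally show "a = 0" .
  next
    fix b assume b: "b \<in> H n Y (cyl P) (cyl Q)"
    let ?a = "induced h n (subtopology X A) B (subtopology Y (cyl P)) (cyl Q) ?\<sigma> b"
    have "b = induced h n (subtopology Y (cyl P)) (cyl Q) (subtopology Y (cyl P)) (cyl Q) id b"
      using induced_id[OF Q b] by simp
    also have "\<dots> = induced h n (subtopology Y (cyl P)) (cyl Q) (subtopology Y (cyl P)) (cyl Q) (?\<sigma> \<circ> proj) b"
      using homotopy[OF pmid pair_map_comp[OF pm pm\<sigma>] _ b] homot unfolding eq by blast
    also have "\<dots> = induced h n (subtopology Y (cyl P)) (cyl Q) (subtopology X A) B proj ?a"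
      by (rule induced_comp[OF pm pm\<sigma> b])
    finally have fin: "b = induced h n (subtopology Y (cyl P)) (cyl Q) (subtopology X A) B proj ?a" .
    show "\<exists>a\<in>H n X A B. induced h n (subtopology Y (cyl P)) (cyl Q) (subtopology X A) B proj a = b"
      by (rule bexI[OF _ induced_in[OF pm\<sigma> b]]) (rule fin[symmetric])
  qed
qed

text \<open>Replacing the height \<open>t\<close> by \<open>\<sigma> t\<close> maps
  \<open>(P, Q')\<close> to \<open>(P, Q)\<close>. This is inverse to the inclusion up to homotopies
  of pairs, as the segments from \<open>t\<close> to \<open>\<sigma> t\<close> stay in each of the
  three sets.\<close>

lemma squeeze_bij:
  assumes P: "P \<subseteq> topspace X \<times> UNIV" "Q \<subseteq> Q'" "Q' \<subseteq> P"
    and \<sigma>: "continuous_on UNIV \<sigma>"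
    and segP: "\<And>a t \<tau>. (a, t) \<in> P \<Longrightarrow> 0 \<le> \<tau> \<Longrightarrow> \<tau> \<le> 1 \<Longrightarrow> (a, (1 - \<tau>) * t + \<tau> * \<sigma> t) \<in> P"
    and segQ: "\<And>a t \<tau>. (a, t) \<in> Q \<Longrightarrow> 0 \<le> \<tau> \<Longrightarrow> \<tau> \<le> 1 \<Longrightarrow> (a, (1 - \<tau>) * t + \<tau> * \<sigma> t) \<in> Q"
    and segQ': "\<And>a t \<tau>. (a, t) \<in> Q' \<Longrightarrow> 0 \<le> \<tau> \<Longrightarrow> \<tau> \<le> 1 \<Longrightarrow> (a, (1 - \<tau>) * t + \<tau> * \<sigma> t) \<in> Q'"
    and into: "\<And>a t. (a, t) \<in> Q' \<Longrightarrow> (a, \<sigma> t) \<in> Q"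
  shows "bij_betw (res n Y (cyl P) (cyl Q') (cyl P) (cyl Q)) (H n Y (cyl P) (cyl Q')) (H n Y (cyl P) (cyl Q))"
proof -
  let ?Z = "subtopology Y (cyl P)"
  let ?r = "\<lambda>z. code (proj z, (\<sigma> \<circ> height) z)"
  have top: "topspace ?Z = cyl P" by (rule topspace_cyl[OF P(1)])
  have sp: "sub_pair Y (cyl P) (cyl Q') (cyl P) (cyl Q)"
    using P cyl_subset_topspace[OF P(1)] unfolding sub_pair_def by blast
  note pmi = sub_pair_map[OF sp]
  have c\<phi>: "continuous_map ?Z euclideanreal (\<sigma> \<circ> height)"
    using continuous_map_compose[OF continuous_map_from_subtopology[OF continuous_map_height], of euclideanreal \<sigma>] \<sigma>
    by (simp add: continuous_map_iff_continuous2)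
  have pmr: "pair_map ?Z (cyl Q') ?Z (cyl Q) ?r"
    unfolding pair_map_def top
  proof (intro conjI)
    show "continuous_map ?Z ?Z ?r"
    proof (rule continuous_map_into_cyl[OF continuous_map_from_subtopology[OF continuous_map_proj] c\<phi>])
      fix z assume "z \<in> topspace ?Z"
      then show "(proj z, (\<sigma> \<circ> height) z) \<in> P"
        unfolding top using segP[of _ _ 1] by auto
    qed
  qed (use P into in auto)
  have hom: "homotopic_with (\<lambda>k. k ` cyl R \<subseteq> cyl R) ?Z ?Z id ?r"
    if "R \<subseteq> P" "\<And>a t \<tau>. (a, t) \<in> R \<Longrightarrow> 0 \<le> \<tau> \<Longrightarrow> \<tau> \<le> 1 \<Longrightarrow> (a, (1 - \<tau>) * t + \<tau> * \<sigma> t) \<in> R" for R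
    by (rule slide_homotopic[OF P(1) that(1) c\<phi>]) (use segP that(2) in auto)
  have Q: "cyl Q \<subseteq> topspace ?Z" "cyl Q' \<subseteq> topspace ?Z" "Q \<subseteq> P" using P unfolding top by auto
  show ?thesis
    unfolding restriction_def
  proof (rule bij_betw_inducedI[OF pmi])
    fix a assume a: "a \<in> H n Y (cyl P) (cyl Q')" "induced h n ?Z (cyl Q) ?Z (cyl Q') id a = 0"
    have "a = induced h n ?Z (cyl Q') ?Z (cyl Q') id a"
      using induced_id[OF Q(2) a(1)] by simp
    also have "\<dots> = induced h n ?Z (cyl Q') ?Z (cyl Q') ?r a"
      using homotopy[OF pair_map_id[OF Q(2)] pair_map_comp[OF pmr pmi] _ a(1)] hom[OF P(3) segQ']
      by simp
    also have "\<dots> = 0"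
      using induced_comp[OF pmr pmi a(1)] a(2) induced_zero[OF pmr] by simp
    finally show "a = 0" .
  next
    fix b assume b: "b \<in> H n Y (cyl P) (cyl Q)"
    have "b = induced h n ?Z (cyl Q) ?Z (cyl Q) id b"
      using induced_id[OF Q(1) b] by simp
    also have "\<dots> = induced h n ?Z (cyl Q) ?Z (cyl Q) ?r b"
      using homotopy[OF pair_map_id[OF Q(1)] pair_map_comp[OF pmi pmr] _ b] hom[OF Q(3) segQ]
      by simp
    also have "\<dots> = induced h n ?Z (cyl Q) ?Z (cyl Q') id (induced h n ?Z (cyl Q') ?Z (cyl Q) ?r b)"
      using induced_comp[OF pmi pmr b] by simp
    finally have fin: "b = induced h n ?Z (cyl Q) ?Z (cyl Q') id (induced h n ?Z (cyl Q') ?Z (cyl Q) ?r b)" .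
    show "\<exists>a\<in>H n Y (cyl P) (cyl Q'). induced h n ?Z (cyl Q) ?Z (cyl Q') id a = b"
      by (rule bexI[OF _ induced_in[OF pmr b]]) (rule fin[symmetric])
  qed
qed

end

section \<open>The differential of the relative Mayer--Vietoris sequence\<close>

context cylinder_theory
begin

abbreviation "dmc \<equiv> double_mapping_cylinder"

text \<open>For a cover this is \<open>M \<union> ends\<close> from the definition of the
  differential, and for the pair \<open>(C, E)\<close> taken twice it is \<open>S'\<close>; likewise
  \<open>with_start C E E\<close> is \<open>S\<^sub>0\<close>. The same lemmas thus serve the
  cylinder over the cover and the one over the intersection.\<close>

definition with_ends :: "'u set \<Rightarrow> 'u set \<Rightarrow> 'u set \<Rightarrow> 'u set \<Rightarrow> ('u \<times> real) set" where
  "with_ends A1 B1 A2 B2 = dmc B1 B2 \<union> (A1 \<times> {0} \<union> A2 \<times> {1})"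

definition with_start :: "'u set \<Rightarrow> 'u set \<Rightarrow> 'u set \<Rightarrow> ('u \<times> real) set" where
  "with_start A1 B1 B2 = dmc B1 B2 \<union> A1 \<times> {0}"

text \<open>A partition of unity, which makes the projection of a double mapping cylinder a homotopy
  equivalence.\<close>

definition separated :: "'u set \<Rightarrow> 'u set \<Rightarrow> bool" where
  "separated U V \<longleftrightarrow> (\<exists>l. continuous_map (subtopology X (U \<union> V)) euclideanreal l \<and>
     (\<forall>a\<in>U \<union> V. 0 \<le> l a \<and> l a \<le> 1 \<and> (a \<notin> V \<longrightarrow> l a = 0) \<and> (a \<notin> U \<longrightarrow> l a = 1)))"

definition mv_cover :: "'u set \<Rightarrow> 'u set \<Rightarrow> 'u set \<Rightarrow> 'u set \<Rightarrow> bool" where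
  "mv_cover A1 B1 A2 B2 \<longleftrightarrow> openin X A1 \<and> openin X A2 \<and> openin X B1 \<and> openin X B2 \<and>
     B1 \<subseteq> A1 \<and> B2 \<subseteq> A2 \<and> separated A1 A2 \<and> separated B1 B2"

text \<open>When one set contains the other, the section can stay at the end that belongs to the
  larger one.\<close>

lemma separated_absorb: "separated U (U \<union> V)" "separated (U \<union> V) V"
  unfolding separated_def
  by (rule exI[of _ "\<lambda>_. 1"], simp) (rule exI[of _ "\<lambda>_. 0"], simp)

lemma mv_cover_openD:
  assumes "mv_cover A1 B1 A2 B2"
  shows "A1 \<subseteq> topspace X" "A2 \<subseteq> topspace X" "B1 \<subseteq> A1" "B2 \<subseteq> A2"
  using assms openin_subset unfolding mv_cover_def by blast+

lemma mv_cover_Int: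
  assumes "mv_cover A1 B1 A2 B2"
  shows "mv_cover (A1 \<inter> A2) (B1 \<inter> B2) (A1 \<inter> A2) (B1 \<inter> B2)"
  using assms separated_absorb(1)[of "A1 \<inter> A2" "{}"] separated_absorb(1)[of "B1 \<inter> B2" "{}"]
  unfolding mv_cover_def by auto

lemma mv_cover_absorb:
  assumes "mv_cover A1 B1 A2 B2"
  shows "mv_cover A1 B1 (A1 \<union> A2) (B1 \<union> B2)" "mv_cover (A1 \<union> A2) (B1 \<union> B2) A2 B2"
  using assms separated_absorb unfolding mv_cover_def by auto

lemma dmc_iff: "(a, t) \<in> dmc P Q \<longleftrightarrow> a \<in> P \<and> t = 0 \<or> a \<in> P \<and> a \<in> Q \<and> 0 \<le> t \<and> t \<le> 1 \<or> a \<in> Q \<and> t = 1"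
  unfolding double_mapping_cylinder_def by auto

lemma dmc_same: "dmc C C = C \<times> {0..1}"
  by (auto simp: dmc_iff)

lemma with_ends_iff: "(a, t) \<in> with_ends A1 B1 A2 B2 \<longleftrightarrow> (a, t) \<in> dmc B1 B2 \<or> a \<in> A1 \<and> t = 0 \<or> a \<in> A2 \<and> t = 1"
  unfolding with_ends_def by auto

lemma with_start_iff: "(a, t) \<in> with_start A1 B1 B2 \<longleftrightarrow> (a, t) \<in> dmc B1 B2 \<or> a \<in> A1 \<and> t = 0"
  unfolding with_start_def by auto

lemma dmc_mono: "P \<subseteq> P' \<Longrightarrow> Q \<subseteq> Q' \<Longrightarrow> dmc P Q \<subseteq> dmc P' Q'"
  by (auto simp: dmc_iff)

lemma fiberwise_convex_dmc: "fiberwise_convex (dmc P Q)"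
  unfolding fiberwise_convex_def by (auto simp: dmc_iff)

lemma pull_dmc_absolute_bij:
  assumes "openin X U" "openin X V" "separated U V"
  shows "bij_betw (pull n (U \<union> V) {} (dmc U V) {}) (H n X (U \<union> V) {}) (H n Y (cyl (dmc U V)) {})"
proof -
  obtain l where l: "continuous_map (subtopology X (U \<union> V)) euclideanreal l"
     "\<And>a. a \<in> U \<union> V \<Longrightarrow> 0 \<le> l a \<and> l a \<le> 1 \<and> (a \<notin> V \<longrightarrow> l a = 0) \<and> (a \<notin> U \<longrightarrow> l a = 1)"
    using assms(3) unfolding separated_def by blast
  have "bij_betw (pull n (U \<union> V) {} (dmc U V) {}) (H n X (U \<union> V) {}) (H n Y (cyl (dmc U V)) (cyl {}))"
  proof (rule pull_bij[OF _ l(1)])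
    show "over (U \<union> V) {} (dmc U V) {}"
      using openin_subset[OF assms(1)] openin_subset[OF assms(2)] by (auto simp: over_def dmc_iff)
    show "(a, l a) \<in> dmc U V" if "a \<in> U \<union> V" for a
      using l(2)[OF that] that by (auto simp: dmc_iff)
  qed (auto simp: fiberwise_convex_dmc, simp add: fiberwise_convex_def)
  then show ?thesis by simp
qed

lemma over_dmc:
  assumes "mv_cover A1 B1 A2 B2"
  shows "over (A1 \<union> A2) (B1 \<union> B2) (dmc A1 A2) (dmc B1 B2)"
  using mv_cover_openD[OF assms] dmc_mono unfolding over_def by (auto simp: dmc_iff)

text \<open>The partition of unity for \<open>A1, A2\<close> need not restrict to one for
  \<open>B1, B2\<close>, so a common section for the pair is not at hand. The five lemma asks only
  for one section on each level.\<close>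

lemma pull_dmc_bij:
  assumes "mv_cover A1 B1 A2 B2"
  shows "bij_betw (pull n (A1 \<union> A2) (B1 \<union> B2) (dmc A1 A2) (dmc B1 B2))
     (H n X (A1 \<union> A2) (B1 \<union> B2)) (H n Y (cyl (dmc A1 A2)) (cyl (dmc B1 B2)))"
  unfolding pull_def
proof (rule five_lemma_pair[OF over_pair_map[OF over_dmc[OF assms]]])
  note D = mv_cover_openD[OF assms]
  have cover: "openin X A1" "openin X A2" "separated A1 A2" "openin X B1" "openin X B2" "separated B1 B2"
    using assms unfolding mv_cover_def by auto
  have sub: "cyl (dmc B1 B2) \<subseteq> cyl (dmc A1 A2)" "B1 \<union> B2 \<subseteq> A1 \<union> A2"
    using dmc_mono[OF D(3,4)] D by auto
  show "bij_betw (induced h n (subtopology Y (cyl (dmc A1 A2))) {} (subtopology X (A1 \<union> A2)) {} proj)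
      (H n X (A1 \<union> A2) {}) (H n Y (cyl (dmc A1 A2)) {})" for n
    using pull_dmc_absolute_bij[OF cover(1-3), of n] by (simp add: pull_def)
  show "bij_betw (induced h n (subtopology (subtopology Y (cyl (dmc A1 A2))) (cyl (dmc B1 B2))) {}
        (subtopology (subtopology X (A1 \<union> A2)) (B1 \<union> B2)) {} proj)
      (cohom h n (subtopology (subtopology X (A1 \<union> A2)) (B1 \<union> B2)) {})
      (cohom h n (subtopology (subtopology Y (cyl (dmc A1 A2))) (cyl (dmc B1 B2))) {})" for n
    unfolding subtopology_nested[OF sub(1)] subtopology_nested[OF sub(2)]
    using pull_dmc_absolute_bij[OF cover(4-6), of n] by (simp add: pull_def)
qed

section \<open>Excision at the ends of a double mapping cylinder\<close>

definition stretch :: "real \<Rightarrow> real" where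
  "stretch t = max 0 (min 1 (3 * t - 1))"

lemma stretch_simps: "t \<le> 1/3 \<Longrightarrow> stretch t = 0" "2/3 \<le> t \<Longrightarrow> stretch t = 1"
  "0 \<le> stretch t" "stretch t \<le> 1"
  by (auto simp: stretch_def)

lemma convex_bounds_01:
  assumes "0 \<le> t" "t \<le> 1" "0 \<le> \<tau>" "\<tau> \<le> (1::real)"
  shows "0 \<le> (1 - \<tau>) * t + \<tau> * stretch t" "(1 - \<tau>) * t + \<tau> * stretch t \<le> 1"
  using assms stretch_simps(3,4) convex_bound_le[of t 1 "stretch t" "1 - \<tau>" \<tau>] by auto

text \<open>Excision needs an open set around the part that does not lie over the intersection, and
  the end slices alone provide none in general. The open collars of width 1/3 do, and
  \<open>stretch\<close>, which is constant on the outer thirds, pushes them back onto the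
  ends.\<close>

definition with_collars :: "'u set \<Rightarrow> 'u set \<Rightarrow> 'u set \<Rightarrow> ('u \<times> real) set" where
  "with_collars A1 A2 E = {(a, t) \<in> dmc A1 A2. a \<in> E \<or> t < 1/3 \<or> 2/3 < t}"

lemma squeeze_collars_bij:
  assumes "mv_cover A1 B1 A2 B2"
  shows "bij_betw (res n Y (cyl (dmc A1 A2)) (cyl (with_collars A1 A2 (B1 \<inter> B2)))
        (cyl (dmc A1 A2)) (cyl (with_ends A1 B1 A2 B2)))
      (H n Y (cyl (dmc A1 A2)) (cyl (with_collars A1 A2 (B1 \<inter> B2))))
      (H n Y (cyl (dmc A1 A2)) (cyl (with_ends A1 B1 A2 B2)))"
proof (rule squeeze_bij[where \<sigma> = stretch])
  note D = mv_cover_openD[OF assms]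
  show "dmc A1 A2 \<subseteq> topspace X \<times> UNIV" using D by (auto simp: dmc_iff)
  show "with_ends A1 B1 A2 B2 \<subseteq> with_collars A1 A2 (B1 \<inter> B2)"
    using D by (auto simp: with_ends_iff with_collars_def dmc_iff)
  show "with_collars A1 A2 (B1 \<inter> B2) \<subseteq> dmc A1 A2"
    by (auto simp: with_collars_def)
  show "continuous_on UNIV stretch"
    unfolding stretch_def by (intro continuous_intros)
  show segN: "(a, (1 - \<tau>) * t + \<tau> * stretch t) \<in> dmc A1 A2"
    if "(a, t) \<in> dmc A1 A2" "0 \<le> \<tau>" "\<tau> \<le> 1" for a t \<tau>
    using that convex_bounds_01[of t \<tau>] stretch_simps(1)[of 0] stretch_simps(2)[of 1]
    by (auto simp: dmc_iff)
  show "(a, (1 - \<tau>) * t + \<tau> * stretch t) \<in> with_ends A1 B1 A2 B2"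
    if "(a, t) \<in> with_ends A1 B1 A2 B2" "0 \<le> \<tau>" "\<tau> \<le> 1" for a t \<tau>
    using that convex_bounds_01[of t \<tau>] stretch_simps(1)[of 0] stretch_simps(2)[of 1]
    by (auto simp: dmc_iff with_ends_iff)
  \<comment> \<open>Inside a collar \<open>stretch\<close> moves towards the nearer end, so the
    segment does not leave the collar.\<close>
  show "(a, (1 - \<tau>) * t + \<tau> * stretch t) \<in> with_collars A1 A2 (B1 \<inter> B2)"
    if "(a, t) \<in> with_collars A1 A2 (B1 \<inter> B2)" "0 \<le> \<tau>" "\<tau> \<le> 1" for a t \<tau>
  proof -
    have t: "(a, t) \<in> dmc A1 A2" "0 \<le> t" "t \<le> 1"
      using that(1) by (auto simp: with_collars_def dmc_iff)
    have "a \<in> B1 \<inter> B2 \<or> t < 1/3 \<or> 2/3 < t"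
      using that(1) unfolding with_collars_def by blast
    then consider "a \<in> B1 \<inter> B2" | "t < 1/3" | "2/3 < t" by blast
    then show ?thesis
    proof cases
      case 2
      then have "(1 - \<tau>) * t + \<tau> * stretch t \<le> t"
        using stretch_simps(1)[of t] that(2,3) t(2) by (simp add: mult_left_le_one_le)
      then show ?thesis using segN[OF t(1) that(2,3)] 2 by (simp add: with_collars_def)
    next
      case 3
      then have "(1 - \<tau>) * t + \<tau> * stretch t - t = \<tau> * (1 - t)"
        using stretch_simps(2)[of t] by (simp add: algebra_simps)
      then have "t \<le> (1 - \<tau>) * t + \<tau> * stretch t"
        using that(2,3) t(3) mult_nonneg_nonneg[of \<tau> "1 - t"] by linarith
      then show ?thesis using segN[OF t(1) that(2,3)] 3 by (simp add: with_collars_def)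
    qed (use segN[OF t(1) that(2,3)] in \<open>simp add: with_collars_def\<close>)
  qed
  show "(a, stretch t) \<in> with_ends A1 B1 A2 B2"
    if "(a, t) \<in> with_collars A1 A2 (B1 \<inter> B2)" for a t
    using that stretch_simps[of t] D by (auto simp: with_ends_iff with_collars_def dmc_iff)
qed

text \<open>Points of the cylinder that do not lie over \<open>C\<close> have height 0 or 1, so they
  are inside the collars and can be excised after the thickening. Undoing the thickening over the
  cover and over \<open>C\<close> gives a commuting square in which the other three sides are
  isomorphisms.\<close>

lemma ends_excision:
  assumes "mv_cover A1 B1 A2 B2"
  defines "C \<equiv> A1 \<inter> A2" and "E \<equiv> B1 \<inter> B2"
  shows "bij_betw (res n Y (cyl (dmc A1 A2)) (cyl (with_ends A1 B1 A2 B2)) (cyl (dmc C C)) (cyl (with_ends C E C E)))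
     (H n Y (cyl (dmc A1 A2)) (cyl (with_ends A1 B1 A2 B2))) (H n Y (cyl (dmc C C)) (cyl (with_ends C E C E)))"
proof -
  note D = mv_cover_openD[OF assms(1)]
  let ?N = "dmc A1 A2" and ?K = "with_ends A1 B1 A2 B2" and ?K' = "with_collars A1 A2 E"
  let ?S = "dmc C C" and ?L = "with_ends C E C E" and ?L' = "with_collars C C E"
  let ?Z = "{(a, t) \<in> ?N. \<not> (a \<in> C \<and> t \<in> UNIV)}"
  let ?G = "{(a, t) \<in> ?N. a \<in> topspace X \<and> t \<in> {..<1/3} \<union> {2/3<..}}"
  have N: "?N \<subseteq> topspace X \<times> UNIV" using D by (auto simp: dmc_iff)
  have sets: "?N - ?Z = ?S" "?K' - ?Z = ?L'"
    unfolding with_collars_def C_def E_def using D by (auto simp: dmc_iff)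
  have opC: "openin X C" using assms(1) unfolding mv_cover_def C_def by auto
  have "bij_betw (res n Y (cyl ?N) (cyl ?K') (cyl ?N - cyl ?Z) (cyl ?K' - cyl ?Z))
     (H n Y (cyl ?N) (cyl ?K')) (H n Y (cyl ?N - cyl ?Z) (cyl ?K' - cyl ?Z))"
  proof (rule restriction_excision[where G = "cyl ?G"])
    show "openin (subtopology Y (cyl ?N)) (cyl ?G)"
      by (rule openin_cyl[OF N]) auto
    show "closedin (subtopology Y (cyl ?N)) (cyl ?Z)"
      by (rule closedin_cyl[OF N opC]) auto
    show "cyl ?Z \<subseteq> cyl ?G"
      using D by (intro image_mono) (auto simp: C_def dmc_iff)
    show "cyl ?G \<subseteq> cyl ?K'"
      by (intro image_mono) (auto simp: with_collars_def)
    show "cyl ?K' \<subseteq> cyl ?N"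
      by (intro image_mono) (auto simp: with_collars_def)
  qed (rule cyl_subset_topspace[OF N])
  then have r2: "bij_betw (res n Y (cyl ?N) (cyl ?K') (cyl ?S) (cyl ?L'))
     (H n Y (cyl ?N) (cyl ?K')) (H n Y (cyl ?S) (cyl ?L'))"
    unfolding cyl_diff sets .
  have r3: "bij_betw (res n Y (cyl ?S) (cyl ?L') (cyl ?S) (cyl ?L)) (H n Y (cyl ?S) (cyl ?L')) (H n Y (cyl ?S) (cyl ?L))"
    using squeeze_collars_bij[OF mv_cover_Int[OF assms(1)], of n] by (simp add: C_def E_def)
  have r1: "bij_betw (res n Y (cyl ?N) (cyl ?K') (cyl ?N) (cyl ?K)) (H n Y (cyl ?N) (cyl ?K')) (H n Y (cyl ?N) (cyl ?K))"
    using squeeze_collars_bij[OF assms(1), of n] by (simp add: E_def)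
  have subs: "?S \<subseteq> ?N" "?L' \<subseteq> ?K'" "?K \<subseteq> ?K'" "?L \<subseteq> ?K" "?L \<subseteq> ?L'" "?K \<subseteq> ?N" "?K' \<subseteq> ?N" "?L' \<subseteq> ?S" "?L \<subseteq> ?S"
    using D by (auto simp: C_def E_def dmc_iff with_ends_iff with_collars_def)
  then have sp: "sub_pair Y (cyl ?N) (cyl ?K') (cyl ?N) (cyl ?K)" "sub_pair Y (cyl ?N) (cyl ?K) (cyl ?S) (cyl ?L)"
    "sub_pair Y (cyl ?N) (cyl ?K') (cyl ?S) (cyl ?L')" "sub_pair Y (cyl ?S) (cyl ?L') (cyl ?S) (cyl ?L)"
    using cyl_subset_topspace[OF N] unfolding sub_pair_def by blast+
  have k: "bij_betw (res n Y (cyl ?N) (cyl ?K') (cyl ?S) (cyl ?L)) (H n Y (cyl ?N) (cyl ?K')) (H n Y (cyl ?S) (cyl ?L))"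
    by (rule bij_betw_composite[OF r2 r3]) (rule res_comp[OF sp(3,4)])
  show ?thesis
    by (rule bij_betw_cancel[OF r1 k]) (rule res_comp[OF sp(1,2)])
qed

lemma sub_pair_cyl:
  assumes "P \<subseteq> topspace X \<times> UNIV" "Q \<subseteq> P" "P' \<subseteq> P" "Q' \<subseteq> Q" "Q' \<subseteq> P'"
  shows "sub_pair Y (cyl P) (cyl Q) (cyl P') (cyl Q')"
  unfolding sub_pair_def using cyl_subset_topspace[OF assms(1)] assms(2-5) by (simp add: image_mono)

lemma over_slice:
  "B \<subseteq> A \<Longrightarrow> A \<subseteq> topspace X \<Longrightarrow> over A B (A \<times> {t}) (B \<times> {t})"
  unfolding over_def by auto

lemma pull_slice_bij:
  assumes "B \<subseteq> A" "A \<subseteq> topspace X"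
  shows "bij_betw (pull n A B (A \<times> {t}) (B \<times> {t})) (H n X A B) (H n Y (cyl (A \<times> {t})) (cyl (B \<times> {t})))"
  by (rule pull_bij[OF over_slice[OF assms], where s = "\<lambda>_. t"])
    (use assms in \<open>auto simp: fiberwise_convex_def\<close>)

text \<open>Below height 1 the two sets agree, so everything up to height 1/2 can be excised. What
  is left slides up to the slice at height 1.\<close>

lemma start_excision:
  assumes "mv_cover A1 B1 A2 B2"
  shows "bij_betw (res n Y (cyl (with_ends A1 B1 A2 B2)) (cyl (with_start A1 B1 B2)) (cyl (A2 \<times> {1})) (cyl (B2 \<times> {1})))
     (H n Y (cyl (with_ends A1 B1 A2 B2)) (cyl (with_start A1 B1 B2)))
     (H n Y (cyl (A2 \<times> {1})) (cyl (B2 \<times> {1})))"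
proof -
  note D = mv_cover_openD[OF assms(1)]
  let ?K = "with_ends A1 B1 A2 B2" and ?Ks = "with_start A1 B1 B2"
  let ?Z = "{(a, t) \<in> ?K. \<not> (a \<in> topspace X \<and> t \<in> {1/2<..})}"
  let ?G = "{(a, t) \<in> ?K. a \<in> topspace X \<and> t \<in> {..<1}}"
  let ?R = "A2 \<times> {1} \<union> (B1 \<inter> B2) \<times> {1/2<..1::real}" and ?Rs = "B2 \<times> {1} \<union> (B1 \<inter> B2) \<times> {1/2<..1::real}"
  have K: "?K \<subseteq> topspace X \<times> UNIV"
    using D unfolding with_ends_def double_mapping_cylinder_def by blast
  have Z: "?Z = {(a, t) \<in> ?K. \<not> 1/2 < t}"
    using K by auto
  have B: "a \<in> B2 \<Longrightarrow> a \<in> A2" for a using D by blast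
  have sets: "?K - ?Z = ?R" "?Ks - ?Z = ?Rs"
  proof -
    have "(a, t) \<in> ?K - ?Z \<longleftrightarrow> (a, t) \<in> ?R" for a t
      unfolding Z using B[of a]
      by (cases "t = 1"; cases "t = 0"; cases "1/2 < t") (auto simp: dmc_iff with_ends_iff)
    then show "?K - ?Z = ?R" by blast
    have "(a, t) \<in> ?Ks - ?Z \<longleftrightarrow> (a, t) \<in> ?Rs" for a t
      unfolding Z using B[of a]
      by (cases "t = 1"; cases "t = 0"; cases "1/2 < t") (auto simp: dmc_iff with_ends_iff with_start_iff)
    then show "?Ks - ?Z = ?Rs" by blast
  qed
  have "bij_betw (res n Y (cyl ?K) (cyl ?Ks) (cyl ?K - cyl ?Z) (cyl ?Ks - cyl ?Z))
     (H n Y (cyl ?K) (cyl ?Ks)) (H n Y (cyl ?K - cyl ?Z) (cyl ?Ks - cyl ?Z))"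
  proof (rule restriction_excision[where G = "cyl ?G"])
    show "openin (subtopology Y (cyl ?K)) (cyl ?G)"
      by (rule openin_cyl[OF K]) auto
    show "closedin (subtopology Y (cyl ?K)) (cyl ?Z)"
      by (rule closedin_cyl[OF K]) auto
    show "cyl ?Z \<subseteq> cyl ?G"
      using K by (intro image_mono) auto
    show "cyl ?G \<subseteq> cyl ?Ks"
      by (intro image_mono) (auto simp: with_ends_iff with_start_iff)
    show "cyl ?Ks \<subseteq> cyl ?K"
      by (intro image_mono) (auto simp: with_ends_iff with_start_iff)
  qed (rule cyl_subset_topspace[OF K])
  then have r1: "bij_betw (res n Y (cyl ?K) (cyl ?Ks) (cyl ?R) (cyl ?Rs)) (H n Y (cyl ?K) (cyl ?Ks)) (H n Y (cyl ?R) (cyl ?Rs))"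
    unfolding cyl_diff sets .
  have ov: "over A2 B2 ?R ?Rs" using D unfolding over_def by auto
  have p: "bij_betw (pull n A2 B2 ?R ?Rs) (H n X A2 B2) (H n Y (cyl ?R) (cyl ?Rs))"
    by (rule pull_bij[OF ov, where s = "\<lambda>_. 1"]) (auto simp: fiberwise_convex_def)
  have q: "bij_betw (pull n A2 B2 (A2 \<times> {1}) (B2 \<times> {1})) (H n X A2 B2) (H n Y (cyl (A2 \<times> {1})) (cyl (B2 \<times> {1})))"
    by (rule pull_slice_bij[OF D(4,2)])
  have r2: "bij_betw (res n Y (cyl ?R) (cyl ?Rs) (cyl (A2 \<times> {1})) (cyl (B2 \<times> {1})))
      (H n Y (cyl ?R) (cyl ?Rs)) (H n Y (cyl (A2 \<times> {1})) (cyl (B2 \<times> {1})))"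
    by (rule bij_betw_cancel[OF p q], rule res_pull[OF ov]) (use D in auto)
  have RK: "?R \<subseteq> ?K" "?Rs \<subseteq> ?Ks"
    by (subst sets(1)[symmetric], rule Diff_subset) (subst sets(2)[symmetric], rule Diff_subset)
  have KK: "?Ks \<subseteq> ?K" unfolding with_start_def with_ends_def by blast
  have AR: "A2 \<times> {1} \<subseteq> ?R" "B2 \<times> {1} \<subseteq> ?Rs" "B2 \<times> {1} \<subseteq> A2 \<times> {1::real}" "?Rs \<subseteq> ?R"
    using B by auto
  note sp = sub_pair_cyl[OF K KK RK AR(4)] sub_pair_cyl[OF order_trans[OF RK(1) K] AR(4,1-3)]
  show ?thesis
    by (rule bij_betw_composite[OF r1 r2]) (rule res_comp[OF sp])
qed

end

lemma inv_into_bij_betw: "bij_betw f A B \<Longrightarrow> b \<in> B \<Longrightarrow> inv_into A f b \<in> A"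
  by (auto simp: bij_betw_def intro: inv_into_into)

context cylinder_theory
begin

text \<open>The classes that witness the value \<open>c\<close> of the differential at \<open>a\<close>: they pass through all the
  isomorphisms which the differential inverts.\<close>

definition mv_witness :: "int \<Rightarrow> 'u set \<Rightarrow> 'u set \<Rightarrow> 'u set \<Rightarrow> 'u set \<Rightarrow> 'v \<Rightarrow> 'v \<Rightarrow> 'v \<Rightarrow> 'v \<Rightarrow> bool" where
  "mv_witness n A1 B1 A2 B2 a \<sigma> \<kappa> c \<longleftrightarrow>
    (let N = cyl (dmc A1 A2); M = cyl (dmc B1 B2); K = cyl (with_ends A1 B1 A2 B2);
         C = A1 \<inter> A2; E = B1 \<inter> B2;
         S = cyl (dmc C C); S' = cyl (with_ends C E C E); S0 = cyl (with_start C E E)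
     in \<sigma> \<in> H n Y S' S0 \<and> \<kappa> \<in> H (n + 1) Y N K \<and> c \<in> H (n + 1) X (A1 \<union> A2) (B1 \<union> B2) \<and>
        res n Y S' S0 (cyl (C \<times> {1})) (cyl (E \<times> {1})) \<sigma> = pull n C E (C \<times> {1}) (E \<times> {1}) a \<and>
        res (n + 1) Y N K S S' \<kappa> = connect h n (subtopology Y S) S' (res n Y S' S0 S' {} \<sigma>) \<and>
        pull (n + 1) (A1 \<union> A2) (B1 \<union> B2) (dmc A1 A2) (dmc B1 B2) c = res (n + 1) Y N K N M \<kappa>)"

abbreviation "mv_diff n A1 B1 A2 B2 \<equiv> mv_differential h code n X (A1, B1) (A2, B2)"

lemma mv_differential_eq:
  fixes A1 B1 A2 B2 :: "'u set"
  defines "N \<equiv> cyl (dmc A1 A2)" and "M \<equiv> cyl (dmc B1 B2)" and "K \<equiv> cyl (with_ends A1 B1 A2 B2)"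
    and "C \<equiv> A1 \<inter> A2" and "E \<equiv> B1 \<inter> B2"
  defines "S \<equiv> cyl (dmc C C)" and "S' \<equiv> cyl (with_ends C E C E)" and "S0 \<equiv> cyl (with_start C E E)"
  shows "mv_diff n A1 B1 A2 B2 =
    inv_into (H (n + 1) X (A1 \<union> A2) (B1 \<union> B2))
      (pull (n + 1) (A1 \<union> A2) (B1 \<union> B2) (dmc A1 A2) (dmc B1 B2)) \<circ>
    res (n + 1) Y N K N M \<circ>
    inv_into (H (n + 1) Y N K) (res (n + 1) Y N K S S') \<circ>
    (connect h n (subtopology Y S) S' \<circ> res n Y S' S0 S' {} \<circ>
     inv_into (H n Y S' S0) (res n Y S' S0 (cyl (C \<times> {1})) (cyl (E \<times> {1}))) \<circ>
     pull n C E (C \<times> {1}) (E \<times> {1}))"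
proof -
  have S': "cyl (C \<times> {0, 1} \<union> E \<times> {0..1}) = S'"
    unfolding S'_def by (rule arg_cong[where f = cyl]) (auto simp: with_ends_iff dmc_iff)
  have S0: "cyl (C \<times> {0} \<union> E \<times> {0..1}) = S0"
    unfolding S0_def by (rule arg_cong[where f = cyl]) (auto simp: with_start_iff dmc_iff)
  have K: "M \<union> cyl (A1 \<times> {0} \<union> A2 \<times> {1}) = K"
    unfolding M_def K_def with_ends_def by (rule image_Un[symmetric])
  show ?thesis
    unfolding mv_differential_def triple_connect_def Let_def split
    unfolding C_def[symmetric] E_def[symmetric] N_def[symmetric] M_def[symmetric] S' S0 K
    unfolding dmc_same[symmetric] S_def[symmetric] pull_def N_def[symmetric] M_def[symmetric]
    by (simp only: o_assoc)
qed

lemma mv_cover_subsets: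
  assumes "mv_cover A1 B1 A2 B2"
  defines "C \<equiv> A1 \<inter> A2" and "E \<equiv> B1 \<inter> B2"
  shows "dmc A1 A2 \<subseteq> topspace X \<times> UNIV" "with_ends A1 B1 A2 B2 \<subseteq> dmc A1 A2"
    "dmc B1 B2 \<subseteq> with_ends A1 B1 A2 B2" "dmc C C \<subseteq> dmc A1 A2" "with_ends C E C E \<subseteq> with_ends A1 B1 A2 B2"
    "with_ends C E C E \<subseteq> dmc C C" "with_start C E E \<subseteq> with_ends C E C E"
    "C \<times> {1} \<subseteq> with_ends C E C E" "E \<times> {1} \<subseteq> with_start C E E" "E \<subseteq> C" "C \<subseteq> topspace X"
    "E \<times> {1} \<subseteq> C \<times> {1::real}"
proof -
  note D = mv_cover_openD[OF assms(1)]
  show "dmc A1 A2 \<subseteq> topspace X \<times> UNIV" "with_ends A1 B1 A2 B2 \<subseteq> dmc A1 A2" "dmc C C \<subseteq> dmc A1 A2"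
    unfolding with_ends_def double_mapping_cylinder_def C_def using D by blast+
  show "dmc B1 B2 \<subseteq> with_ends A1 B1 A2 B2" "with_start C E E \<subseteq> with_ends C E C E"
    "C \<times> {1} \<subseteq> with_ends C E C E" "E \<times> {1} \<subseteq> with_start C E E"
    unfolding with_ends_def with_start_def double_mapping_cylinder_def by blast+
  show "E \<subseteq> C" "C \<subseteq> topspace X" unfolding C_def E_def using D by blast+
  then show "E \<times> {1} \<subseteq> C \<times> {1::real}" by blast
  have "dmc E E \<subseteq> dmc B1 B2" by (rule dmc_mono) (auto simp: E_def)
  then show "with_ends C E C E \<subseteq> with_ends A1 B1 A2 B2"
    unfolding with_ends_def C_def by blast
  have "dmc E E \<subseteq> dmc C C" using \<open>E \<subseteq> C\<close> by (intro dmc_mono)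
  then show "with_ends C E C E \<subseteq> dmc C C"
    unfolding with_ends_def by (auto simp: dmc_iff)
qed

lemma mv_cover_sub_pairs:
  assumes "mv_cover A1 B1 A2 B2"
  defines "C \<equiv> A1 \<inter> A2" and "E \<equiv> B1 \<inter> B2"
  shows "sub_pair Y (cyl (dmc A1 A2)) (cyl (with_ends A1 B1 A2 B2)) (cyl (dmc A1 A2)) (cyl (dmc B1 B2))"
    "sub_pair Y (cyl (dmc A1 A2)) (cyl (with_ends A1 B1 A2 B2)) (cyl (dmc C C)) (cyl (with_ends C E C E))"
    "sub_pair Y (cyl (with_ends C E C E)) (cyl (with_start C E E)) (cyl (with_ends C E C E)) {}"
    "sub_pair Y (cyl (with_ends C E C E)) (cyl (with_start C E E)) (cyl (C \<times> {1})) (cyl (E \<times> {1}))"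
proof -
  note sub = mv_cover_subsets[OF assms(1), folded C_def E_def]
  have S': "with_ends C E C E \<subseteq> topspace X \<times> UNIV" using sub(1,4,6) by blast
  show "sub_pair Y (cyl (dmc A1 A2)) (cyl (with_ends A1 B1 A2 B2)) (cyl (dmc A1 A2)) (cyl (dmc B1 B2))"
    by (rule sub_pair_cyl[OF sub(1,2) order_refl sub(3)]) (use sub(2,3) in blast)
  show "sub_pair Y (cyl (dmc A1 A2)) (cyl (with_ends A1 B1 A2 B2)) (cyl (dmc C C)) (cyl (with_ends C E C E))"
    by (rule sub_pair_cyl[OF sub(1,2,4,5,6)])
  show "sub_pair Y (cyl (with_ends C E C E)) (cyl (with_start C E E)) (cyl (with_ends C E C E)) {}"
    using sub_pair_cyl[OF S' sub(7) order_refl, of "{}"] by simp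
  show "sub_pair Y (cyl (with_ends C E C E)) (cyl (with_start C E E)) (cyl (C \<times> {1})) (cyl (E \<times> {1}))"
    by (rule sub_pair_cyl[OF S' sub(7,8,9,12)])
qed

lemma suspension_start_bij:
  assumes "mv_cover A1 B1 A2 B2"
  defines "C \<equiv> A1 \<inter> A2" and "E \<equiv> B1 \<inter> B2"
  shows "bij_betw (res n Y (cyl (with_ends C E C E)) (cyl (with_start C E E)) (cyl (C \<times> {1})) (cyl (E \<times> {1})))
     (H n Y (cyl (with_ends C E C E)) (cyl (with_start C E E))) (H n Y (cyl (C \<times> {1})) (cyl (E \<times> {1})))"
  using start_excision[OF mv_cover_Int[OF assms(1)]] by (simp add: C_def E_def)

text \<open>A composite of linear maps and of inverses of linear bijections; the bijectivity is
  where the cover enters.\<close>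

lemma mv_diff_linear:
  assumes "mv_cover A1 B1 A2 B2"
  shows "linear_between (scale h) (H n X (A1 \<inter> A2) (B1 \<inter> B2)) (H (n + 1) X (A1 \<union> A2) (B1 \<union> B2))
    (mv_diff n A1 B1 A2 B2)"
proof -
  note sp = mv_cover_sub_pairs[OF assms] and sub = mv_cover_subsets[OF assms]
  let ?C = "A1 \<inter> A2" and ?E = "B1 \<inter> B2"
  let ?S' = "cyl (with_ends ?C ?E ?C ?E)" and ?S = "cyl (dmc ?C ?C)"
  have S: "?S' \<subseteq> ?S" "dmc ?C ?C \<subseteq> topspace X \<times> UNIV"
    using image_mono[OF sub(6), of code] sub(1,4) by simp_all
  note top = topspace_cyl[OF S(2)]
  have sub1: "vs.subspace (H m Y P Q)" if "sub_pair Y P Q P' Q'" for m P Q P' Q'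
    using that by (intro H_subspace) (auto simp: sub_pair_def)
  have conn: "linear_between (scale h) (H n Y ?S' {}) (H (n + 1) Y ?S ?S') (connect h n (subtopology Y ?S) ?S')"
    using connect_linear[of ?S' "subtopology Y ?S" n, unfolded top, OF S(1)] unfolding subtopology_nested[OF S(1)] .
  have subX: "vs.subspace (H (n + 1) X (A1 \<union> A2) (B1 \<union> B2))"
    using mv_cover_openD[OF assms] by (intro H_subspace) auto
  note ov = over_slice[OF sub(10,11), of 1]
  note l1 = pull_linear[OF ov, of n]
  note l2 = linear_between_inv_into[OF res_linear[OF sp(4)] sub1[OF sp(4)] suspension_start_bij[OF assms], of n]
  note l3 = res_linear[OF sp(3), of n]
  note l5 = linear_between_inv_into[OF res_linear[OF sp(2)] sub1[OF sp(2)] ends_excision[OF assms], of "n + 1"]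
  note l6 = res_linear[OF sp(1), of "n + 1"]
  note l7 = linear_between_inv_into[OF pull_linear[OF over_dmc[OF assms]] subX pull_dmc_bij[OF assms]]
  show ?thesis
    unfolding mv_differential_eq o_assoc
    by (intro linear_between_comp[OF l1] linear_between_comp[OF l2] linear_between_comp[OF l3]
        linear_between_comp[OF conn] linear_between_comp[OF l5] linear_between_comp[OF l6] l7)
qed

lemma mv_witness_mv_diff:
  assumes cover: "mv_cover A1 B1 A2 B2" and a: "a \<in> H n X (A1 \<inter> A2) (B1 \<inter> B2)"
  obtains \<sigma> \<kappa> where "mv_witness n A1 B1 A2 B2 a \<sigma> \<kappa> (mv_diff n A1 B1 A2 B2 a)"
proof -
  define N where "N = cyl (dmc A1 A2)"
  define M where "M = cyl (dmc B1 B2)"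
  define K where "K = cyl (with_ends A1 B1 A2 B2)"
  define C where "C = A1 \<inter> A2"
  define E where "E = B1 \<inter> B2"
  define S where "S = cyl (dmc C C)"
  define S' where "S' = cyl (with_ends C E C E)"
  define S0 where "S0 = cyl (with_start C E E)"
  note defs = N_def M_def K_def C_def E_def S_def S'_def S0_def
  note sp = mv_cover_sub_pairs[OF cover, folded C_def E_def, folded N_def M_def K_def S_def S'_def S0_def]
  note sub = mv_cover_subsets[OF cover, folded C_def E_def]
  note b1 = suspension_start_bij[OF cover, folded C_def E_def, folded S'_def S0_def, of n]
  note b2 = ends_excision[OF cover, folded C_def E_def, folded N_def K_def S_def S'_def, of "n + 1"]
  note b3 = pull_dmc_bij[OF cover, folded N_def M_def, of "n + 1"]
  let ?A = "A1 \<union> A2" and ?B = "B1 \<union> B2"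
  let ?p = "pull n C E (C \<times> {1}) (E \<times> {1}) a"
  have p: "?p \<in> H n Y (cyl (C \<times> {1})) (cyl (E \<times> {1}))"
    using pull_in[OF over_slice[OF sub(10,11)]] a by (simp add: C_def E_def)
  define \<sigma> where "\<sigma> = inv_into (H n Y S' S0) (res n Y S' S0 (cyl (C \<times> {1})) (cyl (E \<times> {1}))) ?p"
  have \<sigma>: "\<sigma> \<in> H n Y S' S0" "res n Y S' S0 (cyl (C \<times> {1})) (cyl (E \<times> {1})) \<sigma> = ?p"
    unfolding \<sigma>_def by (rule inv_into_bij_betw[OF b1 p], rule bij_betw_inv_into_right[OF b1 p])
  let ?d = "connect h n (subtopology Y S) S' (res n Y S' S0 S' {} \<sigma>)"
  have SS: "S' \<subseteq> S" "S \<subseteq> topspace Y"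
    using sp(2) unfolding sub_pair_def by auto
  have d: "?d \<in> H (n + 1) Y S S'"
    by (rule connect_in_H[OF SS res_in[OF sp(3) \<sigma>(1)]])
  define \<kappa> where "\<kappa> = inv_into (H (n + 1) Y N K) (res (n + 1) Y N K S S') ?d"
  have \<kappa>: "\<kappa> \<in> H (n + 1) Y N K" "res (n + 1) Y N K S S' \<kappa> = ?d"
    unfolding \<kappa>_def by (rule inv_into_bij_betw[OF b2 d], rule bij_betw_inv_into_right[OF b2 d])
  let ?k = "res (n + 1) Y N K N M \<kappa>"
  have k: "?k \<in> H (n + 1) Y N M" by (rule res_in[OF sp(1) \<kappa>(1)])
  define c where "c = inv_into (H (n + 1) X ?A ?B) (pull (n + 1) ?A ?B (dmc A1 A2) (dmc B1 B2)) ?k"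
  have c: "c \<in> H (n + 1) X ?A ?B" "pull (n + 1) ?A ?B (dmc A1 A2) (dmc B1 B2) c = ?k"
    unfolding c_def by (rule inv_into_bij_betw[OF b3 k], rule bij_betw_inv_into_right[OF b3 k])
  have "mv_diff n A1 B1 A2 B2 a = c"
    unfolding mv_differential_eq c_def \<kappa>_def \<sigma>_def by (simp add: defs)
  moreover have "mv_witness n A1 B1 A2 B2 a \<sigma> \<kappa> c"
    unfolding mv_witness_def Let_def using \<sigma> \<kappa> c by (simp add: defs)
  ultimately show thesis using that by simp
qed

text \<open>Equations for the differential can now be proved by exhibiting classes: all the maps
  that it inverts are bijective, so the witnesses determine the value.\<close>

lemma mv_witness_unique:
  assumes cover: "mv_cover A1 B1 A2 B2" and w: "mv_witness n A1 B1 A2 B2 a \<sigma> \<kappa> c"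
  shows "mv_diff n A1 B1 A2 B2 a = c"
proof -
  note w' = w[unfolded mv_witness_def Let_def]
  have 1: "\<sigma> \<in> H n Y (cyl (with_ends (A1 \<inter> A2) (B1 \<inter> B2) (A1 \<inter> A2) (B1 \<inter> B2))) (cyl (with_start (A1 \<inter> A2) (B1 \<inter> B2) (B1 \<inter> B2)))"
    and 2: "\<kappa> \<in> H (n + 1) Y (cyl (dmc A1 A2)) (cyl (with_ends A1 B1 A2 B2))"
    and 3: "c \<in> H (n + 1) X (A1 \<union> A2) (B1 \<union> B2)"
    using w' by auto
  show ?thesis
    unfolding mv_differential_eq o_apply
    using bij_betw_inv_into_left[OF suspension_start_bij[OF cover] 1]
      bij_betw_inv_into_left[OF ends_excision[OF cover] 2]
      bij_betw_inv_into_left[OF pull_dmc_bij[OF cover] 3] w'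
    by simp
qed

lemma mv_diff_in:
  "mv_cover A1 B1 A2 B2 \<Longrightarrow> a \<in> H n X (A1 \<inter> A2) (B1 \<inter> B2) \<Longrightarrow>
    mv_diff n A1 B1 A2 B2 a \<in> H (n + 1) X (A1 \<union> A2) (B1 \<union> B2)"
  using mv_diff_linear unfolding linear_between_def by blast

section \<open>Naturality and vanishing of the differential\<close>

lemma with_ends_mono:
  assumes "A1' \<subseteq> A1" "B1' \<subseteq> B1" "A2' \<subseteq> A2" "B2' \<subseteq> B2"
  shows "with_ends A1' B1' A2' B2' \<subseteq> with_ends A1 B1 A2 B2"
  using dmc_mono[OF assms(2,4)] assms(1,3) unfolding with_ends_def by blast

lemma with_start_mono:
  assumes "A1' \<subseteq> A1" "B1' \<subseteq> B1" "B2' \<subseteq> B2"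
  shows "with_start A1' B1' B2' \<subseteq> with_start A1 B1 B2"
  using dmc_mono[OF assms(2,3)] assms(1) unfolding with_start_def by blast

text \<open>The restrictions of the witnesses for the larger cover are witnesses for the smaller
  one. Each of the three equations is carried over by commuting squares of restrictions, projections
  and connecting maps.\<close>

lemma mv_diff_natural:
  assumes cover: "mv_cover A1 B1 A2 B2" and cover': "mv_cover A1' B1' A2' B2'"
    and le: "A1' \<subseteq> A1" "B1' \<subseteq> B1" "A2' \<subseteq> A2" "B2' \<subseteq> B2"
    and a: "a \<in> H n X (A1 \<inter> A2) (B1 \<inter> B2)"
  shows "mv_diff n A1' B1' A2' B2' (res n X (A1 \<inter> A2) (B1 \<inter> B2) (A1' \<inter> A2') (B1' \<inter> B2') a) =
    res (n + 1) X (A1 \<union> A2) (B1 \<union> B2) (A1' \<union> A2') (B1' \<union> B2') (mv_diff n A1 B1 A2 B2 a)"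
proof -
  obtain \<sigma> \<kappa> where w: "mv_witness n A1 B1 A2 B2 a \<sigma> \<kappa> (mv_diff n A1 B1 A2 B2 a)"
    using mv_witness_mv_diff[OF cover a] .
  define c where "c = mv_diff n A1 B1 A2 B2 a"
  define A where "A = A1 \<union> A2"
  define B where "B = B1 \<union> B2"
  define N where "N = cyl (dmc A1 A2)"
  define M where "M = cyl (dmc B1 B2)"
  define K where "K = cyl (with_ends A1 B1 A2 B2)"
  define C where "C = A1 \<inter> A2"
  define E where "E = B1 \<inter> B2"
  define C1 where "C1 = cyl (C \<times> {1})"
  define E1 where "E1 = cyl (E \<times> {1})"
  define S where "S = cyl (dmc C C)"
  define S' where "S' = cyl (with_ends C E C E)"
  define S0 where "S0 = cyl (with_start C E E)"
  \<comment> \<open>The prefix \<open>x\<close> marks the sets that belong to the smaller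
    cover.\<close>
  define xA where "xA = A1' \<union> A2'"
  define xB where "xB = B1' \<union> B2'"
  define xN where "xN = cyl (dmc A1' A2')"
  define xM where "xM = cyl (dmc B1' B2')"
  define xK where "xK = cyl (with_ends A1' B1' A2' B2')"
  define xC where "xC = A1' \<inter> A2'"
  define xE where "xE = B1' \<inter> B2'"
  define xC1 where "xC1 = cyl (xC \<times> {1})"
  define xE1 where "xE1 = cyl (xE \<times> {1})"
  define xS where "xS = cyl (dmc xC xC)"
  define xS' where "xS' = cyl (with_ends xC xE xC xE)"
  define xS0 where "xS0 = cyl (with_start xC xE xE)"
  note folds = C_def[symmetric] E_def[symmetric] A_def[symmetric] B_def[symmetric]
    N_def[symmetric] M_def[symmetric] K_def[symmetric] C1_def[symmetric] E1_def[symmetric]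
    S_def[symmetric] S'_def[symmetric] S0_def[symmetric]
  note xfolds = xC_def[symmetric] xE_def[symmetric] xA_def[symmetric] xB_def[symmetric]
    xN_def[symmetric] xM_def[symmetric] xK_def[symmetric] xC1_def[symmetric] xE1_def[symmetric]
    xS_def[symmetric] xS'_def[symmetric] xS0_def[symmetric]
  have w': "\<sigma> \<in> H n Y S' S0" "\<kappa> \<in> H (n + 1) Y N K" "c \<in> H (n + 1) X A B"
    "res n Y S' S0 C1 E1 \<sigma> = pull n C E (C \<times> {1}) (E \<times> {1}) a"
    "res (n + 1) Y N K S S' \<kappa> = connect h n (subtopology Y S) S' (res n Y S' S0 S' {} \<sigma>)"
    "pull (n + 1) A B (dmc A1 A2) (dmc B1 B2) c = res (n + 1) Y N K N M \<kappa>"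
    using w unfolding mv_witness_def Let_def c_def[symmetric] folds by auto
  note sp = mv_cover_sub_pairs[OF cover, unfolded folds]
  note xsp = mv_cover_sub_pairs[OF cover', unfolded xfolds]
  note sub = mv_cover_subsets[OF cover, unfolded folds]
  note xsub = mv_cover_subsets[OF cover', unfolded xfolds]
  have CE: "xC \<subseteq> C" "xE \<subseteq> E" "xA \<subseteq> A" "xB \<subseteq> B"
    using le unfolding C_def E_def xC_def xE_def A_def B_def xA_def xB_def by blast+
  have incl: "xN \<subseteq> N" "xM \<subseteq> M" "xK \<subseteq> K" "xS \<subseteq> S" "xS' \<subseteq> S'" "xS0 \<subseteq> S0" "xC1 \<subseteq> C1" "xE1 \<subseteq> E1"
    unfolding N_def M_def K_def S_def S'_def S0_def xN_def xM_def xK_def xS_def xS'_def xS0_def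
      C1_def E1_def xC1_def xE1_def
    by (intro image_mono dmc_mono with_ends_mono with_start_mono le CE Sigma_mono order_refl)+
  have BA: "B \<subseteq> A" "A \<subseteq> topspace X" "xB \<subseteq> xA" "xA \<subseteq> topspace X"
    using mv_cover_openD[OF cover] mv_cover_openD[OF cover'] unfolding A_def B_def xA_def xB_def by blast+
  have spX: "sub_pair X A B xA xB" "sub_pair X C E xC xE"
    using BA CE xsub(10) sub(10,11) unfolding sub_pair_def by auto
  note spd = sp[unfolded sub_pair_def] and xspd = xsp[unfolded sub_pair_def]
  have spY: "sub_pair Y S' S0 xS' xS0" "sub_pair Y N K xN xK" "sub_pair Y N M xN xM" "sub_pair Y C1 E1 xC1 xE1"
    "sub_pair Y S S' xS xS'" "sub_pair Y S' {} xS' {}"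
    using spd xspd incl unfolding sub_pair_def by auto
  let ?a = "res n X C E xC xE a" and ?\<sigma> = "res n Y S' S0 xS' xS0 \<sigma>"
    and ?\<kappa> = "res (n + 1) Y N K xN xK \<kappa>" and ?c = "res (n + 1) X A B xA xB c"
  have aH: "a \<in> H n X C E" using a unfolding C_def E_def .
  have e1: "res n Y xS' xS0 xC1 xE1 ?\<sigma> = pull n xC xE (xC \<times> {1}) (xE \<times> {1}) ?a"
  proof -
    have sl: "xC \<times> {1} \<subseteq> C \<times> {1::real}" "xE \<times> {1} \<subseteq> E \<times> {1::real}" using CE by auto
    have "res n Y xS' xS0 xC1 xE1 ?\<sigma> = res n Y C1 E1 xC1 xE1 (res n Y S' S0 C1 E1 \<sigma>)"
      using res_comp[OF spY(1) xsp(4) w'(1)] res_comp[OF sp(4) spY(4) w'(1)] by simp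
    also have "\<dots> = pull n C E (xC \<times> {1}) (xE \<times> {1}) a"
      using res_pull[OF over_slice[OF sub(10,11)] sl xsub(12) aH] w'(4)
      unfolding C1_def E1_def xC1_def xE1_def by simp
    also have "\<dots> = pull n xC xE (xC \<times> {1}) (xE \<times> {1}) ?a"
      using pull_res[OF over_slice[OF xsub(10,11)] spX(2) aH] by simp
    finally show ?thesis .
  qed
  have e2: "res (n + 1) Y xN xK xS xS' ?\<kappa> = connect h n (subtopology Y xS) xS' (res n Y xS' xS0 xS' {} ?\<sigma>)"
  proof -
    have "res (n + 1) Y xN xK xS xS' ?\<kappa> = res (n + 1) Y S S' xS xS' (res (n + 1) Y N K S S' \<kappa>)"
      using res_comp[OF spY(2) xsp(2) w'(2)] res_comp[OF sp(2) spY(5) w'(2)] by simp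
    also have "\<dots> = connect h n (subtopology Y xS) xS' (res n Y S' {} xS' {} (res n Y S' S0 S' {} \<sigma>))"
      using connect_res[OF spY(5) res_in[OF sp(3) w'(1)]] w'(5) by simp
    also have "res n Y S' {} xS' {} (res n Y S' S0 S' {} \<sigma>) = res n Y xS' xS0 xS' {} ?\<sigma>"
      using res_comp[OF sp(3) spY(6) w'(1)] res_comp[OF spY(1) xsp(3) w'(1)] by simp
    finally show ?thesis .
  qed
  have e3: "pull (n + 1) xA xB (dmc A1' A2') (dmc B1' B2') ?c = res (n + 1) Y xN xK xN xM ?\<kappa>"
  proof -
    have ov: "over A B (dmc A1 A2) (dmc B1 B2)" "over xA xB (dmc A1' A2') (dmc B1' B2')"
      using over_dmc[OF cover] over_dmc[OF cover'] unfolding A_def B_def xA_def xB_def by simp_all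
    have dm: "dmc A1' A2' \<subseteq> dmc A1 A2" "dmc B1' B2' \<subseteq> dmc B1 B2" "dmc B1' B2' \<subseteq> dmc A1' A2'"
      using le mv_cover_openD(3,4)[OF cover'] by (intro dmc_mono; simp)+
    have "pull (n + 1) xA xB (dmc A1' A2') (dmc B1' B2') ?c = pull (n + 1) A B (dmc A1' A2') (dmc B1' B2') c"
      using pull_res[OF ov(2) spX(1) w'(3)] .
    also have "\<dots> = res (n + 1) Y N M xN xM (pull (n + 1) A B (dmc A1 A2) (dmc B1 B2) c)"
      using res_pull[OF ov(1) dm w'(3)] unfolding N_def M_def xN_def xM_def by simp
    also have "\<dots> = res (n + 1) Y xN xK xN xM ?\<kappa>"
      using res_comp[OF sp(1) spY(3) w'(2)] res_comp[OF spY(2) xsp(1) w'(2)] w'(6) by simp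
    finally show ?thesis .
  qed
  have "mv_witness n A1' B1' A2' B2' ?a ?\<sigma> ?\<kappa> ?c"
    unfolding mv_witness_def Let_def xfolds
    using e1 e2 e3 res_in[OF spY(1) w'(1)] res_in[OF spY(2) w'(2)] res_in[OF spX(1) w'(3)] by simp
  from mv_witness_unique[OF cover' this] show ?thesis
    unfolding folds xfolds c_def .
qed

text \<open>The slice over \<open>A\<close> at height \<open>t\<close> lies in the subspace to which
  \<open>\<kappa>\<close> is relative. So the class on the slice factors through the cohomology of a
  space relative to itself, which is zero, and \<open>pull_slice_bij\<close> transports this back to
  \<open>X\<close>.\<close>

lemma res_mv_diff_zero:
  assumes cover: "mv_cover A1 B1 A2 B2" and a: "a \<in> H n X (A1 \<inter> A2) (B1 \<inter> B2)"
    and i: "A = A1 \<and> B = B1 \<and> t = 0 \<or> A = A2 \<and> B = B2 \<and> t = (1::real)"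
  shows "res (n + 1) X (A1 \<union> A2) (B1 \<union> B2) A B (mv_diff n A1 B1 A2 B2 a) = 0"
proof -
  let ?c = "mv_diff n A1 B1 A2 B2 a"
  obtain \<sigma> \<kappa> where w: "mv_witness n A1 B1 A2 B2 a \<sigma> \<kappa> ?c"
    using mv_witness_mv_diff[OF cover a] .
  let ?N = "cyl (dmc A1 A2)" and ?M = "cyl (dmc B1 B2)" and ?K = "cyl (with_ends A1 B1 A2 B2)"
  have \<kappa>: "\<kappa> \<in> H (n + 1) Y ?N ?K"
    and pc: "pull (n + 1) (A1 \<union> A2) (B1 \<union> B2) (dmc A1 A2) (dmc B1 B2) ?c = res (n + 1) Y ?N ?K ?N ?M \<kappa>"
    using w unfolding mv_witness_def Let_def by auto
  note D = mv_cover_openD[OF cover] and sub = mv_cover_subsets[OF cover] and sp = mv_cover_sub_pairs[OF cover]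
  have c: "?c \<in> H (n + 1) X (A1 \<union> A2) (B1 \<union> B2)" by (rule mv_diff_in[OF cover a])
  have AB: "B \<subseteq> A" "A \<subseteq> topspace X" "A \<subseteq> A1 \<union> A2" "B \<subseteq> B1 \<union> B2" using i D by auto
  have sl: "A \<times> {t} \<subseteq> dmc A1 A2" "B \<times> {t} \<subseteq> dmc B1 B2" "B \<times> {t} \<subseteq> A \<times> {t}" "A \<times> {t} \<subseteq> with_ends A1 B1 A2 B2"
    using i AB by (auto simp: dmc_iff with_ends_iff)
  have spX: "sub_pair X (A1 \<union> A2) (B1 \<union> B2) A B"
    using AB D unfolding sub_pair_def by blast
  have MN: "dmc B1 B2 \<subseteq> dmc A1 A2" using D by (intro dmc_mono)
  have BK: "B \<times> {t} \<subseteq> with_ends A1 B1 A2 B2" using sl(3,4) by (rule order_trans)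
  note sp1 = sub_pair_cyl[OF sub(1) MN sl(1-3)]
  note sp2 = sub_pair_cyl[OF sub(1,2) sl(1,4) order_refl]
  have sp3: "sub_pair Y (cyl (A \<times> {t})) (cyl (A \<times> {t})) (cyl (A \<times> {t})) (cyl (B \<times> {t}))"
    by (rule sub_pair_cyl) (use AB in auto)
  have top: "cyl (A \<times> {t}) \<subseteq> topspace Y" using sp2 unfolding sub_pair_def by blast
  have "pull (n + 1) A B (A \<times> {t}) (B \<times> {t}) (res (n + 1) X (A1 \<union> A2) (B1 \<union> B2) A B ?c) =
      pull (n + 1) (A1 \<union> A2) (B1 \<union> B2) (A \<times> {t}) (B \<times> {t}) ?c"
    by (rule pull_res[OF over_slice[OF AB(1,2)] spX c])
  also have "\<dots> = res (n + 1) Y ?N ?M (cyl (A \<times> {t})) (cyl (B \<times> {t})) (res (n + 1) Y ?N ?K ?N ?M \<kappa>)"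
    using res_pull[OF over_dmc[OF cover] sl(1-3) c] pc by simp
  also have "\<dots> = res (n + 1) Y (cyl (A \<times> {t})) (cyl (A \<times> {t})) (cyl (A \<times> {t})) (cyl (B \<times> {t}))
      (res (n + 1) Y ?N ?K (cyl (A \<times> {t})) (cyl (A \<times> {t})) \<kappa>)"
    using res_comp[OF sp(1) sp1 \<kappa>] res_comp[OF sp2 sp3 \<kappa>] by simp
  also have "\<dots> = 0"
    using res_self_zero[OF top res_in[OF sp2 \<kappa>]] res_zero[OF sp3] by simp
  finally have z: "pull (n + 1) A B (A \<times> {t}) (B \<times> {t}) (res (n + 1) X (A1 \<union> A2) (B1 \<union> B2) A B ?c) = 0" .
  show ?thesis
    by (rule bij_betw_induced_zero[OF pull_slice_bij[OF AB(1,2), unfolded pull_def]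
        over_pair_map[OF over_slice[OF AB(1,2)]] res_in[OF spX c] z[unfolded pull_def]])
qed

text \<open>Comparing with the covers \<open>A1, A\<close> and \<open>A, A2\<close>, whose differentials vanish by
  \<open>res_mv_diff_zero\<close>, avoids any computation with the sign of the suspension isomorphism.\<close>

lemma mv_diff_res_zero:
  assumes cover: "mv_cover A1 B1 A2 B2"
    and i: "A = A1 \<and> B = B1 \<or> A = A2 \<and> B = B2" and a: "a \<in> H n X A B"
  shows "mv_diff n A1 B1 A2 B2 (res n X A B (A1 \<inter> A2) (B1 \<inter> B2) a) = 0"
proof -
  note D = mv_cover_openD[OF cover]
  have top: "A1 \<union> A2 \<subseteq> topspace X" "B1 \<union> B2 \<subseteq> A1 \<union> A2" using D by auto
  from i show ?thesis
  proof (elim disjE conjE)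
    assume AB: "A = A1" "B = B1"
    note cover' = mv_cover_absorb(1)[OF cover]
    have eq: "A1 \<inter> (A1 \<union> A2) = A1" "B1 \<inter> (B1 \<union> B2) = B1"
      "A1 \<union> (A1 \<union> A2) = A1 \<union> A2" "B1 \<union> (B1 \<union> B2) = B1 \<union> B2" by auto
    have a': "a \<in> H n X (A1 \<inter> (A1 \<union> A2)) (B1 \<inter> (B1 \<union> B2))" using a AB eq by simp
    \<comment> \<open>The second pair of this cover is the whole union, so the restriction to it is
      the identity.\<close>
    have "mv_diff n A1 B1 (A1 \<union> A2) (B1 \<union> B2) a = 0"
      using res_mv_diff_zero[OF cover' a', of "A1 \<union> A2" "B1 \<union> B2" 1]
        res_id[OF top mv_diff_in[OF cover' a', unfolded eq]] unfolding eq by simp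
    then show ?thesis
      using mv_diff_natural[OF cover' cover _ _ _ _ a'] res_zero[of X "A1 \<union> A2" "B1 \<union> B2" "A1 \<union> A2" "B1 \<union> B2"] top
      unfolding eq AB by (simp add: sub_pair_def)
  next
    assume AB: "A = A2" "B = B2"
    note cover' = mv_cover_absorb(2)[OF cover]
    have eq: "(A1 \<union> A2) \<inter> A2 = A2" "(B1 \<union> B2) \<inter> B2 = B2"
      "A1 \<union> A2 \<union> A2 = A1 \<union> A2" "B1 \<union> B2 \<union> B2 = B1 \<union> B2" by auto
    have a': "a \<in> H n X ((A1 \<union> A2) \<inter> A2) ((B1 \<union> B2) \<inter> B2)" using a AB eq by simp
    have "mv_diff n (A1 \<union> A2) (B1 \<union> B2) A2 B2 a = 0"
      using res_mv_diff_zero[OF cover' a', of "A1 \<union> A2" "B1 \<union> B2" 0]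
        res_id[OF top mv_diff_in[OF cover' a', unfolded eq]] unfolding eq by simp
    then show ?thesis
      using mv_diff_natural[OF cover' cover _ _ _ _ a'] res_zero[of X "A1 \<union> A2" "B1 \<union> B2" "A1 \<union> A2" "B1 \<union> B2"] top
      unfolding eq AB by (simp add: sub_pair_def)
  qed
qed

end

section \<open>Inverse limits along increasing unions\<close>

context cylinder_theory
begin

text \<open>For increasing \<open>A\<close> the fibre over a point is the half-line
  \<open>{k..}\<close>, where \<open>k\<close> is the first stage that contains the point. In
  particular the fibres are convex.\<close>

definition telescope :: "(nat \<Rightarrow> 'u set) \<Rightarrow> ('u \<times> real) set" where
  "telescope A = {(a, t). 0 \<le> t \<and> a \<in> A (nat \<lfloor>t\<rfloor>)}"

text \<open>The function \<open>l\<close> is a section of the projection from the telescope to the union.\<close>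

definition exhaustion :: "(nat \<Rightarrow> 'u set) \<Rightarrow> bool" where
  "exhaustion A \<longleftrightarrow> (\<forall>k. A k \<subseteq> A (Suc k) \<and> A k \<subseteq> topspace X) \<and>
     (\<exists>l. continuous_map (subtopology X (\<Union>k. A k)) euclideanreal l \<and>
       (\<forall>a\<in>\<Union>k. A k. 0 \<le> l a \<and> a \<in> A (nat \<lfloor>l a\<rfloor>)))"

definition strips :: "('u \<times> real) set \<Rightarrow> real set \<Rightarrow> ('u \<times> real) set" where
  "strips P J = {(a, t) \<in> P. t \<in> J}"

text \<open>The pieces are preimages of disjoint open sets under the height, so the additivity axiom
  applies to them.\<close>

lemma
  fixes J :: "nat \<Rightarrow> real set"
  assumes P: "P \<subseteq> topspace X \<times> UNIV" and op: "\<And>k. open (J k)"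
    and disj: "\<And>j k. j \<in> I \<Longrightarrow> k \<in> I \<Longrightarrow> j \<noteq> k \<Longrightarrow> J j \<inter> J k = {}"
    and JI: "JI = (\<Union>k\<in>I. J k)"
  shows strips_additivity_ex: "(\<And>k. k \<in> I \<Longrightarrow> c k \<in> H n Y (cyl (strips P (J k))) {}) \<Longrightarrow>
      \<exists>a\<in>H n Y (cyl (strips P JI)) {}. \<forall>k\<in>I. res n Y (cyl (strips P JI)) {} (cyl (strips P (J k))) {} a = c k"
    and strips_additivity_inj: "a \<in> H n Y (cyl (strips P JI)) {} \<Longrightarrow>
      (\<And>k. k \<in> I \<Longrightarrow> res n Y (cyl (strips P JI)) {} (cyl (strips P (J k))) {} a = 0) \<Longrightarrow> a = 0"
proof -
  let ?Z = "subtopology Y (cyl (strips P JI))"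
  let ?W = "\<lambda>k. cyl (strips P (J k))"
  have PI: "strips P JI \<subseteq> topspace X \<times> UNIV" using P unfolding strips_def by auto
  have le: "?W k \<subseteq> cyl (strips P JI)" if "k \<in> I" for k
    using that unfolding JI strips_def by (intro image_mono) auto
  have openW: "openin ?Z (?W k)" if "k \<in> I" for k
  proof -
    have eq: "strips P (J k) = {(a, t) \<in> strips P JI. a \<in> topspace X \<and> t \<in> J k}"
      using P that unfolding strips_def JI by auto
    show ?thesis
      unfolding eq by (rule openin_cyl[OF PI openin_topspace op])
  qed
  have disjW: "?W j \<inter> ?W k = {}" if "j \<in> I" "k \<in> I" "j \<noteq> k" for j k
    using disj[OF that] unfolding cyl_Int strips_def by auto
  have cover: "(\<Union>k\<in>I. ?W k) = topspace ?Z"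
    unfolding topspace_cyl[OF PI] unfolding JI strips_def by auto
  have nested: "subtopology ?Z (?W k) = subtopology Y (?W k)" if "k \<in> I" for k
    by (rule subtopology_nested[OF le[OF that]])
  show "\<exists>a\<in>H n Y (cyl (strips P JI)) {}. \<forall>k\<in>I. res n Y (cyl (strips P JI)) {} (?W k) {} a = c k"
    if "\<And>k. k \<in> I \<Longrightarrow> c k \<in> H n Y (?W k) {}"
    using additivity_ex[of "{}" ?Z I ?W c n, OF _ openW disjW cover] that nested
    by (auto simp: restriction_def)
  show "a = 0" if "a \<in> H n Y (cyl (strips P JI)) {}"
      "\<And>k. k \<in> I \<Longrightarrow> res n Y (cyl (strips P JI)) {} (?W k) {} a = 0"
    using additivity_inj[of "{}" ?Z I ?W a n, OF _ openW disjW cover] that nested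
    by (auto simp: restriction_def)
qed

section \<open>The telescope as a union of even and odd strips\<close>

context
  fixes A :: "nat \<Rightarrow> 'u set"
  assumes exhaustion: "exhaustion A"
begin

lemma exhaustion_mono: "j \<le> k \<Longrightarrow> A j \<subseteq> A k"
  using exhaustion lift_Suc_mono_le[of A] unfolding exhaustion_def by blast

lemma exhaustion_top: "A k \<subseteq> topspace X" "(\<Union>k. A k) \<subseteq> topspace X"
  using exhaustion unfolding exhaustion_def by blast+

lemma sub_pair_stage: "sub_pair X (\<Union>k. A k) {} (A j) {}" "j \<le> k \<Longrightarrow> sub_pair X (A k) {} (A j) {}"
  using exhaustion_top exhaustion_mono unfolding sub_pair_def by auto

abbreviation (input) "Tl \<equiv> telescope A"
text \<open>Open intervals around the integers: those of equal parity are disjoint, together they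
  cover the nonnegative heights, and the neighbours \<open>JU k\<close> and
  \<open>JU (Suc k)\<close> meet in \<open>JW k\<close>. The strip over \<open>JU k\<close> slides
  up to height \<open>k\<close>, where the fibre is \<open>A k\<close>; the strip over
  \<open>JW k\<close> has the same stage \<open>A k\<close>.\<close>

abbreviation (input) "JU \<equiv> \<lambda>k::nat. {real k - 1<..<real k + 1}"
abbreviation (input) "JW \<equiv> \<lambda>k::nat. {real k<..<real k + 1}"
abbreviation (input) "Ue \<equiv> strips Tl (\<Union>k\<in>{k. even k}. JU k)"
abbreviation (input) "Uo \<equiv> strips Tl (\<Union>k\<in>{k. odd k}. JU k)"
abbreviation (input) "UW \<equiv> strips Tl (\<Union>k\<in>UNIV. JW k)"

lemma telescope_subset: "Tl \<subseteq> (\<Union>k. A k) \<times> UNIV" "Tl \<subseteq> topspace X \<times> UNIV"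
  using exhaustion_top unfolding telescope_def by auto

lemma strips_subset: "strips P J \<subseteq> P" "J \<subseteq> J' \<Longrightarrow> strips P J \<subseteq> strips P J'"
  unfolding strips_def by auto

lemma fiberwise_convex_telescope: "fiberwise_convex Tl"
  unfolding fiberwise_convex_def
proof (intro allI impI)
  fix a t t' s
  assume *: "(a, t) \<in> Tl" "(a, t') \<in> Tl" "t \<le> s" "s \<le> t'"
  then have "nat \<lfloor>t\<rfloor> \<le> nat \<lfloor>s\<rfloor>" by (intro nat_mono floor_mono)
  from exhaustion_mono[OF this] show "(a, s) \<in> Tl"
    using * unfolding telescope_def by auto
qed

lemma fiberwise_convex_strips:
  assumes "fiberwise_convex P" "is_interval J"
  shows "fiberwise_convex (strips P J)"
  using assms unfolding fiberwise_convex_def strips_def is_interval_1 by blast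

lemma strip_over:
  assumes "J \<subseteq> {..<real k + 1}"
  shows "over (A k) {} (strips Tl J) {}"
proof -
  have "a \<in> A k" if "(a, t) \<in> strips Tl J" for a t
  proof -
    have t: "0 \<le> t" "t < real k + 1" "a \<in> A (nat \<lfloor>t\<rfloor>)"
      using that assms unfolding strips_def telescope_def by auto
    then have "nat \<lfloor>t\<rfloor> \<le> k" by linarith
    from exhaustion_mono[OF this] show ?thesis using t(3) by blast
  qed
  then show ?thesis unfolding over_def using exhaustion_top by auto
qed

text \<open>Below height \<open>k + 1\<close> only stages up to \<open>k\<close> occur, and at the
  height \<open>s\<close>, which is at least \<open>k\<close>, all of \<open>A k\<close> is present.
  So the constant function \<open>s\<close> gives a section.\<close>

lemma pull_strip_bij:
  assumes "J \<subseteq> {..<real k + 1}" "is_interval J" "s \<in> J" "real k \<le> s"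
  shows "bij_betw (pull n (A k) {} (strips Tl J) {}) (H n X (A k) {}) (H n Y (cyl (strips Tl J)) {})"
proof -
  have "bij_betw (pull n (A k) {} (strips Tl J) {}) (H n X (A k) {}) (H n Y (cyl (strips Tl J)) (cyl {}))"
  proof (rule pull_bij[OF strip_over[OF assms(1)], where s = "\<lambda>_. s"])
    show "(a, s) \<in> strips Tl J" if "a \<in> A k" for a
    proof -
      have "k \<le> nat \<lfloor>s\<rfloor>" using assms(4) by (simp add: le_nat_floor)
      from exhaustion_mono[OF this] show ?thesis
        using that assms(3,4) unfolding strips_def telescope_def by auto
    qed
    show "fiberwise_convex (strips Tl J)"
      by (rule fiberwise_convex_strips[OF fiberwise_convex_telescope assms(2)])
  qed (auto simp: fiberwise_convex_def)
  then show ?thesis by simp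
qed

lemma pull_JU_bij: "bij_betw (pull n (A k) {} (strips Tl (JU k)) {}) (H n X (A k) {}) (H n Y (cyl (strips Tl (JU k))) {})"
  by (rule pull_strip_bij[where s = "real k"]) (auto simp: is_interval_1)

lemma pull_JW_bij: "bij_betw (pull n (A k) {} (strips Tl (JW k)) {}) (H n X (A k) {}) (H n Y (cyl (strips Tl (JW k))) {})"
  by (rule pull_strip_bij[where s = "real k + 1/2"]) (auto simp: is_interval_1)

lemma over_telescope: "over (\<Union>k. A k) {} Tl {}"
  unfolding over_def using telescope_subset(1) exhaustion_top(2) by simp

lemma pull_telescope_bij: "bij_betw (pull n (\<Union>k. A k) {} Tl {}) (H n X (\<Union>k. A k) {}) (H n Y (cyl Tl) {})"
proof -
  have "\<exists>l. continuous_map (subtopology X (\<Union>k. A k)) euclideanreal l \<and>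
      (\<forall>a\<in>\<Union>k. A k. 0 \<le> l a \<and> a \<in> A (nat \<lfloor>l a\<rfloor>))"
    using exhaustion unfolding exhaustion_def by (rule conjunct2)
  then obtain l where l: "continuous_map (subtopology X (\<Union>k. A k)) euclideanreal l"
    "\<forall>a\<in>\<Union>k. A k. 0 \<le> l a \<and> a \<in> A (nat \<lfloor>l a\<rfloor>)"
    by (elim exE conjE)
  have "bij_betw (pull n (\<Union>k. A k) {} Tl {}) (H n X (\<Union>k. A k) {}) (H n Y (cyl Tl) (cyl {}))"
  proof (rule pull_bij[OF over_telescope l(1) _ _ fiberwise_convex_telescope])
    show "(a, l a) \<in> Tl" if "a \<in> (\<Union>k. A k)" for a
      using bspec[OF l(2) that] unfolding telescope_def by simp
  qed (simp_all add: fiberwise_convex_def)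
  then show ?thesis by simp
qed

lemma strips_openin:
  assumes "open J"
  shows "openin (subtopology Y (cyl Tl)) (cyl (strips Tl J))"
proof -
  have "strips Tl J = {(a, t) \<in> Tl. a \<in> topspace X \<and> t \<in> J}"
    using telescope_subset(2) unfolding strips_def by auto
  then show ?thesis using openin_cyl[OF telescope_subset(2) openin_topspace assms] by simp
qed

lemma strips_union: "cyl Ue \<union> cyl Uo = cyl Tl"
proof -
  have in_union: "(a, t) \<in> Ue \<union> Uo" if "(a, t) \<in> Tl" for a t
  proof -
    have "0 \<le> t" using that unfolding telescope_def by auto
    then have "t \<in> JU (nat \<lfloor>t\<rfloor>)" by (simp; linarith)
    then show ?thesis
      using that unfolding strips_def by (cases "even (nat \<lfloor>t\<rfloor>)") blast+
  qed
  have "Ue \<union> Uo = Tl"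
  proof
    show "Ue \<union> Uo \<subseteq> Tl" by (intro Un_least strips_subset(1))
    show "Tl \<subseteq> Ue \<union> Uo" by (rule subrelI) (rule in_union)
  qed
  then show ?thesis by (simp only: image_Un[symmetric])
qed

text \<open>Intervals of different parity meet only if their centres are consecutive, and then in
  the open unit interval between the centres.\<close>

lemma strips_intersection: "cyl Ue \<inter> cyl Uo = cyl UW"
proof -
  have "(\<Union>k\<in>{k. even k}. JU k) \<inter> (\<Union>k\<in>{k. odd k}. JU k) = (\<Union>k\<in>UNIV. JW k)" (is "?E \<inter> ?O = ?W")
  proof
    show "?E \<inter> ?O \<subseteq> ?W"
    proof
      fix t assume "t \<in> ?E \<inter> ?O"
      then obtain j k where jk: "even j" "odd k" "t \<in> JU j" "t \<in> JU k" by blast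
      then have "j \<noteq> k" by blast
      moreover have "real j < real k + 2" "real k < real j + 2" using jk(3,4) by auto
      ultimately have "k = Suc j \<or> j = Suc k" by linarith
      then have "t \<in> JW j \<or> t \<in> JW k" using jk(3,4) by auto
      then show "t \<in> ?W" by blast
    qed
    show "?W \<subseteq> ?E \<inter> ?O"
    proof
      fix t assume "t \<in> ?W"
      then obtain k where "t \<in> JW k" by blast
      then have t: "t \<in> JU k" "t \<in> JU (Suc k)" by auto
      show "t \<in> ?E \<inter> ?O"
      proof (cases "even k")
        case True
        then have "k \<in> {k. even k}" "Suc k \<in> {k. odd k}" by simp_all
        then show ?thesis using t by blast
      next
        case False
        then have "Suc k \<in> {k. even k}" "k \<in> {k. odd k}" by simp_all
        then show ?thesis using t by blast
      qed
    qed
  qed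
  then have "Ue \<inter> Uo = UW" unfolding strips_def by blast
  then show ?thesis by (simp add: cyl_Int)
qed

lemma overlap_subset: "UW \<subseteq> Ue" "UW \<subseteq> Uo"
proof -
  have "cyl UW \<subseteq> cyl Ue" "cyl UW \<subseteq> cyl Uo" using strips_intersection by blast+
  then show "UW \<subseteq> Ue" "UW \<subseteq> Uo"
    using inj_image_subset_iff[OF inj_code] by blast+
qed

lemma JU_subset: "even k \<Longrightarrow> strips Tl (JU k) \<subseteq> Ue" "odd k \<Longrightarrow> strips Tl (JU k) \<subseteq> Uo"
  by (rule strips_subset(2), blast)+

lemma over_JU: "over (A k) {} (strips Tl (JU k)) {}"
  and over_JW: "over (A k) {} (strips Tl (JW k)) {}"
  by (rule strip_over, auto)+

lemma JU_disjoint: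
  assumes "j \<noteq> k" "even j = even k"
  shows "JU j \<inter> JU k = {}"
proof (rule ccontr)
  assume "JU j \<inter> JU k \<noteq> {}"
  then have "real j < real k + 2" "real k < real j + 2" by auto
  then have "k = Suc j \<or> j = Suc k" using assms(1) by linarith
  then show False using assms(2) by auto
qed

lemma JW_disjoint:
  assumes "j \<noteq> k"
  shows "JW j \<inter> JW k = {}"
proof (rule ccontr)
  assume "JW j \<inter> JW k \<noteq> {}"
  then have "real j < real k + 1" "real k < real j + 1" by auto
  then show False using assms by linarith
qed

lemma even_union: "\<exists>u\<in>H n Y (cyl Ue) {}. \<forall>k. even k \<longrightarrow>
      res n Y (cyl Ue) {} (cyl (strips Tl (JU k))) {} u = pull n (A k) {} (strips Tl (JU k)) {} (c k)"
  and odd_union: "\<exists>u\<in>H n Y (cyl Uo) {}. \<forall>k. odd k \<longrightarrow>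
      res n Y (cyl Uo) {} (cyl (strips Tl (JU k))) {} u = pull n (A k) {} (strips Tl (JU k)) {} (c k)"
  if "\<And>k. c k \<in> H n X (A k) {}"
proof -
  have in': "pull n (A k) {} (strips Tl (JU k)) {} (c k) \<in> H n Y (cyl (strips Tl (JU k))) {}" for k
    using pull_in[OF over_JU that] by simp
  show "\<exists>u\<in>H n Y (cyl Ue) {}. \<forall>k. even k \<longrightarrow>
      res n Y (cyl Ue) {} (cyl (strips Tl (JU k))) {} u = pull n (A k) {} (strips Tl (JU k)) {} (c k)"
  proof -
    have "\<exists>u\<in>H n Y (cyl Ue) {}. \<forall>k\<in>{k. even k}.
        res n Y (cyl Ue) {} (cyl (strips Tl (JU k))) {} u = pull n (A k) {} (strips Tl (JU k)) {} (c k)"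
    proof (rule strips_additivity_ex[OF telescope_subset(2) _ _ refl])
      show "JU j \<inter> JU k = {}" if "j \<in> {k. even k}" "k \<in> {k. even k}" "j \<noteq> k" for j k
        by (rule JU_disjoint) (use that in simp_all)
    qed (rule open_greaterThanLessThan, rule in')
    then show ?thesis by simp
  qed
  show "\<exists>u\<in>H n Y (cyl Uo) {}. \<forall>k. odd k \<longrightarrow>
      res n Y (cyl Uo) {} (cyl (strips Tl (JU k))) {} u = pull n (A k) {} (strips Tl (JU k)) {} (c k)"
  proof -
    have "\<exists>u\<in>H n Y (cyl Uo) {}. \<forall>k\<in>{k. odd k}.
        res n Y (cyl Uo) {} (cyl (strips Tl (JU k))) {} u = pull n (A k) {} (strips Tl (JU k)) {} (c k)"
    proof (rule strips_additivity_ex[OF telescope_subset(2) _ _ refl])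
      show "JU j \<inter> JU k = {}" if "j \<in> {k. odd k}" "k \<in> {k. odd k}" "j \<noteq> k" for j k
        by (rule JU_disjoint) (use that in simp_all)
    qed (rule open_greaterThanLessThan, rule in')
    then show ?thesis by simp
  qed
qed

lemma sub_pair_strips: "P' \<subseteq> P \<Longrightarrow> P \<subseteq> Tl \<Longrightarrow> sub_pair Y (cyl P) {} (cyl P') {}"
  using sub_pair_cyl[of P "{}" P' "{}"] telescope_subset(2) by auto

text \<open>Over \<open>JW k\<close> the classes \<open>u\<close> and \<open>v\<close> are given by
  the stages \<open>k\<close> and \<open>Suc k\<close>. The parity of \<open>k\<close> decides which
  of the two stages belongs to \<open>u\<close>, whence the sign.\<close>

lemma res_to_overlap:
  assumes c: "\<And>k. c k \<in> H n X (A k) {}"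
    and u: "u \<in> H n Y (cyl Ue) {}"
      "\<And>k. even k \<Longrightarrow> res n Y (cyl Ue) {} (cyl (strips Tl (JU k))) {} u = pull n (A k) {} (strips Tl (JU k)) {} (c k)"
    and v: "v \<in> H n Y (cyl Uo) {}"
      "\<And>k. odd k \<Longrightarrow> res n Y (cyl Uo) {} (cyl (strips Tl (JU k))) {} v = pull n (A k) {} (strips Tl (JU k)) {} (c k)"
  shows "res n Y (cyl UW) {} (cyl (strips Tl (JW k))) {}
      (res n Y (cyl Ue) {} (cyl UW) {} u - res n Y (cyl Uo) {} (cyl UW) {} v) =
    pull n (A k) {} (strips Tl (JW k)) {}
      (if even k then c k - res n X (A (Suc k)) {} (A k) {} (c (Suc k))
       else res n X (A (Suc k)) {} (A k) {} (c (Suc k)) - c k)"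
proof -
  let ?W = "cyl (strips Tl (JW k))"
  note UWe = overlap_subset
  have WJ: "strips Tl (JW k) \<subseteq> UW" "strips Tl (JW k) \<subseteq> strips Tl (JU k)"
    "strips Tl (JW k) \<subseteq> strips Tl (JU (Suc k))"
    by (rule strips_subset(2); force)+
  note T = strips_subset(1)[of Tl]
  have sp: "sub_pair Y (cyl Ue) {} (cyl UW) {}" "sub_pair Y (cyl Uo) {} (cyl UW) {}"
    "sub_pair Y (cyl UW) {} ?W {}"
    by (intro sub_pair_strips UWe WJ T)+
  note ov = over_JU and ovW = over_JW[of k]
  have pk: "res n Y (cyl (strips Tl (JU k))) {} ?W {} (pull n (A k) {} (strips Tl (JU k)) {} (c k)) =
      pull n (A k) {} (strips Tl (JW k)) {} (c k)"
    using res_pull[OF ov WJ(2) _ _ c, of "{}"] by simp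
  have pSk: "res n Y (cyl (strips Tl (JU (Suc k)))) {} ?W {} (pull n (A (Suc k)) {} (strips Tl (JU (Suc k))) {} (c (Suc k))) =
      pull n (A k) {} (strips Tl (JW k)) {} (res n X (A (Suc k)) {} (A k) {} (c (Suc k)))"
    using res_pull[OF ov WJ(3) _ _ c, of "{}"] pull_res[OF ovW sub_pair_stage(2) c, of "Suc k"] by simp
  have rc: "res n X (A (Suc k)) {} (A k) {} (c (Suc k)) \<in> H n X (A k) {}"
    by (rule res_in[OF sub_pair_stage(2) c]) simp
  have ru: "res n Y (cyl Ue) {} ?W {} u =
      res n Y (cyl (strips Tl (JU j))) {} ?W {} (pull n (A j) {} (strips Tl (JU j)) {} (c j))"
    if "even j" "strips Tl (JW k) \<subseteq> strips Tl (JU j)" for j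
    using res_comp[OF sub_pair_strips[OF JU_subset(1)[OF that(1)] T] sub_pair_strips[OF that(2) T] u(1)] u(2)[OF that(1)]
    by simp
  have rv: "res n Y (cyl Uo) {} ?W {} v =
      res n Y (cyl (strips Tl (JU j))) {} ?W {} (pull n (A j) {} (strips Tl (JU j)) {} (c j))"
    if "odd j" "strips Tl (JW k) \<subseteq> strips Tl (JU j)" for j
    using res_comp[OF sub_pair_strips[OF JU_subset(2)[OF that(1)] T] sub_pair_strips[OF that(2) T] v(1)] v(2)[OF that(1)]
    by simp
  have "res n Y (cyl UW) {} ?W {} (res n Y (cyl Ue) {} (cyl UW) {} u - res n Y (cyl Uo) {} (cyl UW) {} v) =
      res n Y (cyl Ue) {} ?W {} u - res n Y (cyl Uo) {} ?W {} v"
    using res_diff[OF sp(3) res_in[OF sp(1) u(1)] res_in[OF sp(2) v(1)]]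
      res_comp[OF sp(1,3) u(1)] res_comp[OF sp(2,3) v(1)] by simp
  then show ?thesis
    using ru[of k] ru[of "Suc k"] rv[of k] rv[of "Suc k"] WJ(2,3) pk pSk
      pull_diff[OF ovW c rc] pull_diff[OF ovW rc c]
    by (cases "even k") simp_all
qed

lemma overlap_zeroI:
  assumes "d \<in> H n Y (cyl UW) {}" "\<And>k. res n Y (cyl UW) {} (cyl (strips Tl (JW k))) {} d = 0"
  shows "d = 0"
  by (rule strips_additivity_inj[OF telescope_subset(2), of JW UNIV _ d n, OF _ JW_disjoint refl assms(1)])
    (use assms(2) in auto)

lemma telescope_open_cover:
  defines "Z \<equiv> subtopology Y (cyl Tl)"
  shows "openin Z (cyl Ue)" "openin Z (cyl Uo)"
    "P \<subseteq> Tl \<Longrightarrow> subtopology Z (cyl P) = subtopology Y (cyl P)"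
  unfolding Z_def by (auto intro!: strips_openin subtopology_nested)

text \<open>One half of Milnor's sequence. On the telescope a compatible family defines a class on
  the even strips and one on the odd strips; by compatibility they agree on the overlap, so they
  glue to a class of the telescope, that is, of the union.\<close>

lemma inverse_limit_surjective:
  assumes c: "\<And>k. c k \<in> H n X (A k) {}"
    and compat: "\<And>k. res n X (A (Suc k)) {} (A k) {} (c (Suc k)) = c k"
  obtains a where "a \<in> H n X (\<Union>k. A k) {}" "\<And>k. res n X (\<Union>k. A k) {} (A k) {} a = c k"
proof -
  let ?Z = "subtopology Y (cyl Tl)"
  obtain u where u: "u \<in> H n Y (cyl Ue) {}"
      "\<And>k. even k \<Longrightarrow> res n Y (cyl Ue) {} (cyl (strips Tl (JU k))) {} u = pull n (A k) {} (strips Tl (JU k)) {} (c k)"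
    using even_union[OF c] by blast
  obtain v where v: "v \<in> H n Y (cyl Uo) {}"
      "\<And>k. odd k \<Longrightarrow> res n Y (cyl Uo) {} (cyl (strips Tl (JU k))) {} v = pull n (A k) {} (strips Tl (JU k)) {} (c k)"
    using odd_union[OF c] by blast
  note UWe = overlap_subset
  note T = strips_subset(1)[of Tl]
  have sp: "sub_pair Y (cyl Ue) {} (cyl UW) {}" "sub_pair Y (cyl Uo) {} (cyl UW) {}"
    by (intro sub_pair_strips UWe T)+
  let ?d = "res n Y (cyl Ue) {} (cyl UW) {} u - res n Y (cyl Uo) {} (cyl UW) {} v"
  have top: "cyl UW \<subseteq> topspace Y" using sp unfolding sub_pair_def by blast
  have "?d = 0"
  proof (rule overlap_zeroI)
    show "?d \<in> H n Y (cyl UW) {}"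
      by (rule H_diff[OF _ top res_in[OF sp(1) u(1)] res_in[OF sp(2) v(1)]]) simp
    show "res n Y (cyl UW) {} (cyl (strips Tl (JW k))) {} ?d = 0" for k
      using res_to_overlap[OF c u v, of k] compat pull_zero[OF over_JW] by simp
  qed
  then have agree: "res n Y (cyl Ue) {} (cyl UW) {} u = res n Y (cyl Uo) {} (cyl UW) {} v" by simp
  note Z = telescope_open_cover
  obtain q where "q \<in> H n ?Z (cyl Ue \<union> cyl Uo) {}"
    "res n ?Z (cyl Ue \<union> cyl Uo) {} (cyl Ue) {} q = u" "res n ?Z (cyl Ue \<union> cyl Uo) {} (cyl Uo) {} q = v"
  proof (rule mayer_vietoris_glue[OF Z(1,2), of u n v])
    show "u \<in> H n ?Z (cyl Ue) {}" "v \<in> H n ?Z (cyl Uo) {}"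
      using u(1) v(1) by (simp_all add: Z(3)[OF T])
    show "res n ?Z (cyl Ue) {} (cyl Ue \<inter> cyl Uo) {} u = res n ?Z (cyl Uo) {} (cyl Ue \<inter> cyl Uo) {} v"
      using agree unfolding strips_intersection restriction_def Z(3)[OF T] .
  qed
  then have q: "q \<in> H n Y (cyl Tl) {}" "res n Y (cyl Tl) {} (cyl Ue) {} q = u" "res n Y (cyl Tl) {} (cyl Uo) {} q = v"
    unfolding strips_union restriction_def Z(3)[OF T] Z(3)[OF order_refl] by auto
  obtain a where a: "a \<in> H n X (\<Union>k. A k) {}" "pull n (\<Union>k. A k) {} Tl {} a = q"
    using bij_betw_onto[OF pull_telescope_bij q(1)] by blast
  have "res n X (\<Union>k. A k) {} (A k) {} a = c k" for k
  proof -
    let ?J = "strips Tl (JU k)"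
    note ov = over_JU[of k]
    have "pull n (A k) {} ?J {} (res n X (\<Union>k. A k) {} (A k) {} a) = pull n (\<Union>k. A k) {} ?J {} a"
      by (rule pull_res[OF ov sub_pair_stage(1) a(1)])
    also have "\<dots> = res n Y (cyl Tl) {} (cyl ?J) {} q"
      using res_pull[OF over_telescope T _ _ a(1), of "{}"] a(2) by simp
    also have "\<dots> = pull n (A k) {} ?J {} (c k)"
    proof (cases "even k")
      case True
      then show ?thesis
        using res_comp[OF sub_pair_strips[OF T order_refl] sub_pair_strips[OF JU_subset(1) T] q(1)] q(2) u(2)[of k] by simp
    next
      case False
      then show ?thesis
        using res_comp[OF sub_pair_strips[OF T order_refl] sub_pair_strips[OF JU_subset(2) T] q(1)] q(3) v(2)[of k] by simp
    qed
    finally show ?thesis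
      by (rule bij_betw_eq[OF pull_JU_bij res_in[OF sub_pair_stage(1) a(1)] c])
  qed
  then show thesis using that a(1) by blast
qed

text \<open>The other half of Milnor's sequence: the kernel is the cohomology of the overlap in
  degree \<open>n - 1\<close> modulo differences of restrictions, a derived limit. It vanishes
  because finite-dimensionality makes it possible to choose the \<open>c k\<close> with
  \<open>c k\<close> minus the restriction of \<open>c (Suc k)\<close> prescribed, for all
  \<open>k\<close> at once.\<close>

lemma inverse_limit_injective:
  assumes fin: "\<And>k. finite_dimensional (scale h) (H (n - 1) X (A k) {})"
    and a: "a \<in> H n X (\<Union>k. A k) {}" "\<And>k. res n X (\<Union>k. A k) {} (A k) {} a = 0"
  shows "a = 0"
proof -
  let ?Z = "subtopology Y (cyl Tl)"
  let ?q = "pull n (\<Union>k. A k) {} Tl {} a"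
  note T = strips_subset(1)[of Tl] and Z = telescope_open_cover
  have q: "?q \<in> H n Y (cyl Tl) {}" using pull_in[OF over_telescope a(1)] by simp
  have rq: "res n Y (cyl Tl) {} (cyl (strips Tl (JU k))) {} ?q = 0" for k
  proof -
    note ov = over_JU[of k]
    show ?thesis
      using res_pull[OF over_telescope T _ _ a(1), of "{}"] pull_res[OF ov sub_pair_stage(1) a(1)]
        a(2)[of k] pull_zero[OF ov] by simp
  qed
  have spT: "sub_pair Y (cyl Tl) {} (cyl Ue) {}" "sub_pair Y (cyl Tl) {} (cyl Uo) {}"
    by (intro sub_pair_strips T order_refl)+
  have qe: "res n Y (cyl Tl) {} (cyl Ue) {} ?q = 0"
  proof (rule strips_additivity_inj[OF telescope_subset(2), of JU "{k. even k}", OF _ JU_disjoint refl res_in[OF spT(1) q]])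
    show "res n Y (cyl Ue) {} (cyl (strips Tl (JU k))) {} (res n Y (cyl Tl) {} (cyl Ue) {} ?q) = 0" if "k \<in> {k. even k}" for k
      using res_comp[OF spT(1) sub_pair_strips[OF JU_subset(1) T] q, of k] that rq by simp
  qed auto
  have qo: "res n Y (cyl Tl) {} (cyl Uo) {} ?q = 0"
  proof (rule strips_additivity_inj[OF telescope_subset(2), of JU "{k. odd k}", OF _ JU_disjoint refl res_in[OF spT(2) q]])
    show "res n Y (cyl Uo) {} (cyl (strips Tl (JU k))) {} (res n Y (cyl Tl) {} (cyl Uo) {} ?q) = 0" if "k \<in> {k. odd k}" for k
      using res_comp[OF spT(2) sub_pair_strips[OF JU_subset(2) T] q, of k] that rq by simp
  qed auto
  have surj: "\<exists>u\<in>H (n - 1) Y (cyl Ue) {}. \<exists>v\<in>H (n - 1) Y (cyl Uo) {}.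
      d = res (n - 1) Y (cyl Ue) {} (cyl UW) {} u - res (n - 1) Y (cyl Uo) {} (cyl UW) {} v"
    if d: "d \<in> H (n - 1) Y (cyl UW) {}" for d
  proof -
    let ?m = "n - 1"
    have WU: "strips Tl (JW k) \<subseteq> UW" for k by (rule strips_subset(2)) force
    have spW: "sub_pair Y (cyl UW) {} (cyl (strips Tl (JW k))) {}" for k
      by (rule sub_pair_strips[OF WU T])
    have "\<forall>k. \<exists>e. e \<in> H ?m X (A k) {} \<and> pull ?m (A k) {} (strips Tl (JW k)) {} e =
        res ?m Y (cyl UW) {} (cyl (strips Tl (JW k))) {} d"
      using bij_betw_onto[OF pull_JW_bij res_in[OF spW d]] unfolding Bex_def by (rule allI)
    from choice[OF this] obtain e where "\<forall>k. e k \<in> H ?m X (A k) {} \<and>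
      pull ?m (A k) {} (strips Tl (JW k)) {} (e k) = res ?m Y (cyl UW) {} (cyl (strips Tl (JW k))) {} d" ..
    then have e: "\<And>k. e k \<in> H ?m X (A k) {}"
      "\<And>k. pull ?m (A k) {} (strips Tl (JW k)) {} (e k) = res ?m Y (cyl UW) {} (cyl (strips Tl (JW k))) {} d"
      by simp_all
    \<comment> \<open>The alternating sign undoes the one in \<open>res_to_overlap\<close>.\<close>
    define e' where "e' k = (if even k then e k else - e k)" for k
    have HA: "vs.subspace (H ?m X (A k) {})" for k
      by (rule H_subspace) (use exhaustion_top in auto)
    have e': "e' k \<in> H ?m X (A k) {}" for k
      unfolding e'_def using e(1) vs.subspace_neg[OF HA] by simp
    have sps: "sub_pair X (A (Suc k)) {} (A k) {}" for k by (rule sub_pair_stage(2)) simp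
    \<comment> \<open>The family sought is a thread for the restriction maps translated by
      \<open>e'\<close>; the affine sets are the full cohomology spaces.\<close>
    have "\<exists>c. \<forall>k. c k \<in> H ?m X (A k) {} \<and> res ?m X (A (Suc k)) {} (A k) {} (c (Suc k)) + e' k = c k"
    proof (rule vs.affine_inverse_system_thread)
      show "vs.affine_subset (H ?m X (A k) {})" for k
        unfolding vs.affine_subset_def
        using vs.subspace_add[OF HA] vs.subspace_diff[OF HA] vs.subspace_scale[OF HA] by blast
      show "H ?m X (A k) {} \<noteq> {}" for k using e' by blast
      show "\<exists>B. finite B \<and> H ?m X (A k) {} \<subseteq> vs.span B" for k
        using fin[of k] unfolding finite_dimensional_def by auto
      show "res ?m X (A (Suc k)) {} (A k) {} x + e' k \<in> H ?m X (A k) {}"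
        if "x \<in> H ?m X (A (Suc k)) {}" for k x
        using vs.subspace_add[OF HA res_in[OF sps that] e'] .
      show "res ?m X (A (Suc k)) {} (A k) {} (scale h b (x - y) + z) + e' k =
          scale h b (res ?m X (A (Suc k)) {} (A k) {} x + e' k - (res ?m X (A (Suc k)) {} (A k) {} y + e' k)) +
          (res ?m X (A (Suc k)) {} (A k) {} z + e' k)"
        if x: "x \<in> H ?m X (A (Suc k)) {}" and y: "y \<in> H ?m X (A (Suc k)) {}" and z: "z \<in> H ?m X (A (Suc k)) {}"
        for k x y z b
      proof -
        have xy: "x - y \<in> H ?m X (A (Suc k)) {}" by (rule vs.subspace_diff[OF HA x y])
        have "scale h b (x - y) \<in> H ?m X (A (Suc k)) {}" by (rule vs.subspace_scale[OF HA xy])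
        from res_add[OF sps this z] show ?thesis
          using res_scale[OF sps xy, of b] res_diff[OF sps x y] by simp
      qed
    qed
    then obtain c where c: "\<And>k. c k \<in> H ?m X (A k) {}"
      "\<And>k. res ?m X (A (Suc k)) {} (A k) {} (c (Suc k)) + e' k = c k" by blast
    have c': "c k - res ?m X (A (Suc k)) {} (A k) {} (c (Suc k)) = e' k" for k
      using c(2)[of k] by (simp add: algebra_simps)
    have c'': "res ?m X (A (Suc k)) {} (A k) {} (c (Suc k)) - c k = - e' k" for k
      using c'[of k] by (simp add: algebra_simps)
    obtain u where u: "u \<in> H ?m Y (cyl Ue) {}"
        "\<And>k. even k \<Longrightarrow> res ?m Y (cyl Ue) {} (cyl (strips Tl (JU k))) {} u = pull ?m (A k) {} (strips Tl (JU k)) {} (c k)"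
      using even_union[OF c(1)] by blast
    obtain v where v: "v \<in> H ?m Y (cyl Uo) {}"
        "\<And>k. odd k \<Longrightarrow> res ?m Y (cyl Uo) {} (cyl (strips Tl (JU k))) {} v = pull ?m (A k) {} (strips Tl (JU k)) {} (c k)"
      using odd_union[OF c(1)] by blast
    have sp: "sub_pair Y (cyl Ue) {} (cyl UW) {}" "sub_pair Y (cyl Uo) {} (cyl UW) {}"
      by (intro sub_pair_strips overlap_subset T)+
    let ?w = "res ?m Y (cyl Ue) {} (cyl UW) {} u - res ?m Y (cyl Uo) {} (cyl UW) {} v"
    have top: "cyl UW \<subseteq> topspace Y" using sp unfolding sub_pair_def by blast
    have w: "?w \<in> H ?m Y (cyl UW) {}"
      by (rule H_diff[OF _ top res_in[OF sp(1) u(1)] res_in[OF sp(2) v(1)]]) simp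
    have "d - ?w = 0"
    proof (rule overlap_zeroI)
      show "d - ?w \<in> H ?m Y (cyl UW) {}" by (rule H_diff[OF _ top d w]) simp
      have "res ?m Y (cyl UW) {} (cyl (strips Tl (JW k))) {} ?w = res ?m Y (cyl UW) {} (cyl (strips Tl (JW k))) {} d" for k
        using res_to_overlap[OF c(1) u v, of k] e(2)[of k] c'[of k] c''[of k]
        by (cases "even k") (simp_all add: e'_def)
      then show "res ?m Y (cyl UW) {} (cyl (strips Tl (JW k))) {} (d - ?w) = 0" for k
        using res_diff[OF spW d w] by simp
    qed
    then have "d = ?w" by simp
    then show ?thesis using u(1) v(1) by blast
  qed
  have "?q = 0"
  proof (rule mayer_vietoris_injective[OF Z(1,2), of n])
    show "?q \<in> H n ?Z (cyl Ue \<union> cyl Uo) {}"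
      using q unfolding strips_union Z(3)[OF order_refl] .
    show "res n ?Z (cyl Ue \<union> cyl Uo) {} (cyl Ue) {} ?q = 0"
      using qe unfolding strips_union restriction_def Z(3)[OF T] Z(3)[OF order_refl] .
    show "res n ?Z (cyl Ue \<union> cyl Uo) {} (cyl Uo) {} ?q = 0"
      using qo unfolding strips_union restriction_def Z(3)[OF T] Z(3)[OF order_refl] .
    show "\<exists>u\<in>H (n - 1) ?Z (cyl Ue) {}. \<exists>v\<in>H (n - 1) ?Z (cyl Uo) {}.
        d = res (n - 1) ?Z (cyl Ue) {} (cyl Ue \<inter> cyl Uo) {} u - res (n - 1) ?Z (cyl Uo) {} (cyl Ue \<inter> cyl Uo) {} v"
      if "d \<in> H (n - 1) ?Z (cyl Ue \<inter> cyl Uo) {}" for d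
      using surj that unfolding strips_intersection restriction_def Z(3)[OF T] .
  qed
  then have "induced h n (subtopology Y (cyl Tl)) (cyl {}) (subtopology X (\<Union>k. A k)) {} proj a = 0"
    unfolding pull_def .
  moreover have "bij_betw (induced h n (subtopology Y (cyl Tl)) (cyl {}) (subtopology X (\<Union>k. A k)) {} proj)
      (H n X (\<Union>k. A k) {}) (H n Y (cyl Tl) (cyl {}))"
    using pull_telescope_bij[of n] unfolding pull_def by simp
  ultimately show "a = 0"
    using bij_betw_induced_zero over_pair_map[OF over_telescope] a(1) by blast
qed

end

end

section \<open>From spaces to pairs of spaces\<close>

context cylinder_theory
begin

text \<open>In contrast to \<open>inverse_limit_injective\<close>, the maps are now plain
  restrictions, and the affine sets \<open>S k\<close> carry the constraint on the choices.\<close>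

lemma relative_affine_thread:
  fixes P Q :: "nat \<Rightarrow> 'u set" and S :: "nat \<Rightarrow> 'v set"
  assumes sp: "\<And>k. sub_pair X (P (Suc k)) {} (P k) {}"
    and fin: "\<And>k. finite_dimensional (scale h) (H m X (P k) {})"
    and S: "\<And>k. S k \<subseteq> H m X (P k) {}" "\<And>k. S k \<noteq> {}" "\<And>k. vs.affine_subset (S k)"
    and into: "\<And>k x. x \<in> S (Suc k) \<Longrightarrow> res m X (P (Suc k)) {} (P k) {} x \<in> S k"
  shows "\<exists>c. \<forall>k. c k \<in> S k \<and> res m X (P (Suc k)) {} (P k) {} (c (Suc k)) = c k"
proof (rule vs.affine_inverse_system_thread[OF S(3,2) _ into])
    show "\<exists>B. finite B \<and> S k \<subseteq> vs.span B" for k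
      using fin[of k] S(1)[of k] unfolding finite_dimensional_def by blast
    show "res m X (P (Suc k)) {} (P k) {} (scale h b (x - y) + z) =
        scale h b (res m X (P (Suc k)) {} (P k) {} x - res m X (P (Suc k)) {} (P k) {} y) + res m X (P (Suc k)) {} (P k) {} z"
      if "x \<in> S (Suc k)" "y \<in> S (Suc k)" "z \<in> S (Suc k)" for k x y z b
    proof -
      have top: "P (Suc k) \<subseteq> topspace X" using sp[of k] unfolding sub_pair_def by blast
      have HS: "vs.subspace (H m X (P (Suc k)) {})" by (rule H_subspace[OF _ top]) simp
      have x: "x \<in> H m X (P (Suc k)) {}" and y: "y \<in> H m X (P (Suc k)) {}" and z: "z \<in> H m X (P (Suc k)) {}"
        using that S(1)[of "Suc k"] by blast+
      have xy: "x - y \<in> H m X (P (Suc k)) {}" by (rule vs.subspace_diff[OF HS x y])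
      have "scale h b (x - y) \<in> H m X (P (Suc k)) {}" by (rule vs.subspace_scale[OF HS xy])
      from res_add[OF sp this z] show ?thesis
        using res_scale[OF sp xy, of b] res_diff[OF sp x y] by simp
    qed
qed

lemma affine_subset_fibre:
  assumes "vs.subspace V" "linear_between (scale h) V W \<phi>"
  shows "vs.affine_subset {x \<in> V. \<phi> x = w}"
  unfolding vs.affine_subset_def
proof (intro ballI allI)
  fix x y z c assume x: "x \<in> {x \<in> V. \<phi> x = w}" and y: "y \<in> {x \<in> V. \<phi> x = w}" and z: "z \<in> {x \<in> V. \<phi> x = w}"
  have xy: "x - y \<in> V" using x y vs.subspace_diff[OF assms(1)] by blast
  then have s: "scale h c (x - y) \<in> V" by (rule vs.subspace_scale[OF assms(1)])
  have "\<phi> (x - y) = 0" using linear_between_diff[OF assms(2,1), of x y] x y by simp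
  then have "\<phi> (scale h c (x - y)) = 0"
    using assms(2) xy unfolding linear_between_def by simp
  then have "\<phi> (scale h c (x - y) + z) = w"
    using assms(2) s z unfolding linear_between_def by simp
  then show "scale h c (x - y) + z \<in> {x \<in> V. \<phi> x = w}"
    using vs.subspace_add[OF assms(1) s] z by simp
qed

context
  fixes A B :: "nat \<Rightarrow> 'u set"
  assumes exA: "exhaustion A" and exB: "exhaustion B" and BA: "\<And>k. B k \<subseteq> A k"
    and finA: "\<And>m k. finite_dimensional (scale h) (H m X (A k) {})"
    and finB: "\<And>m k. finite_dimensional (scale h) (H m X (B k) {})"
begin

abbreviation (input) "UA \<equiv> \<Union>k. A k"
abbreviation (input) "UB \<equiv> \<Union>k. B k"

lemma relative_sub_pairs:
  "UB \<subseteq> UA" "UA \<subseteq> topspace X" "A k \<subseteq> topspace X"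
  "sub_pair X UA UB (A k) (B k)" "sub_pair X (A k) (B k) (A k) {}"
  "sub_pair X (A k) {} (B k) {}" "sub_pair X UA UB UA {}" "sub_pair X UA {} UB {}"
  "sub_pair X (A (Suc k)) (B (Suc k)) (A k) (B k)"
  using exhaustion_top[OF exA] BA exhaustion_mono[OF exA, of k "Suc k"] exhaustion_mono[OF exB, of k "Suc k"]
  unfolding sub_pair_def by (simp_all add: UN_mono UN_upper)

lemmas stageA = sub_pair_stage(1)[OF exA] and stageB = sub_pair_stage(1)[OF exB]

lemma stage_Suc: "sub_pair X (A (Suc k)) {} (A k) {}" "sub_pair X (B (Suc k)) {} (B k) {}"
  by (rule sub_pair_stage(2)[OF exA], simp) (rule sub_pair_stage(2)[OF exB], simp)

lemma H_subspace_stage: "vs.subspace (H m X (A k) {})" "vs.subspace (H m X (B k) {})"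
  using exhaustion_top(1)[OF exA] exhaustion_top(1)[OF exB] by (simp_all add: H_subspace)

text \<open>By the absolute case \<open>c\<close> is the connecting image of a class
  \<open>d\<close> on the union of the \<open>B k\<close>, and \<open>d\<close> has to be extended
  to the union of the \<open>A k\<close>. Stage by stage it extends, because \<open>c\<close>
  vanishes there. The extensions form nonempty affine sets; a thread of them glues to a class that
  restricts to \<open>d\<close>, again by the absolute case.\<close>

lemma relative_limit_injective:
  assumes c: "c \<in> H n X UA UB" "\<And>k. res n X UA UB (A k) (B k) c = 0"
  shows "c = 0"
proof -
  note rsp = relative_sub_pairs
  let ?m = "n - 1"
  have jc: "res n X UA UB UA {} c = 0"
  proof (rule inverse_limit_injective[OF exA finA res_in[OF rsp(7) c(1)]])
    show "res n X UA {} (A k) {} (res n X UA UB UA {} c) = 0" for k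
      using res_comp[OF rsp(7) stageA c(1)] res_comp[OF rsp(4) rsp(5) c(1)] c(2) res_zero[OF rsp(5)] by simp
  qed
  obtain d where d: "d \<in> H ?m X UB {}" "connect h ?m (subtopology X UA) UB d = c"
    using res_lift_to_subspace[OF rsp(1,2) c(1) jc] .
  define S where "S k = {e \<in> H ?m X (A k) {}. res ?m X (A k) {} (B k) {} e = res ?m X UB {} (B k) {} d}" for k
  have "\<exists>e. \<forall>k. e k \<in> S k \<and> res ?m X (A (Suc k)) {} (A k) {} (e (Suc k)) = e k"
  proof (rule relative_affine_thread[where P = A and m = ?m and S = S, OF stage_Suc(1) finA])
    show "S k \<subseteq> H ?m X (A k) {}" for k unfolding S_def by blast
    show "vs.affine_subset (S k)" for k
      unfolding S_def by (rule affine_subset_fibre[OF H_subspace_stage(1) res_linear[OF rsp(6)]])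
    show "S k \<noteq> {}" for k
    proof -
      have "connect h ?m (subtopology X (A k)) (B k) (res ?m X UB {} (B k) {} d) = 0"
        using connect_res[OF rsp(4) d(1)] d(2) c(2) by simp
      then obtain b where "b \<in> H ?m X (A k) {}" "res ?m X (A k) {} (B k) {} b = res ?m X UB {} (B k) {} d"
        using res_extend_from_subspace[OF BA rsp(3) res_in[OF stageB d(1)]] by blast
      then show ?thesis unfolding S_def by blast
    qed
    show "res ?m X (A (Suc k)) {} (A k) {} x \<in> S k" if "x \<in> S (Suc k)" for k x
    proof -
      have x: "x \<in> H ?m X (A (Suc k)) {}" "res ?m X (A (Suc k)) {} (B (Suc k)) {} x = res ?m X UB {} (B (Suc k)) {} d"
        using that unfolding S_def by auto
      have "res ?m X (A k) {} (B k) {} (res ?m X (A (Suc k)) {} (A k) {} x) =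
          res ?m X (B (Suc k)) {} (B k) {} (res ?m X UB {} (B (Suc k)) {} d)"
        using res_comp[OF stage_Suc(1) rsp(6) x(1)] res_comp[OF rsp(6) stage_Suc(2) x(1)] x(2) by simp
      then show ?thesis
        unfolding S_def using res_in[OF stage_Suc(1) x(1)] res_comp[OF stageB stage_Suc(2) d(1)] by simp
    qed
  qed
  then obtain e where "\<forall>k. e k \<in> S k \<and> res ?m X (A (Suc k)) {} (A k) {} (e (Suc k)) = e k" ..
  then have e: "\<And>k. e k \<in> S k" "\<And>k. res ?m X (A (Suc k)) {} (A k) {} (e (Suc k)) = e k"
    by simp_all
  have eH: "e k \<in> H ?m X (A k) {}" and eB: "res ?m X (A k) {} (B k) {} (e k) = res ?m X UB {} (B k) {} d" for k
    using e(1)[of k] unfolding S_def by auto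
  obtain e' where e': "e' \<in> H ?m X UA {}" "\<And>k. res ?m X UA {} (A k) {} e' = e k"
    using inverse_limit_surjective[OF exA eH e(2)] by blast
  let ?r = "res ?m X UA {} UB {} e'"
  have r: "?r \<in> H ?m X UB {}" by (rule res_in[OF rsp(8) e'(1)])
  have UBtop: "UB \<subseteq> topspace X" using rsp(1,2) by (rule order_trans)
  have "?r - d = 0"
  proof (rule inverse_limit_injective[OF exB finB])
    show "?r - d \<in> H ?m X UB {}" by (rule H_diff[OF _ UBtop r d(1)]) simp
    show "res ?m X UB {} (B k) {} (?r - d) = 0" for k
      using res_diff[OF stageB r d(1)] res_comp[OF rsp(8) stageB e'(1)] res_comp[OF stageA rsp(6) e'(1)] e'(2) eB
      by simp
  qed
  then show "c = 0"
    using connect_res_zero[OF rsp(1,2) e'(1)] d(2) by simp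
qed

text \<open>After forgetting the \<open>B k\<close> the family glues to \<open>e\<close>, which
  vanishes on the union of the \<open>B k\<close> and so lifts to a relative class
  \<open>c'\<close>. The errors \<open>g k\<close> are connecting images of classes on the
  \<open>B k\<close>. A thread of such preimages glues to \<open>d'\<close>, whose connecting class
  corrects \<open>c'\<close>.\<close>

lemma relative_limit_surjective:
  assumes c: "\<And>k. c k \<in> H n X (A k) (B k)"
    and compat: "\<And>k. res n X (A (Suc k)) (B (Suc k)) (A k) (B k) (c (Suc k)) = c k"
  obtains a where "a \<in> H n X UA UB" "\<And>k. res n X UA UB (A k) (B k) a = c k"
proof -
  note rsp = relative_sub_pairs
  let ?m = "n - 1"
  have jc: "res n X (A k) (B k) (A k) {} (c k) \<in> H n X (A k) {}" for k
    by (rule res_in[OF rsp(5) c])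
  have "res n X (A (Suc k)) {} (A k) {} (res n X (A (Suc k)) (B (Suc k)) (A (Suc k)) {} (c (Suc k))) =
      res n X (A k) (B k) (A k) {} (c k)" for k
    using res_comp[OF rsp(5) stage_Suc(1) c] res_comp[OF rsp(9) rsp(5) c] compat by simp
  then obtain e where e: "e \<in> H n X UA {}" "\<And>k. res n X UA {} (A k) {} e = res n X (A k) (B k) (A k) {} (c k)"
    using inverse_limit_surjective[OF exA, of "\<lambda>k. res n X (A k) (B k) (A k) {} (c k)" n] jc by blast
  have "res n X UA {} UB {} e = 0"
  proof (rule inverse_limit_injective[OF exB finB res_in[OF rsp(8) e(1)]])
    show "res n X UB {} (B k) {} (res n X UA {} UB {} e) = 0" for k
    proof -
      have "sub_pair X (A k) (B k) (B k) {}" using rsp(6)[of k] BA unfolding sub_pair_def by simp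
      then have "res n X (A k) (B k) (B k) {} (c k) = 0"
        by (rule res_into_subset_zero[OF _ order_refl c])
      then show ?thesis
        using res_comp[OF rsp(8) stageB e(1)] res_comp[OF stageA rsp(6) e(1)] e(2) res_comp[OF rsp(5) rsp(6) c]
        by simp
    qed
  qed
  then obtain c' where c': "c' \<in> H n X UA UB" "res n X UA UB UA {} c' = e"
    using res_lift_to_relative[OF rsp(1,2) e(1)] by blast
  define g where "g k = c k - res n X UA UB (A k) (B k) c'" for k
  have c'k: "res n X UA UB (A k) (B k) c' \<in> H n X (A k) (B k)" for k by (rule res_in[OF rsp(4) c'(1)])
  have g: "g k \<in> H n X (A k) (B k)" for k
    unfolding g_def by (rule H_diff[OF BA rsp(3) c c'k])
  have jg: "res n X (A k) (B k) (A k) {} (g k) = 0" for k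
    unfolding g_def
    using res_diff[OF rsp(5) c c'k] res_comp[OF rsp(4) rsp(5) c'(1)] res_comp[OF rsp(7) stageA c'(1)] c'(2) e(2)
    by simp
  have gSuc: "res n X (A (Suc k)) (B (Suc k)) (A k) (B k) (g (Suc k)) = g k" for k
    unfolding g_def using res_diff[OF rsp(9) c c'k] res_comp[OF rsp(4) rsp(9) c'(1)] compat by simp
  define S where "S k = {d \<in> H ?m X (B k) {}. connect h ?m (subtopology X (A k)) (B k) d = g k}" for k
  have "\<exists>d. \<forall>k. d k \<in> S k \<and> res ?m X (B (Suc k)) {} (B k) {} (d (Suc k)) = d k"
  proof (rule relative_affine_thread[where P = B and m = ?m and S = S, OF stage_Suc(2) finB])
    show "S k \<subseteq> H ?m X (B k) {}" for k unfolding S_def by blast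
    have top: "B k \<subseteq> topspace (subtopology X (A k))" for k using BA rsp(3) by (simp add: order_trans[OF BA rsp(3)])
    show "vs.affine_subset (S k)" for k
      unfolding S_def
      by (rule affine_subset_fibre[OF H_subspace_stage(2)
            connect_linear[OF top, of ?m, unfolded subtopology_nested[OF BA]]])
    show "S k \<noteq> {}" for k
    proof -
      obtain b where "b \<in> H ?m X (B k) {}" "connect h ?m (subtopology X (A k)) (B k) b = g k"
        using res_lift_to_subspace[OF BA rsp(3) g jg] .
      then show ?thesis unfolding S_def by blast
    qed
    show "res ?m X (B (Suc k)) {} (B k) {} x \<in> S k" if "x \<in> S (Suc k)" for k x
    proof -
      have x: "x \<in> H ?m X (B (Suc k)) {}" "connect h ?m (subtopology X (A (Suc k))) (B (Suc k)) x = g (Suc k)"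
        using that unfolding S_def by auto
      show ?thesis
        unfolding S_def using res_in[OF stage_Suc(2) x(1)] connect_res[OF rsp(9) x(1)] x(2) gSuc by simp
    qed
  qed
  then obtain d where "\<forall>k. d k \<in> S k \<and> res ?m X (B (Suc k)) {} (B k) {} (d (Suc k)) = d k" ..
  then have d: "\<And>k. d k \<in> S k" "\<And>k. res ?m X (B (Suc k)) {} (B k) {} (d (Suc k)) = d k"
    by simp_all
  have dH: "d k \<in> H ?m X (B k) {}" and dg: "connect h ?m (subtopology X (A k)) (B k) (d k) = g k" for k
    using d(1)[of k] unfolding S_def by auto
  obtain d' where d': "d' \<in> H ?m X UB {}" "\<And>k. res ?m X UB {} (B k) {} d' = d k"
    using inverse_limit_surjective[OF exB dH d(2)] by blast
  let ?\<delta> = "connect h ?m (subtopology X UA) UB d'"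
  have \<delta>: "?\<delta> \<in> H n X UA UB" using connect_in_H[OF rsp(1,2) d'(1)] by simp
  show thesis
  proof (rule that)
    show "c' + ?\<delta> \<in> H n X UA UB" by (rule H_add[OF rsp(1,2) c'(1) \<delta>])
    show "res n X UA UB (A k) (B k) (c' + ?\<delta>) = c k" for k
    proof -
      have dk: "res n X UA UB (A k) (B k) ?\<delta> = c k - res n X UA UB (A k) (B k) c'"
        using connect_res[OF rsp(4) d'(1), of k] d'(2) dg[of k] unfolding g_def by simp
      show ?thesis unfolding res_add[OF rsp(4) c'(1) \<delta>] dk by simp
    qed
  qed
qed

end

section \<open>Finite-dimensionality\<close>

text \<open>\<open>finite_dimensional\<close> asks for a finite set that spans exactly the given
  space, so a basis inside the subspace has to be chosen.\<close>

lemma finite_dimensional_subspace: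
  assumes "vs.subspace U" "U \<subseteq> V" "finite_dimensional (scale h) V"
  shows "finite_dimensional (scale h) U"
proof -
  obtain B where B: "finite B" "vs.span B = V" using assms(3) unfolding finite_dimensional_def by blast
  obtain C where C: "C \<subseteq> U" "vs.independent C" "U \<subseteq> vs.span C"
    using vs.maximal_independent_subset by blast
  have "C \<subseteq> vs.span B" using C(1) assms(2) B(2) by simp
  then have "finite C" using vs.independent_span_bound[OF B(1) C(2)] by blast
  moreover have "vs.span C = U" by (rule vs.span_subspace[OF C(1,3) assms(1)])
  ultimately show ?thesis unfolding finite_dimensional_def by blast
qed

lemma linear_between_image_subspace:
  assumes "linear_between (scale h) V W \<phi>" "vs.subspace V" "vs.subspace U" "U \<subseteq> V"
  shows "vs.subspace (\<phi> ` U)"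
proof (rule vs.subspaceI)
  note lb = assms(1)[unfolded linear_between_def]
  show "0 \<in> \<phi> ` U"
    using linear_between_zero[OF assms(1,2)] vs.subspace_0[OF assms(3)] by (metis imageI)
  fix x y c assume "x \<in> \<phi> ` U"
  then obtain u where u: "u \<in> U" "x = \<phi> u" by blast
  have "scale h c u \<in> U" "\<phi> (scale h c u) = scale h c x"
    using u lb assms(4) vs.subspace_scale[OF assms(3) u(1)] by auto
  then show "scale h c x \<in> \<phi> ` U" by (metis imageI)
  assume "y \<in> \<phi> ` U"
  then obtain v where v: "v \<in> U" "y = \<phi> v" by blast
  have "u \<in> V" "v \<in> V" using u(1) v(1) assms(4) by blast+
  then have "u + v \<in> U" "\<phi> (u + v) = x + y"
    using u v lb vs.subspace_add[OF assms(3) u(1) v(1)] by auto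
  then show "x + y \<in> \<phi> ` U" by (metis imageI)
qed

lemma finite_dimensional_image:
  assumes "linear_between (scale h) V W \<phi>" "finite_dimensional (scale h) V"
  shows "finite_dimensional (scale h) (\<phi> ` V)"
proof -
  obtain B where B: "finite B" "vs.span B = V" using assms(2) unfolding finite_dimensional_def by blast
  have V: "vs.subspace V" unfolding B(2)[symmetric] by (rule vs.subspace_span)
  have sub: "vs.subspace (\<phi> ` V)" by (rule linear_between_image_subspace[OF assms(1) V V order_refl])
  have BV: "B \<subseteq> V" using vs.span_superset[of B] B(2) by simp
  have "V \<subseteq> {v \<in> V. \<phi> v \<in> vs.span (\<phi> ` B)}"
    unfolding B(2)[symmetric]
  proof (rule vs.span_minimal)
    show "B \<subseteq> {v \<in> vs.span B. \<phi> v \<in> vs.span (\<phi> ` B)}"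
      by (auto intro: vs.span_base)
    show "vs.subspace {v \<in> vs.span B. \<phi> v \<in> vs.span (\<phi> ` B)}"
    proof (rule vs.subspaceI)
      note lb = assms(1)[unfolded linear_between_def, folded B(2)]
      show "0 \<in> {v \<in> vs.span B. \<phi> v \<in> vs.span (\<phi> ` B)}"
        using linear_between_zero[OF assms(1) V] by (simp add: vs.span_zero)
      show "x + y \<in> {v \<in> vs.span B. \<phi> v \<in> vs.span (\<phi> ` B)}"
        if "x \<in> {v \<in> vs.span B. \<phi> v \<in> vs.span (\<phi> ` B)}" "y \<in> {v \<in> vs.span B. \<phi> v \<in> vs.span (\<phi> ` B)}" for x y
        using that lb by (simp add: vs.span_add)
      show "scale h c x \<in> {v \<in> vs.span B. \<phi> v \<in> vs.span (\<phi> ` B)}"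
        if "x \<in> {v \<in> vs.span B. \<phi> v \<in> vs.span (\<phi> ` B)}" for x c
        using that lb by (simp add: vs.span_scale)
    qed
  qed
  then have "\<phi> ` V \<subseteq> vs.span (\<phi> ` B)" by blast
  then have "vs.span (\<phi> ` B) = \<phi> ` V"
    by (rule vs.span_subspace[OF image_mono[OF BV] _ sub])
  then show ?thesis using B(1) unfolding finite_dimensional_def by blast
qed

text \<open>Generators of the kernel together with preimages of generators of the image span
  \<open>V\<close>.\<close>

lemma finite_dimensional_extension:
  assumes lb: "linear_between (scale h) V W \<phi>" and V: "vs.subspace V"
    and W: "finite_dimensional (scale h) W"
    and ker: "finite_dimensional (scale h) {v \<in> V. \<phi> v = 0}"
  shows "finite_dimensional (scale h) V"
proof -
  have im: "vs.subspace (\<phi> ` V)" by (rule linear_between_image_subspace[OF lb V V order_refl])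
  have "\<phi> ` V \<subseteq> W" using lb unfolding linear_between_def by blast
  then obtain C where C: "finite C" "vs.span C = \<phi> ` V"
    using finite_dimensional_subspace[OF im _ W] unfolding finite_dimensional_def by blast
  have "C \<subseteq> \<phi> ` V" using vs.span_superset[of C] C(2) by simp
  then obtain D where D: "D \<subseteq> V" "finite D" "C = \<phi> ` D"
    using finite_subset_image[OF C(1)] by blast
  obtain B where B: "finite B" "vs.span B = {v \<in> V. \<phi> v = 0}"
    using ker unfolding finite_dimensional_def by blast
  have BV: "B \<subseteq> V" using vs.span_superset[of B] B(2) by blast
  have DV: "vs.span D \<subseteq> V" by (rule vs.span_minimal[OF D(1) V])
  have "vs.span (B \<union> D) = V"
  proof (rule vs.span_subspace)
    show "B \<union> D \<subseteq> V" using BV D(1) by blast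
    show "V \<subseteq> vs.span (B \<union> D)"
    proof
      fix v assume v: "v \<in> V"
      have "vs.span C \<subseteq> \<phi> ` vs.span D"
        by (rule vs.span_minimal)
          (use D(3) vs.span_superset linear_between_image_subspace[OF lb V vs.subspace_span DV] in auto)
      moreover have "\<phi> v \<in> vs.span C" using v C(2) by simp
      ultimately obtain w where w: "w \<in> vs.span D" "\<phi> v = \<phi> w" by blast
      have "v - w \<in> vs.span B"
        unfolding B(2) using vs.subspace_diff[OF V v] linear_between_diff[OF lb V v] w DV by auto
      then have "v - w \<in> vs.span (B \<union> D)" using vs.span_mono[of B "B \<union> D"] by blast
      moreover have "w \<in> vs.span (B \<union> D)" using vs.span_mono[of D "B \<union> D"] w(1) by blast
      ultimately have "(v - w) + w \<in> vs.span (B \<union> D)" by (rule vs.span_add)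
      then show "v \<in> vs.span (B \<union> D)" by simp
    qed
  qed (rule V)
  then show ?thesis using B(1) D(2) unfolding finite_dimensional_def by (metis finite_UnI)
qed

text \<open>By the long exact sequence, the kernel of the map that forgets \<open>Q\<close> is an
  image of the cohomology of \<open>Q\<close> in degree \<open>n - 1\<close>.\<close>

lemma finite_dimensional_relative:
  assumes "Q \<subseteq> P" "P \<subseteq> topspace X"
    and "finite_dimensional (scale h) (H n X P {})" "finite_dimensional (scale h) (H (n - 1) X Q {})"
  shows "finite_dimensional (scale h) (H n X P Q)"
proof (rule finite_dimensional_extension[OF res_linear H_subspace[OF assms(1,2)] assms(3)])
  show sp: "sub_pair X P Q P {}" using assms(1,2) by (simp add: sub_pair_def)
  have top: "Q \<subseteq> topspace (subtopology X P)" using assms(1,2) by (simp add: order_trans)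
  have "connect h (n - 1) (subtopology X P) Q ` H (n - 1) X Q {} = {v \<in> H n X P Q. res n X P Q P {} v = 0}"
    using exact_relative[OF top, of "n - 1"]
    unfolding restriction_def subtopology_nested[OF assms(1)] by simp
  then show "finite_dimensional (scale h) {v \<in> H n X P Q. res n X P Q P {} v = 0}"
    using finite_dimensional_image[OF connect_linear[OF top, of "n - 1", unfolded subtopology_nested[OF assms(1)]] assms(4)]
    by simp
qed

text \<open>By additivity the restrictions to the two parts are jointly injective. So the kernel of
  the first embeds by the second, and \<open>finite_dimensional_extension\<close> applies
  twice.\<close>

lemma finite_dimensional_disjoint_union:
  assumes op: "openin X P" "openin X Q" and disj: "P \<inter> Q = {}"
    and fin: "finite_dimensional (scale h) (H n X P {})" "finite_dimensional (scale h) (H n X Q {})"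
  shows "finite_dimensional (scale h) (H n X (P \<union> Q) {})"
proof -
  have top: "P \<union> Q \<subseteq> topspace X" using op openin_subset by blast
  have sp: "sub_pair X (P \<union> Q) {} P {}" "sub_pair X (P \<union> Q) {} Q {}"
    using top unfolding sub_pair_def by auto
  let ?Z = "subtopology X (P \<union> Q)"
  let ?W = "\<lambda>b. if b then P else Q"
  have zero: "v = 0" if v: "v \<in> H n X (P \<union> Q) {}" "res n X (P \<union> Q) {} P {} v = 0" "res n X (P \<union> Q) {} Q {} v = 0" for v
  proof (rule additivity_inj[of "{}" ?Z UNIV ?W v n])
    show "openin ?Z (?W b)" for b
      using op top by (auto simp: openin_open_subtopology openin_Un)
    show "?W b \<inter> ?W b' = {}" if "b \<noteq> b'" for b b' using that disj by auto
    show "(\<Union>b\<in>UNIV. ?W b) = topspace ?Z" using top by (auto simp: UNIV_bool)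
    show "induced h n (subtopology ?Z (?W b)) ({} \<inter> ?W b) ?Z {} id v = 0" for b
      using v(2,3) by (simp add: restriction_def subtopology_nested)
  qed (use v in auto)
  have HS: "vs.subspace (H n X (P \<union> Q) {})" by (rule H_subspace[OF _ top]) simp
  let ?K = "{v \<in> H n X (P \<union> Q) {}. res n X (P \<union> Q) {} P {} v = 0}"
  have K: "vs.subspace ?K"
  proof (rule vs.subspaceI)
    show "0 \<in> ?K" using vs.subspace_0[OF HS] res_zero[OF sp(1)] by simp
    show "x + y \<in> ?K" if "x \<in> ?K" "y \<in> ?K" for x y
      using that vs.subspace_add[OF HS] res_add[OF sp(1)] by simp
    show "scale h c x \<in> ?K" if "x \<in> ?K" for c x
      using that vs.subspace_scale[OF HS] res_scale[OF sp(1)] by simp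
  qed
  have lbK: "linear_between (scale h) ?K (H n X Q {}) (res n X (P \<union> Q) {} Q {})"
    using res_linear[OF sp(2), of n] unfolding linear_between_def by auto
  have "{v \<in> ?K. res n X (P \<union> Q) {} Q {} v = 0} = {0}"
    using zero vs.subspace_0[OF K] res_zero[OF sp(2)] by auto
  moreover have "finite_dimensional (scale h) {0}"
    unfolding finite_dimensional_def by (rule exI[of _ "{}"]) simp
  ultimately have "finite_dimensional (scale h) ?K"
    by (intro finite_dimensional_extension[OF lbK K fin(2)]) simp
  then show ?thesis by (rule finite_dimensional_extension[OF res_linear[OF sp(1)] HS fin(1)])
qed

end

section \<open>Preimages of open sets of reals\<close>

lemma open_set_bump:
  fixes S :: "real set"
  assumes "open S"
  shows "\<exists>d. continuous_on UNIV d \<and> (\<forall>t. 0 \<le> d t \<and> d t \<le> (1::real) \<and> (0 < d t \<longleftrightarrow> t \<in> S))"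
\<comment> \<open>\<open>infdist\<close> to the empty set is 0, so the full line is treated
  apart.\<close>
proof (cases "S = UNIV")
  case True
  then show ?thesis by (intro exI[of _ "\<lambda>_. 1"]) simp
next
  case False
  then have ne: "- S \<noteq> {}" by auto
  have pos: "0 < infdist t (- S) \<longleftrightarrow> t \<in> S" for t
    using in_closed_iff_infdist_zero[OF closed_Compl[OF assms] ne, of t] infdist_nonneg[of t "- S"]
    by (auto simp: less_le)
  have "continuous_on UNIV (\<lambda>t. min 1 (infdist t (- S)))"
    by (intro continuous_intros)
  then show ?thesis
    using pos infdist_nonneg[of _ "- S"] by (intro exI[of _ "\<lambda>t. min 1 (infdist t (- S))"]) simp
qed

text \<open>The weights \<open>(1/2) ^ k\<close> make the sum \<open>g\<close> small where the first
  stage containing \<open>t\<close> is late, so that minus its logarithm is, up to a constant, at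
  least the index of this stage. This continuous function becomes the height of the section of the
  telescope.\<close>

lemma telescoping_function:
  fixes S :: "nat \<Rightarrow> real set"
  assumes op: "\<And>k. open (S k)" and mono: "\<And>k. S k \<subseteq> S (Suc k)"
  shows "\<exists>L. continuous_on (\<Union>k. S k) L \<and> (\<forall>t\<in>\<Union>k. S k. 0 \<le> (L t :: real) \<and> t \<in> S (nat \<lfloor>L t\<rfloor>))"
proof -
  have "\<forall>k. \<exists>d. continuous_on UNIV d \<and> (\<forall>t. 0 \<le> d t \<and> d t \<le> (1::real) \<and> (0 < d t \<longleftrightarrow> t \<in> S k))"
    using open_set_bump[OF op] by (rule allI)
  from choice[OF this] obtain d where d: "\<forall>k. continuous_on UNIV (d k) \<and> (\<forall>t. 0 \<le> d k t \<and> d k t \<le> (1::real) \<and> (0 < d k t \<longleftrightarrow> t \<in> S k))" ..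
  let ?w = "\<lambda>k t. (1/2) ^ k * d k t :: real"
  define g where "g t = (\<Sum>k. ?w k t)" for t
  have bound: "norm (?w k t) \<le> (1/2) ^ k" for k t
    using d by (simp add: abs_mult mult_left_le)
  have geo: "summable (\<lambda>k. (1/2) ^ k :: real)" by (rule summable_geometric) simp
  have sm: "summable (\<lambda>k. ?w k t)" for t
    by (rule summable_comparison_test[OF _ geo]) (use bound in blast)
  have "uniform_limit UNIV (\<lambda>n t. \<Sum>k<n. ?w k t) g sequentially"
    unfolding g_def by (rule Weierstrass_m_test[OF _ geo]) (use bound in blast)
  then have cont: "continuous_on UNIV g"
    by (rule uniform_limit_theorem[rotated])
      (use d in \<open>auto intro!: always_eventually continuous_intros\<close>)
  have pos: "0 < g t" if t: "t \<in> S k" for t k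
    unfolding g_def by (rule suminf_pos2[OF sm, of _ k]) (use d t in auto)
  have le: "g t \<le> 2 * (1/2) ^ K" if t: "\<And>k. k < K \<Longrightarrow> t \<notin> S k" for t K
  proof -
    have "g t \<le> (\<Sum>k. if k < K then 0 else (1/2) ^ k)"
      unfolding g_def
    proof (rule suminf_le[OF _ sm])
      show "?w k t \<le> (if k < K then 0 else (1/2) ^ k)" for k
      proof (cases "k < K")
        case True
        then have "d k t = 0" using t d by (metis less_le)
        then show ?thesis by simp
      next
        case False
        then show ?thesis using d by simp
      qed
      show "summable (\<lambda>k. if k < K then 0 else (1/2::real) ^ k)"
        by (rule summable_comparison_test[OF _ geo]) auto
    qed
    also have "(\<lambda>k. if k < K then 0 else (1/2::real) ^ k) sums (2 * (1/2) ^ K)"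
    proof -
      have "(\<lambda>k. (1/2) ^ K * (1/2::real) ^ k) sums ((1/2) ^ K * 2)"
        using sums_mult[OF geometric_sums[of "1/2::real"], of "(1/2) ^ K"] by simp
      then have "(\<lambda>k. if k + K < K then 0 else (1/2::real) ^ (k + K)) sums (2 * (1/2) ^ K)"
        by (simp add: power_add mult.commute)
      then show ?thesis by (subst (asm) sums_iff_shift) simp
    qed
    then have "(\<Sum>k. if k < K then 0 else (1/2::real) ^ k) = 2 * (1/2) ^ K"
      by (rule sums_unique[symmetric])
    finally show ?thesis .
  qed
  \<comment> \<open>The summand 1 absorbs the factor 2 in the bound \<open>le\<close>, so that
    \<open>L t\<close> is at least the index \<open>K\<close> of the first stage containing
    \<open>t\<close>.\<close>
  define L where "L t = 1 - log 2 (g t)" for t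
  show ?thesis
  proof (intro exI[of _ L] conjI ballI)
    have "continuous_on (\<Union>k. S k) g" using cont continuous_on_subset by blast
    then show "continuous_on (\<Union>k. S k) L"
      unfolding L_def using pos by (intro continuous_intros) force+
    fix t assume "t \<in> (\<Union>k. S k)"
    then obtain k where k: "t \<in> S k" by blast
    define K where "K = (LEAST k. t \<in> S k)"
    have K: "t \<in> S K" "\<And>j. j < K \<Longrightarrow> t \<notin> S j"
      unfolding K_def using LeastI[of "\<lambda>k. t \<in> S k", OF k] not_less_Least by blast+
    have "log 2 (g t) \<le> log 2 (2 * (1/2) ^ K)"
      using pos[OF k] le[OF K(2)] by simp
    also have "\<dots> = 1 - real K"
      by (simp add: log_mult log_nat_power log_divide)
    finally have LK: "real K \<le> L t" unfolding L_def by simp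
    then have "K \<le> nat \<lfloor>L t\<rfloor>" by (simp add: le_nat_floor)
    then have "S K \<subseteq> S (nat \<lfloor>L t\<rfloor>)" using lift_Suc_mono_le[of S, OF mono] by blast
    then show "0 \<le> L t" "t \<in> S (nat \<lfloor>L t\<rfloor>)" using K(1) LK by auto
  qed
qed

locale tame_function = cylinder_theory h code X
  for h :: "('k::field, 'v::ab_group_add, 'u) cohomology_data"
    and code :: "'u \<times> real \<Rightarrow> 'u" and X :: "'u topology" +
  fixes f :: "'u \<Rightarrow> real"
  assumes continuous_f: "continuous_map X euclideanreal f" and tame_f: "tame h X f"
begin

definition pre :: "real set \<Rightarrow> 'u set" where
  "pre S = {x \<in> topspace X. f x \<in> S}"

lemma pre_top: "pre S \<subseteq> topspace X"
  and pre_mono: "S \<subseteq> S' \<Longrightarrow> pre S \<subseteq> pre S'"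
  and pre_Un: "pre (S \<union> S') = pre S \<union> pre S'"
  and pre_Int: "pre (S \<inter> S') = pre S \<inter> pre S'"
  and pre_UN: "pre (\<Union>k. R k) = (\<Union>k. pre (R k))"
  unfolding pre_def by auto

lemma openin_pre: "open S \<Longrightarrow> openin X (pre S)"
  using openin_continuous_map_preimage[OF continuous_f] unfolding pre_def by simp

lemma continuous_map_pre:
  assumes "continuous_on S L"
  shows "continuous_map (subtopology X (pre S)) euclideanreal (L \<circ> f)"
proof (rule continuous_map_compose)
  show "continuous_map (subtopology X (pre S)) (top_of_set S) f"
    using continuous_map_from_subtopology[OF continuous_f]
    by (auto simp: continuous_map_in_subtopology pre_def)
  show "continuous_map (top_of_set S) euclideanreal L" using assms by simp
qed

text \<open>The usual partition of unity for two open sets of reals, composed with \<open>f\<close>;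
  the denominator is positive on their union.\<close>

lemma separated_pre:
  assumes "open S" "open S'"
  shows "separated (pre S) (pre S')"
proof -
  from open_set_bump[OF assms(1)] obtain d where
    "continuous_on UNIV d \<and> (\<forall>t. 0 \<le> d t \<and> d t \<le> (1::real) \<and> (0 < d t \<longleftrightarrow> t \<in> S))" ..
  then have d: "continuous_on UNIV d" "\<And>t. 0 \<le> d t" "\<And>t. 0 < d t \<longleftrightarrow> t \<in> S"
    by simp_all
  from open_set_bump[OF assms(2)] obtain e where
    "continuous_on UNIV e \<and> (\<forall>t. 0 \<le> e t \<and> e t \<le> (1::real) \<and> (0 < e t \<longleftrightarrow> t \<in> S'))" ..
  then have e: "continuous_on UNIV e" "\<And>t. 0 \<le> e t" "\<And>t. 0 < e t \<longleftrightarrow> t \<in> S'"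
    by simp_all
  let ?L = "\<lambda>t. e t / (d t + e t)"
  have pos: "0 < d t + e t" if "t \<in> S \<union> S'" for t
    using that d(2)[of t] d(3)[of t] e(2)[of t] e(3)[of t] by (auto simp: add_pos_nonneg add_nonneg_pos)
  have "continuous_on (S \<union> S') ?L"
    using pos by (intro continuous_intros continuous_on_subset[OF d(1)] continuous_on_subset[OF e(1)]) force+
  from continuous_map_pre[OF this]
  have cont: "continuous_map (subtopology X (pre S \<union> pre S')) euclideanreal (?L \<circ> f)"
    unfolding pre_Un .
  show ?thesis
    unfolding separated_def
  proof (intro exI[of _ "?L \<circ> f"] conjI ballI cont)
    fix a assume a: "a \<in> pre S \<union> pre S'"
    then have p: "0 < d (f a) + e (f a)" by (intro pos) (auto simp: pre_def)
    show "0 \<le> (?L \<circ> f) a" "(?L \<circ> f) a \<le> 1"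
      using p d(2)[of "f a"] e(2)[of "f a"] by (auto simp: divide_le_eq)
    show "a \<notin> pre S' \<longrightarrow> (?L \<circ> f) a = 0"
      using a e(2)[of "f a"] e(3)[of "f a"] by (auto simp: pre_def less_le)
    show "a \<notin> pre S \<longrightarrow> (?L \<circ> f) a = 1"
      using a p d(2)[of "f a"] d(3)[of "f a"] by (auto simp: pre_def less_le)
  qed
qed

text \<open>An increasing sequence of open sets in an arbitrary space need not admit such a height
  function; a sequence pulled back from the line inherits the one constructed there.\<close>

lemma exhaustion_pre:
  assumes "\<And>k. open (S k)" "\<And>k. S k \<subseteq> S (Suc k)"
  shows "exhaustion (\<lambda>k. pre (S k))"
proof -
  from telescoping_function[of S, OF assms] obtain L :: "real \<Rightarrow> real" where
    L: "continuous_on (\<Union>k. S k) L \<and> (\<forall>t\<in>\<Union>k. S k. 0 \<le> L t \<and> t \<in> S (nat \<lfloor>L t\<rfloor>))" ..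
  show ?thesis
    unfolding exhaustion_def
  proof (intro conjI allI exI[of _ "L \<circ> f"] ballI)
    show "pre (S k) \<subseteq> pre (S (Suc k))" "pre (S k) \<subseteq> topspace X" for k
      by (rule pre_mono[OF assms(2)]) (rule pre_top)
    show "continuous_map (subtopology X (\<Union>k. pre (S k))) euclideanreal (L \<circ> f)"
      using continuous_map_pre[OF conjunct1[OF L]] unfolding pre_UN .
    fix a assume "a \<in> (\<Union>k. pre (S k))"
    then have a: "a \<in> topspace X" "f a \<in> (\<Union>k. S k)" unfolding pre_def by auto
    from bspec[OF conjunct2[OF L] a(2)] a(1)
    show "0 \<le> (L \<circ> f) a" "a \<in> pre (S (nat \<lfloor>(L \<circ> f) a\<rfloor>))"
      unfolding pre_def by simp_all
  qed
qed

lemma finite_dimensional_pre_interval: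
  assumes "open S" "is_interval S"
  shows "finite_dimensional (scale h) (H n X (pre S) {})"
  using tame_f assms unfolding tame_def pre_def by blast

end

section \<open>The strip\<close>

text \<open>\<open>T\<close> is a glide reflection whose square is the translation by
  \<open>(- 2 * pi, 2 * pi)\<close>, hence the distinction by parity.\<close>

lemma T_power_eq:
  "T_power n (x, y) = (if even n then (x - real_of_int n * pi, y + real_of_int n * pi)
     else (- y - real_of_int n * pi, real_of_int n * pi - x))"
proof -
  have T: "T (x, y) = (- pi - y, pi - x)" for x y by (simp add: T_def)
  have invT: "inv T (x, y) = (pi - y, - pi - x)" for x y
  proof -
    have "inj T" by (auto simp: inj_def T_def)
    then have "inv T (T (pi - y, - pi - x)) = (pi - y, - pi - x)" by simp
    then show ?thesis by (simp add: T)
  qed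
  have pos: "(T ^^ m) (x, y) = (if even m then (x - real m * pi, y + real m * pi)
     else (- y - real m * pi, real m * pi - x))" for m
    by (induction m) (auto simp: T algebra_simps)
  have neg: "(inv T ^^ m) (x, y) = (if even m then (x + real m * pi, y - real m * pi)
     else (- y + real m * pi, - real m * pi - x))" for m
    by (induction m) (auto simp: invT algebra_simps)
  show ?thesis
  proof (cases "0 \<le> n")
    case True
    then show ?thesis unfolding T_power_def by (simp add: pos even_nat_iff)
  next
    case False
    then show ?thesis unfolding T_power_def by (simp add: neg even_nat_iff)
  qed
qed

lemma T_eq_T_power: "T u = T_power 1 u"
  by (cases u) (simp add: T_power_eq T_def)

lemma T_power_add: "T_power m (T_power n u) = T_power (m + n) u"
  by (cases u) (auto simp: T_power_eq algebra_simps)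

lemma T_power_0: "T_power 0 u = u"
  by (cases u) (simp add: T_power_eq)

lemma T_power_le: "T_power n u \<preceq> T_power n v \<longleftrightarrow> u \<preceq> v"
  by (cases u; cases v) (auto simp: T_power_eq strip_le_def)

lemma T_power_strip: "T_power n u \<in> strip \<longleftrightarrow> u \<in> strip"
  by (cases u) (auto simp: T_power_eq strip_def)

lemma T_power_gap: "fst (T_power n u) - snd (T_power n u) = fst u - snd u - 2 * pi * real_of_int n"
  by (cases u) (auto simp: T_power_eq algebra_simps)

lemma T_power_tendsto:
  assumes "u \<longlonglongrightarrow> l"
  shows "(\<lambda>k. T_power n (u k)) \<longlonglongrightarrow> T_power n l"
proof -
  have eq: "T_power n v = (if even n then (fst v - real_of_int n * pi, snd v + real_of_int n * pi)
     else (- snd v - real_of_int n * pi, real_of_int n * pi - fst v))" for v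
    by (cases v) (simp add: T_power_eq)
  show ?thesis
    unfolding eq using assms by (cases "even n") (auto intro!: tendsto_intros)
qed

lemma fundamental_domain_iff:
  "u \<in> fundamental_domain \<longleftrightarrow> u \<in> strip \<and> 0 \<le> fst u - snd u \<and> fst u - snd u < 2 * pi"
  by (cases u) (auto simp: fundamental_domain_def)

lemma in_tile_iff:
  "u \<in> T_power (- n) ` fundamental_domain \<longleftrightarrow> T_power n u \<in> fundamental_domain"
proof
  assume "u \<in> T_power (- n) ` fundamental_domain"
  then show "T_power n u \<in> fundamental_domain"
    by (auto simp: T_power_add T_power_0)
next
  assume "T_power n u \<in> fundamental_domain"
  moreover have "u = T_power (- n) (T_power n u)" by (simp add: T_power_add T_power_0)
  ultimately show "u \<in> T_power (- n) ` fundamental_domain" by blast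
qed

text \<open>Each application of \<open>T\<close> lowers \<open>fst u - snd u\<close> by
  \<open>2 * pi\<close>, so exactly one power moves the point into the fundamental domain, and its
  exponent is a floor.\<close>

lemma tile_eq_iff:
  assumes "u \<in> strip"
  shows "tile u = n \<longleftrightarrow> T_power n u \<in> fundamental_domain"
proof -
  have iff: "T_power m u \<in> fundamental_domain \<longleftrightarrow> m = \<lfloor>(fst u - snd u) / (2 * pi)\<rfloor>" for m
  proof -
    have "T_power m u \<in> fundamental_domain \<longleftrightarrow>
        real_of_int m * (2 * pi) \<le> fst u - snd u \<and> fst u - snd u < (real_of_int m + 1) * (2 * pi)"
      using assms unfolding fundamental_domain_iff T_power_strip T_power_gap
      by (auto simp: algebra_simps)
    also have "\<dots> \<longleftrightarrow> real_of_int m \<le> (fst u - snd u) / (2 * pi) \<and> (fst u - snd u) / (2 * pi) < real_of_int m + 1"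
      by (simp add: pos_le_divide_eq pos_divide_less_eq)
    also have "\<dots> \<longleftrightarrow> m = \<lfloor>(fst u - snd u) / (2 * pi)\<rfloor>"
      by (subst eq_commute[of m]) (simp only: floor_eq_iff)
    finally show ?thesis .
  qed
  have "tile u = \<lfloor>(fst u - snd u) / (2 * pi)\<rfloor>"
    unfolding tile_def in_tile_iff iff by simp
  then show ?thesis unfolding iff by auto
qed

lemma T_power_tile: "u \<in> strip \<Longrightarrow> T_power (tile u) u \<in> fundamental_domain"
  using tile_eq_iff by blast

lemma strip_le_refl: "u \<preceq> u"
  and strip_le_trans: "u \<preceq> v \<Longrightarrow> v \<preceq> w \<Longrightarrow> u \<preceq> w"
  by (auto simp: strip_le_def)

lemma tile_antimono:
  assumes "u \<in> strip" "v \<in> strip" "u \<preceq> v"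
  shows "tile v \<le> tile u"
proof (rule ccontr)
  assume "\<not> tile v \<le> tile u"
  then have "real_of_int (tile u) + 1 \<le> real_of_int (tile v)" by linarith
  then have "2 * pi * (real_of_int (tile u) + 1) \<le> 2 * pi * real_of_int (tile v)"
    by (intro mult_left_mono) auto
  then show False
    using T_power_tile[OF assms(1)] T_power_tile[OF assms(2)] assms(3)
    unfolding fundamental_domain_iff T_power_gap strip_le_def by (simp add: algebra_simps)
qed

lemma rho1_eq: "rho1 u = {t. - pi - snd u < arctan t \<and> arctan t < pi - fst u}"
  and rho0_eq: "rho0 u = {t. arctan t < snd u \<or> arctan t > fst u}"
  by (cases u; simp add: rho1_def rho0_def)+

lemma open_arctan_less: "open {t. arctan t < c}" "open {t. c < arctan t}"
  by (intro open_Collect_less continuous_intros)+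

lemma is_interval_arctan: "is_interval {t. arctan t < c}" "is_interval {t. c < arctan t}"
  "is_interval {t. b < arctan t \<and> arctan t < c}"
  unfolding is_interval_1 using arctan_monotone' by (auto intro: le_less_trans less_le_trans)

lemma open_rho: "open (rho1 u)" "open (rho0 u)"
proof -
  have "rho1 u = {t. - pi - snd u < arctan t} \<inter> {t. arctan t < pi - fst u}"
    "rho0 u = {t. arctan t < snd u} \<union> {t. fst u < arctan t}"
    by (auto simp: rho1_eq rho0_eq)
  then show "open (rho1 u)" "open (rho0 u)"
    using open_arctan_less by (auto intro: open_Int open_Un)
qed

text \<open>For each of the two rays, one bound of \<open>rho1\<close> comes from the strip and the
  other from the range of \<open>arctan\<close>.\<close>

lemma rho0_subset_rho1:
  assumes "u \<in> strip"
  shows "rho0 u \<subseteq> rho1 u"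
proof
  fix t assume "t \<in> rho0 u"
  moreover have "- (pi / 2) < arctan t" "arctan t < pi / 2" by (rule arctan_lbound arctan_ubound)+
  moreover have "- pi \<le> fst u + snd u" "fst u + snd u \<le> pi"
    using assms by (auto simp: strip_def)
  ultimately show "t \<in> rho1 u" by (auto simp: rho1_eq rho0_eq)
qed

lemma rho_mono:
  assumes "u \<preceq> v"
  shows "rho1 u \<subseteq> rho1 v" "rho0 u \<subseteq> rho0 v"
  using assms by (auto simp: rho1_eq rho0_eq strip_le_def)

text \<open>In a rectangle, \<open>p\<close> is the lower right corner and \<open>w\<close> the upper left one.\<close>

definition rectangle :: "real \<times> real \<Rightarrow> real \<times> real \<Rightarrow> bool" where
  "rectangle p w \<longleftrightarrow> p \<in> fundamental_domain \<and> w \<in> fundamental_domain \<and> p \<preceq> w \<and> w \<preceq> T p"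

text \<open>The condition \<open>w \<preceq> T p\<close> says that \<open>fst w + snd p\<close> is
  at least \<open>- pi\<close> and that \<open>fst p + snd w\<close> is at most \<open>pi\<close>:
  it keeps the two remaining corners in the strip.\<close>

lemma rectangle_corners:
  assumes "rectangle p w"
  shows "(fst w, snd p) \<in> fundamental_domain" "(fst p, snd w) \<in> fundamental_domain"
    "p \<preceq> (fst w, snd p)" "p \<preceq> (fst p, snd w)" "(fst w, snd p) \<preceq> w" "(fst p, snd w) \<preceq> w"
  using assms unfolding rectangle_def
  by (cases p; cases w; auto simp: fundamental_domain_def strip_def strip_le_def T_def)+

text \<open>Both bounds of the fundamental domain enter. The two open intervals leave no gap in
  their union because \<open>fst p - snd p < 2 * pi\<close>, and the intersection of the two pairs
  of rays has no additional piece in the middle because \<open>snd w \<le> fst w\<close>.\<close>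

lemma rectangle_rho:
  assumes "rectangle p w"
  shows "rho1 (fst w, snd p) \<union> rho1 (fst p, snd w) = rho1 w" "rho0 (fst w, snd p) \<union> rho0 (fst p, snd w) = rho0 w"
    "rho1 (fst w, snd p) \<inter> rho1 (fst p, snd w) = rho1 p" "rho0 (fst w, snd p) \<inter> rho0 (fst p, snd w) = rho0 p"
proof -
  have *: "fst w \<le> fst p" "snd p \<le> snd w" "snd w \<le> fst w" "fst p - snd p < 2 * pi"
    using assms unfolding rectangle_def fundamental_domain_iff strip_le_def by auto
  show "rho1 (fst w, snd p) \<union> rho1 (fst p, snd w) = rho1 w" "rho0 (fst w, snd p) \<union> rho0 (fst p, snd w) = rho0 w"
    "rho1 (fst w, snd p) \<inter> rho1 (fst p, snd w) = rho1 p" "rho0 (fst w, snd p) \<inter> rho0 (fst p, snd w) = rho0 p"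
    using * by (auto simp: rho1_eq rho0_eq)
qed

text \<open>Membership of \<open>t\<close> is expressed by strict inequalities for the coordinates,
  so what holds at the limit already holds for some \<open>w k\<close>.\<close>

lemma rho_increasing_union:
  assumes "w \<longlonglongrightarrow> l" "\<And>k. w k \<preceq> l"
  shows "(\<Union>k. rho1 (w k)) = rho1 l" "(\<Union>k. rho0 (w k)) = rho0 l"
proof -
  have lim: "(\<lambda>k. fst (w k)) \<longlonglongrightarrow> fst l" "(\<lambda>k. snd (w k)) \<longlonglongrightarrow> snd l"
    using assms(1) by (auto intro: tendsto_fst tendsto_snd)
  show "(\<Union>k. rho1 (w k)) = rho1 l"
  proof
    show "(\<Union>k. rho1 (w k)) \<subseteq> rho1 l" using rho_mono(1)[OF assms(2)] by blast
    show "rho1 l \<subseteq> (\<Union>k. rho1 (w k))"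
    proof
      fix t assume "t \<in> rho1 l"
      then have "fst l < pi - arctan t" "- pi - arctan t < snd l" by (auto simp: rho1_eq)
      then have "\<forall>\<^sub>F k in sequentially. fst (w k) < pi - arctan t \<and> - pi - arctan t < snd (w k)"
        using order_tendstoD(2)[OF lim(1)] order_tendstoD(1)[OF lim(2)] by (intro eventually_conj) auto
      then obtain k where "fst (w k) < pi - arctan t \<and> - pi - arctan t < snd (w k)"
        using eventually_happens' sequentially_bot by blast
      then have "t \<in> rho1 (w k)" by (simp add: rho1_eq)
      then show "t \<in> (\<Union>k. rho1 (w k))" by blast
    qed
  qed
  show "(\<Union>k. rho0 (w k)) = rho0 l"
  proof
    show "(\<Union>k. rho0 (w k)) \<subseteq> rho0 l" using rho_mono(2)[OF assms(2)] by blast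
    show "rho0 l \<subseteq> (\<Union>k. rho0 (w k))"
    proof
      fix t assume "t \<in> rho0 l"
      then consider "arctan t < snd l" | "fst l < arctan t" by (auto simp: rho0_eq)
      then have "\<exists>k. arctan t < snd (w k) \<or> fst (w k) < arctan t"
      proof cases
        case 1
        then have "\<forall>\<^sub>F k in sequentially. arctan t < snd (w k)" by (rule order_tendstoD(1)[OF lim(2)])
        then show ?thesis using eventually_happens' sequentially_bot by blast
      next
        case 2
        then have "\<forall>\<^sub>F k in sequentially. fst (w k) < arctan t" by (rule order_tendstoD(2)[OF lim(1)])
        then show ?thesis using eventually_happens' sequentially_bot by blast
      qed
      then obtain k where "t \<in> rho0 (w k)" by (auto simp: rho0_eq)
      then show "t \<in> (\<Union>k. rho0 (w k))" by blast
    qed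
  qed
qed

section \<open>The functor\<close>

context tame_function
begin

section \<open>Restrictions and differentials between points of the fundamental domain\<close>

abbreviation "PA u \<equiv> pre (rho1 u)"
abbreviation "PB u \<equiv> pre (rho0 u)"
abbreviation "HP n u \<equiv> H n X (PA u) (PB u)"
abbreviation "resP n u v \<equiv> res n X (PA u) (PB u) (PA v) (PB v)"
abbreviation "diffP n p w \<equiv> mv_diff n (PA (fst w, snd p)) (PB (fst w, snd p)) (PA (fst p, snd w)) (PB (fst p, snd w))"

lemma preimage_pair_eq: "preimage_pair X f u = (PA u, PB u)"
  by (simp add: preimage_pair_def pre_def)

lemma h_space_eq: "h_space h X f u = HP (tile u) (T_power (tile u) u)"
  by (simp add: h_space_def preimage_pair_eq Let_def)

lemma h_map_same:
  "tile v = tile u \<Longrightarrow> h_map h code X f u v = resP (tile u) (T_power (tile v) v) (T_power (tile u) u)"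
  by (simp add: h_map_def preimage_pair_eq Let_def)

lemma h_map_next:
  "tile v = tile u - 1 \<Longrightarrow> v \<preceq> T u \<Longrightarrow>
    h_map h code X f u v = diffP (tile v) (T_power (tile v) v) (T_power (tile u) u)"
  by (simp add: h_map_def preimage_pair_eq case_prod_unfold Let_def)

lemma h_map_zero:
  "tile v \<noteq> tile u \<Longrightarrow> \<not> (tile v = tile u - 1 \<and> v \<preceq> T u) \<Longrightarrow> h_map h code X f u v = (\<lambda>_. 0)"
  by (auto simp: h_map_def Let_def)

lemma PB_subset_PA: "u \<in> strip \<Longrightarrow> PB u \<subseteq> PA u"
  by (intro pre_mono rho0_subset_rho1)

lemma HP_subspace: "u \<in> strip \<Longrightarrow> vs.subspace (HP n u)"
  by (intro H_subspace PB_subset_PA pre_top)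

lemma sub_pair_P:
  assumes "u \<in> strip" "v \<in> strip" "v \<preceq> u"
  shows "sub_pair X (PA u) (PB u) (PA v) (PB v)"
  unfolding sub_pair_def
  using PB_subset_PA[OF assms(1)] PB_subset_PA[OF assms(2)] pre_mono[OF rho_mono(1)[OF assms(3)]]
    pre_mono[OF rho_mono(2)[OF assms(3)]] pre_top[of "rho1 u"] by simp

lemma resP_id: "u \<in> strip \<Longrightarrow> a \<in> HP n u \<Longrightarrow> resP n u u a = a"
  by (intro res_id PB_subset_PA pre_top)

lemma resP_comp:
  "u \<in> strip \<Longrightarrow> v \<in> strip \<Longrightarrow> w \<in> strip \<Longrightarrow> v \<preceq> u \<Longrightarrow> w \<preceq> v \<Longrightarrow> a \<in> HP n u \<Longrightarrow>
    resP n v w (resP n u v a) = resP n u w a"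
  by (intro res_comp sub_pair_P)

lemma domain_strip: "u \<in> fundamental_domain \<Longrightarrow> u \<in> strip"
  by (simp add: fundamental_domain_iff)

lemma rectangle_strip:
  assumes "rectangle p w"
  shows "p \<in> strip" "w \<in> strip" "(fst w, snd p) \<in> strip" "(fst p, snd w) \<in> strip"
  using assms rectangle_corners(1,2)[OF assms] domain_strip unfolding rectangle_def by blast+

lemma rectangle_mv_cover:
  assumes "rectangle p w"
  shows "mv_cover (PA (fst w, snd p)) (PB (fst w, snd p)) (PA (fst p, snd w)) (PB (fst p, snd w))"
  unfolding mv_cover_def
  by (intro conjI openin_pre separated_pre open_rho PB_subset_PA rectangle_strip[OF assms])

lemma rectangle_sets:
  assumes "rectangle p w"
  shows "PA (fst w, snd p) \<union> PA (fst p, snd w) = PA w" "PB (fst w, snd p) \<union> PB (fst p, snd w) = PB w"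
    "PA (fst w, snd p) \<inter> PA (fst p, snd w) = PA p" "PB (fst w, snd p) \<inter> PB (fst p, snd w) = PB p"
  unfolding pre_Un[symmetric] pre_Int[symmetric] rectangle_rho[OF assms] by (rule refl)+

lemma diffP_linear:
  assumes "rectangle p w"
  shows "linear_between (scale h) (HP n p) (HP (n + 1) w) (diffP n p w)"
  using mv_diff_linear[OF rectangle_mv_cover[OF assms], of n] unfolding rectangle_sets[OF assms] .

lemma diffP_in: "rectangle p w \<Longrightarrow> a \<in> HP n p \<Longrightarrow> diffP n p w a \<in> HP (n + 1) w"
  using diffP_linear[of p w n] unfolding linear_between_def by blast

lemma diffP_natural:
  assumes r: "rectangle p w" "rectangle p' w'" and le: "p' \<preceq> p" "w' \<preceq> w" and a: "a \<in> HP n p"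
  shows "diffP n p' w' (resP n p p' a) = resP (n + 1) w w' (diffP n p w a)"
proof -
  have c: "(fst w', snd p') \<preceq> (fst w, snd p)" "(fst p', snd w') \<preceq> (fst p, snd w)"
    using le by (auto simp: strip_le_def)
  show ?thesis
    using mv_diff_natural[OF rectangle_mv_cover[OF r(1)] rectangle_mv_cover[OF r(2)]
      pre_mono[OF rho_mono(1)[OF c(1)]] pre_mono[OF rho_mono(2)[OF c(1)]]
      pre_mono[OF rho_mono(1)[OF c(2)]] pre_mono[OF rho_mono(2)[OF c(2)]], of a n] a
    unfolding rectangle_sets[OF r(1)] rectangle_sets[OF r(2)] by blast
qed

text \<open>The two intermediate corners are the pairs of the Mayer-Vietoris cover, and the
  restriction to \<open>u\<close> factors through one of them.\<close>

lemma resP_diffP_zero: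
  assumes r: "rectangle p w" and u: "u \<in> strip" "u \<preceq> (fst w, snd p) \<or> u \<preceq> (fst p, snd w)" and a: "a \<in> HP n p"
  shows "resP (n + 1) w u (diffP n p w a) = 0"
proof -
  note s = rectangle_strip[OF r] and c = rectangle_corners[OF r]
  note z = res_mv_diff_zero[OF rectangle_mv_cover[OF r], of a n, unfolded rectangle_sets[OF r], OF a]
  have main: "resP (n + 1) w u (diffP n p w a) = 0"
    if v: "v \<in> strip" "v \<preceq> w" "u \<preceq> v" "resP (n + 1) w v (diffP n p w a) = 0" for v
    using resP_comp[OF s(2) v(1) u(1) v(2,3) diffP_in[OF r a]] v(4) res_zero[OF sub_pair_P[OF v(1) u(1) v(3)]]
    by simp
  from u(2) show ?thesis
  proof
    assume "u \<preceq> (fst w, snd p)"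
    then show ?thesis by (rule main[OF s(3) c(5)]) (rule z[where t = 0], simp)
  next
    assume "u \<preceq> (fst p, snd w)"
    then show ?thesis by (rule main[OF s(4) c(6)]) (rule z[where t = 1], simp)
  qed
qed

text \<open>Here the restriction from \<open>q\<close> factors through one of the two intermediate
  corners.\<close>

lemma diffP_resP_zero:
  assumes r: "rectangle p w" and q: "q \<in> strip" "(fst w, snd p) \<preceq> q \<or> (fst p, snd w) \<preceq> q" and a: "a \<in> HP n q"
  shows "diffP n p w (resP n q p a) = 0"
proof -
  note s = rectangle_strip[OF r] and c = rectangle_corners[OF r]
  note z = mv_diff_res_zero[OF rectangle_mv_cover[OF r], unfolded rectangle_sets[OF r]]
  have main: "diffP n p w (resP n q p a) = 0"
    if v: "v \<in> strip" "p \<preceq> v" "v \<preceq> q" "\<And>b. b \<in> HP n v \<Longrightarrow> diffP n p w (resP n v p b) = 0" for v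
    using v(4)[OF res_in[OF sub_pair_P[OF q(1) v(1,3)] a]] resP_comp[OF q(1) v(1) s(1) v(3,2) a] by simp
  from q(2) show ?thesis
  proof
    assume "(fst w, snd p) \<preceq> q"
    then show ?thesis by (rule main[OF s(3) c(3)]) (rule z, simp)
  next
    assume "(fst p, snd w) \<preceq> q"
    then show ?thesis by (rule main[OF s(4) c(4)]) (rule z, simp)
  qed
qed

text \<open>Let \<open>z\<close> be an intermediate corner of the rectangle from \<open>q\<close> to
  \<open>w\<close>. If \<open>p\<close> and \<open>z\<close> also span a rectangle, naturality
  factors the first differential through the restriction from \<open>z\<close> to \<open>q\<close>,
  which the second differential kills. If this failed for both corners, adding the two violated
  inequalities would give \<open>fst p - snd p > 2 * pi + fst w - snd w\<close>, impossible in the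
  fundamental domain.\<close>

lemma diffP_diffP_zero:
  assumes r: "rectangle p q" "rectangle q w" and a: "a \<in> HP n p"
  shows "diffP (n + 1) q w (diffP n p q a) = 0"
proof -
  have strips: "p \<in> fundamental_domain" "q \<in> fundamental_domain" "w \<in> fundamental_domain"
    "p \<preceq> q" "q \<preceq> w" "q \<preceq> T p" "w \<preceq> T q"
    using r unfolding rectangle_def by auto
  have p: "p \<in> strip" using strips domain_strip by blast
  have main: "diffP (n + 1) q w (diffP n p q a) = 0"
    if z: "rectangle p z" "q \<preceq> z" "(fst w, snd q) \<preceq> z \<or> (fst q, snd w) \<preceq> z" for z
  proof -
    have "diffP n p q a = resP (n + 1) z q (diffP n p z a)"
      using diffP_natural[OF z(1) r(1) strip_le_refl z(2) a] resP_id[OF p a] by simp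
    then show ?thesis
      using diffP_resP_zero[OF r(2) rectangle_strip(2)[OF z(1)] z(3) diffP_in[OF z(1) a]] by simp
  qed
  have "- pi \<le> fst w + snd p \<or> fst p + snd w \<le> pi"
    using strips(1,3) unfolding fundamental_domain_iff by linarith
  then show ?thesis
  proof
    assume "- pi \<le> fst w + snd p"
    then have "rectangle p (fst w, snd q)"
      using strips rectangle_corners(1)[OF r(2)] unfolding rectangle_def
      by (cases p) (auto simp: strip_le_def T_def)
    then show ?thesis
      by (rule main) (use strips strip_le_refl in \<open>auto simp: strip_le_def\<close>)
  next
    assume "fst p + snd w \<le> pi"
    then have "rectangle p (fst q, snd w)"
      using strips rectangle_corners(2)[OF r(2)] unfolding rectangle_def
      by (cases p) (auto simp: strip_le_def T_def)
    then show ?thesis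
      by (rule main) (use strips strip_le_refl in \<open>auto simp: strip_le_def\<close>)
  qed
qed

section \<open>The internal maps and their composition\<close>

abbreviation "pt u \<equiv> T_power (tile u) u"
abbreviation "F \<equiv> h_space h X f"
abbreviation "\<phi> \<equiv> h_map h code X f"

lemma pt_strip: "u \<in> strip \<Longrightarrow> pt u \<in> strip"
  by (simp add: T_power_strip)

lemma pt_le_same: "tile v = tile u \<Longrightarrow> pt u \<preceq> pt v \<longleftrightarrow> u \<preceq> v"
  by (simp add: T_power_le)

lemma pt_le_next: "tile v = tile u - 1 \<Longrightarrow> pt v \<preceq> pt u \<longleftrightarrow> v \<preceq> T u"
  using T_power_le[of "tile u - 1" v "T u"] by (simp add: T_eq_T_power T_power_add)

lemma pt_le_T: "tile v = tile u - 1 \<Longrightarrow> pt u \<preceq> T (pt v) \<longleftrightarrow> u \<preceq> v"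
  using T_power_le[of "tile u" u v] by (simp add: T_eq_T_power T_power_add)

text \<open>The power of \<open>T\<close> that normalises \<open>v\<close> is one less than the one
  for \<open>u\<close>, which makes \<open>v\<close> the lower right corner:
  \<open>v \<preceq> T u\<close> turns into \<open>p \<preceq> w\<close>, and
  \<open>u \<preceq> v\<close> into \<open>w \<preceq> T p\<close>.\<close>

lemma rectangle_pt:
  assumes "u \<in> strip" "v \<in> strip" "tile v = tile u - 1" "u \<preceq> v" "v \<preceq> T u"
  shows "rectangle (pt v) (pt u)"
  unfolding rectangle_def
  using T_power_tile[OF assms(1)] T_power_tile[OF assms(2)] pt_le_next[OF assms(3)] pt_le_T[OF assms(3)] assms(4,5)
  by blast

lemma \<phi>_linear:
  assumes "u \<in> strip" "v \<in> strip" "u \<preceq> v"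
  shows "linear_between (scale h) (F v) (F u) (\<phi> u v)"
proof -
  consider "tile v = tile u" | "tile v = tile u - 1" "v \<preceq> T u"
    | "tile v \<noteq> tile u" "\<not> (tile v = tile u - 1 \<and> v \<preceq> T u)" by blast
  then show ?thesis
  proof cases
    case 1
    have "pt u \<preceq> pt v" using pt_le_same[OF 1] assms(3) by simp
    from res_linear[OF sub_pair_P[OF pt_strip[OF assms(2)] pt_strip[OF assms(1)] this], of "tile u"]
    show ?thesis unfolding h_map_same[OF 1] h_space_eq 1 .
  next
    case 2
    have "tile v + 1 = tile u" using 2(1) by simp
    with diffP_linear[OF rectangle_pt[OF assms(1,2) 2(1) assms(3) 2(2)], of "tile v"]
    show ?thesis unfolding h_map_next[OF 2] h_space_eq by simp
  next
    case 3
    show ?thesis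
      unfolding h_map_zero[OF 3] linear_between_def h_space_eq
      using vs.subspace_0[OF HP_subspace[OF pt_strip[OF assms(1)]]] by auto
  qed
qed

lemma F_subspace: "u \<in> strip \<Longrightarrow> vs.subspace (F u)"
  unfolding h_space_eq by (intro HP_subspace pt_strip)

lemma \<phi>_zero: "u \<in> strip \<Longrightarrow> v \<in> strip \<Longrightarrow> u \<preceq> v \<Longrightarrow> \<phi> u v 0 = 0"
  using linear_between_zero[OF \<phi>_linear F_subspace] by blast

text \<open>The cases are the possible drops of the tile from \<open>u\<close> to \<open>v\<close>
  and from \<open>v\<close> to \<open>w\<close>. In \<open>second\<close> and \<open>first\<close> a
  differential meets a restriction. If the outer points still span a rectangle, naturality gives the
  equation; otherwise the direct map is zero, and the composite vanishes because the restriction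
  passes through an intermediate corner or a factor is zero already.\<close>

lemma \<phi>_comp:
  assumes s: "u \<in> strip" "v \<in> strip" "w \<in> strip" and le: "u \<preceq> v" "v \<preceq> w" and a: "a \<in> F w"
  shows "\<phi> u v (\<phi> v w a) = \<phi> u w a"
proof -
  have uw: "u \<preceq> w" using le by (rule strip_le_trans)
  have a': "a \<in> HP (tile w) (pt w)" using a unfolding h_space_eq .
  note ps = pt_strip[OF s(1)] pt_strip[OF s(2)] pt_strip[OF s(3)]
  have zero1: "\<phi> u v (\<phi> v w a) = 0" if "tile w \<noteq> tile v" "\<not> (tile w = tile v - 1 \<and> w \<preceq> T v)"
    using h_map_zero[OF that] \<phi>_zero[OF s(1,2) le(1)] by simp
  have zero2: "\<phi> u v (\<phi> v w a) = 0" if "tile v \<noteq> tile u" "\<not> (tile v = tile u - 1 \<and> v \<preceq> T u)"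
    using h_map_zero[OF that] by simp
  have zero3: "\<phi> u w a = 0" if "tile w \<noteq> tile u" "\<not> (tile w = tile u - 1 \<and> w \<preceq> T u)"
    using h_map_zero[OF that] by simp
  have T: "T u \<preceq> T v" using le(1) by (simp add: T_eq_T_power T_power_le)
  have tiles: "tile v \<le> tile u" "tile w \<le> tile v" using tile_antimono s le by auto
  consider (same) "tile v = tile u" "tile w = tile u" | (second) "tile v = tile u" "tile w = tile v - 1"
    | (first) "tile v = tile u - 1" "tile w = tile v" | (both) "tile v = tile u - 1" "tile w = tile v - 1"
    | (far) "tile v < tile u - 1 \<or> tile w < tile v - 1"
    using tiles by linarith
  then show ?thesis
  proof cases
    case same
    have wv: "tile w = tile v" using same by simp
    have "pt v \<preceq> pt w" "pt u \<preceq> pt v"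
      using pt_le_same[OF wv] pt_le_same[OF same(1)] le by auto
    from resP_comp[OF ps(3,2,1) this a']
    show ?thesis
      unfolding h_map_same[OF same(1)] h_map_same[OF same(2)] h_map_same[OF wv] by (simp add: same)
  next
    case second
    have wu: "tile w = tile u - 1" using second by simp
    have uv: "pt u \<preceq> pt v" using pt_le_same[OF second(1)] le(1) by simp
    have deg: "tile u = tile w + 1" using wu by simp
    show ?thesis
    proof (cases "w \<preceq> T v")
      case wv: True
      note rv = rectangle_pt[OF s(2,3) second(2) le(2) wv]
      show ?thesis
      proof (cases "w \<preceq> T u")
        case True
        note ru = rectangle_pt[OF s(1,3) wu uw True]
        have "diffP (tile w) (pt w) (pt u) a = resP (tile w + 1) (pt v) (pt u) (diffP (tile w) (pt w) (pt v) a)"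
          using diffP_natural[OF rv ru strip_le_refl uv a'] resP_id[OF ps(3) a'] by simp
        then show ?thesis
          unfolding h_map_same[OF second(1)] h_map_next[OF second(2) wv] h_map_next[OF wu True] by (simp add: deg)
      next
        case False
        \<comment> \<open>As \<open>pt u\<close> is below \<open>pt v\<close> but not above
          \<open>pt w\<close>, one coordinate places it below one of the two intermediate
          corners.\<close>
        then have "\<not> pt w \<preceq> pt u" using pt_le_next[OF wu] by simp
        then have "pt u \<preceq> (fst (pt v), snd (pt w)) \<or> pt u \<preceq> (fst (pt w), snd (pt v))"
          using uv unfolding strip_le_def by auto
        from resP_diffP_zero[OF rv ps(1) this a']
        have "\<phi> u v (\<phi> v w a) = 0"
          unfolding h_map_same[OF second(1)] h_map_next[OF second(2) wv] by (simp add: deg)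
        then show ?thesis using zero3 wu False by simp
      qed
    next
      case False
      then have "\<not> w \<preceq> T u" using T strip_le_trans by blast
      then show ?thesis using zero1 zero3 False second wu by simp
    qed
  next
    case first
    have wu: "tile w = tile u - 1" using first by simp
    have vw: "pt v \<preceq> pt w" using pt_le_same[OF first(2)] le(2) by simp
    have \<phi>vw: "\<phi> v w a = resP (tile w) (pt w) (pt v) a"
      unfolding h_map_same[OF first(2)] by (simp add: first(2))
    show ?thesis
    proof (cases "v \<preceq> T u")
      case vu: True
      note rv = rectangle_pt[OF s(1,2) first(1) le(1) vu]
      have \<phi>uv: "\<phi> u v (\<phi> v w a) = diffP (tile w) (pt v) (pt u) (resP (tile w) (pt w) (pt v) a)"
        unfolding \<phi>vw h_map_next[OF first(1) vu] by (simp add: first(2))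
      show ?thesis
      proof (cases "w \<preceq> T u")
        case True
        note rw = rectangle_pt[OF s(1,3) wu uw True]
        have "\<phi> u v (\<phi> v w a) = resP (tile w + 1) (pt u) (pt u) (diffP (tile w) (pt w) (pt u) a)"
          unfolding \<phi>uv by (rule diffP_natural[OF rw rv vw strip_le_refl a'])
        also have "\<dots> = diffP (tile w) (pt w) (pt u) a"
          by (rule resP_id[OF ps(1) diffP_in[OF rw a']])
        finally show ?thesis unfolding h_map_next[OF wu True] .
      next
        case False
        then have "\<not> pt w \<preceq> pt u" using pt_le_next[OF wu] by simp
        then have "(fst (pt u), snd (pt v)) \<preceq> pt w \<or> (fst (pt v), snd (pt u)) \<preceq> pt w"
          using vw unfolding strip_le_def by auto
        from diffP_resP_zero[OF rv ps(3) this a'] show ?thesis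
          unfolding \<phi>uv using zero3 wu False by simp
      qed
    next
      case False
      then have "\<not> w \<preceq> T u" using le(2) strip_le_trans by blast
      then show ?thesis using zero2 zero3 False first wu by simp
    qed
  next
    case both
    \<comment> \<open>The tiles of \<open>u\<close> and \<open>w\<close> differ by two, so the
      direct map is zero by definition and the composite has to vanish.\<close>
    have "\<phi> u w a = 0" using zero3 both by simp
    moreover have "\<phi> u v (\<phi> v w a) = 0"
    proof (cases "v \<preceq> T u \<and> w \<preceq> T v")
      case True
      note ru = rectangle_pt[OF s(1,2) both(1) le(1)] and rv = rectangle_pt[OF s(2,3) both(2) le(2)]
      have deg: "tile v = tile w + 1" using both by simp
      show ?thesis
        using diffP_diffP_zero[OF rv ru a'] True
        unfolding h_map_next[OF both(1) conjunct1[OF True]] h_map_next[OF both(2) conjunct2[OF True]]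
        by (simp add: deg)
    next
      case False
      then show ?thesis using zero1 zero2 both by auto
    qed
    ultimately show ?thesis by simp
  next
    case far
    then have "\<phi> u w a = 0" using zero3 tiles by auto
    moreover have "\<phi> u v (\<phi> v w a) = 0" using far zero1 zero2 by auto
    ultimately show ?thesis by simp
  qed
qed

lemma finite_dimensional_PA: "finite_dimensional (scale h) (H n X (PA u) {})"
proof (rule finite_dimensional_pre_interval[OF open_rho(1)])
  show "is_interval (rho1 u)" unfolding rho1_eq by (rule is_interval_arctan)
qed

text \<open>In the fundamental domain \<open>snd u \<le> fst u\<close>, so the two rays that form
  \<open>rho0 u\<close> are disjoint, and tameness applies to each of them.\<close>

lemma finite_dimensional_PB:
  assumes "u \<in> fundamental_domain"
  shows "finite_dimensional (scale h) (H n X (PB u) {})"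
proof -
  let ?L = "{t. arctan t < snd u}" and ?R = "{t. fst u < arctan t}"
  have eq: "PB u = pre ?L \<union> pre ?R"
    unfolding pre_Un[symmetric] by (rule arg_cong[where f = pre]) (auto simp: rho0_eq)
  show ?thesis
    unfolding eq
  proof (rule finite_dimensional_disjoint_union)
    show "pre ?L \<inter> pre ?R = {}"
      using assms by (auto simp: pre_def fundamental_domain_iff)
  qed (intro openin_pre open_arctan_less finite_dimensional_pre_interval is_interval_arctan)+
qed

lemma finite_dimensional_F:
  assumes "u \<in> strip"
  shows "finite_dimensional (scale h) (F u)"
  unfolding h_space_eq
  by (rule finite_dimensional_relative[OF PB_subset_PA[OF pt_strip[OF assms]] pre_top
        finite_dimensional_PA finite_dimensional_PB[OF T_power_tile[OF assms]]])

lemma strip_functor_vect_h: "strip_functor_vect (scale h) F \<phi>"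
  unfolding strip_functor_vect_def strip_functor_def
proof (intro conjI ballI impI)
  fix u a assume u: "u \<in> strip" and a: "a \<in> F u"
  show "\<phi> u u a = a"
    using resP_id[OF pt_strip[OF u], of a "tile u"] a unfolding h_map_same[OF refl] h_space_eq by simp
qed (intro F_subspace \<phi>_linear \<phi>_comp finite_dimensional_F; assumption)+

section \<open>Increasing sequences and their limits\<close>

lemma increasing_le_limit:
  assumes "\<And>k. u k \<preceq> u (Suc k)" "u \<longlonglongrightarrow> l"
  shows "u k \<preceq> l" "j \<le> k \<Longrightarrow> u j \<preceq> u k"
proof -
  have dec: "decseq (\<lambda>k. fst (u k))" and inc: "incseq (\<lambda>k. snd (u k))"
    using assms(1) unfolding strip_le_def by (simp_all add: decseq_SucI incseq_SucI)
  show "u k \<preceq> l"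
    using decseq_ge[OF dec tendsto_fst[OF assms(2)]] incseq_le[OF inc tendsto_snd[OF assms(2)]]
    unfolding strip_le_def by simp
  show "u j \<preceq> u k" if "j \<le> k"
    using decseqD[OF dec that] incseqD[OF inc that] unfolding strip_le_def by simp
qed

text \<open>In the tile of the limit the upper bound on the difference of the coordinates is strict,
  so it holds for late terms by convergence. The lower bound may be attained at the limit, but the
  terms lie below the limit in the order, where the difference is at least as large.\<close>

lemma tile_eventually:
  assumes s: "\<And>k. u k \<in> strip" "l \<in> strip" and inc: "\<And>k. u k \<preceq> u (Suc k)" and lim: "u \<longlonglongrightarrow> l"
  obtains K where "\<And>k. K \<le> k \<Longrightarrow> tile (u k) = tile l"
proof -
  have "(\<lambda>k. fst (T_power (tile l) (u k)) - snd (T_power (tile l) (u k))) \<longlonglongrightarrow>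
      fst (pt l) - snd (pt l)"
    by (intro tendsto_intros T_power_tendsto lim)
  moreover have "fst (pt l) - snd (pt l) < 2 * pi"
    using T_power_tile[OF s(2)] by (simp add: fundamental_domain_iff)
  ultimately have "\<forall>\<^sub>F k in sequentially. fst (T_power (tile l) (u k)) - snd (T_power (tile l) (u k)) < 2 * pi"
    by (rule order_tendstoD(2))
  then obtain K where K: "\<And>k. K \<le> k \<Longrightarrow> fst (T_power (tile l) (u k)) - snd (T_power (tile l) (u k)) < 2 * pi"
    unfolding eventually_sequentially by blast
  have "tile (u k) = tile l" if "K \<le> k" for k
  proof -
    have "T_power (tile l) (u k) \<preceq> pt l"
      using increasing_le_limit(1)[OF inc lim] by (simp add: T_power_le)
    then have "T_power (tile l) (u k) \<in> fundamental_domain"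
      using K[OF that] T_power_tile[OF s(2)] s(1)
      unfolding fundamental_domain_iff strip_le_def T_power_strip by auto
    then show ?thesis using tile_eq_iff[OF s(1)] by blast
  qed
  then show thesis by (rule that)
qed

lemma sequentially_continuous_h: "sequentially_continuous F \<phi>"
  unfolding sequentially_continuous_def
proof (intro allI impI, elim conjE)
  fix u l assume u: "\<forall>k. u k \<in> strip \<and> u k \<preceq> u (Suc k)" and l: "l \<in> strip" and lim: "u \<longlonglongrightarrow> l"
  have us: "u k \<in> strip" and inc: "u k \<preceq> u (Suc k)" for k using u by auto
  note le = increasing_le_limit[OF inc lim]
  obtain K where K: "\<And>k. K \<le> k \<Longrightarrow> tile (u k) = tile l"
    using tile_eventually[OF us l inc lim] by blast
  define n where "n = tile l"
  \<comment> \<open>Once the tile is constant, a single power of \<open>T\<close> moves the tail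
    into the fundamental domain, where it increases to \<open>pt l\<close> and the internal maps
    become restrictions.\<close>
  define w where "w k = T_power n (u (k + K))" for k
  have tw: "tile (u (k + K)) = n" for k unfolding n_def by (rule K) simp
  have wD: "w k \<in> fundamental_domain" for k
    using T_power_tile[OF us, of "k + K"] unfolding w_def tw .
  have ws: "w k \<in> strip" for k by (rule domain_strip[OF wD])
  have ls: "pt l \<in> strip" by (rule pt_strip[OF l])
  have wl: "w k \<preceq> pt l" for k
    unfolding w_def n_def by (simp add: T_power_le le(1))
  have wS: "w k \<preceq> w (Suc k)" for k
    unfolding w_def using inc[of "k + K"] by (simp add: T_power_le)
  have "w \<longlonglongrightarrow> pt l"
    unfolding w_def n_def by (rule T_power_tendsto[OF LIMSEQ_ignore_initial_segment[OF lim]])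
  note unions = rho_increasing_union[OF this wl]
  have UA: "(\<Union>k. PA (w k)) = PA (pt l)" and UB: "(\<Union>k. PB (w k)) = PB (pt l)"
    unfolding pre_UN[symmetric] unions by (rule refl)+
  have exA: "exhaustion (\<lambda>k. PA (w k))" and exB: "exhaustion (\<lambda>k. PB (w k))"
    by (intro exhaustion_pre open_rho rho_mono wS)+
  note hyps = exA exB PB_subset_PA[OF ws] finite_dimensional_PA finite_dimensional_PB[OF wD]
  have Fl: "F l = HP n (pt l)" and Fu: "F (u (k + K)) = HP n (w k)" for k
    unfolding h_space_eq tw w_def n_def by (rule refl)+
  have \<phi>l: "\<phi> (u (k + K)) l = resP n (pt l) (w k)" for k
    using h_map_same[of l "u (k + K)"] by (simp add: tw w_def n_def[symmetric])
  have \<phi>S: "\<phi> (u (k + K)) (u (Suc k + K)) = resP n (w (Suc k)) (w k)" for k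
    using h_map_same[of "u (Suc k + K)" "u (k + K)"] tw[of k] tw[of "Suc k"] by (simp add: w_def)
  let ?m = "\<lambda>a k. \<phi> (u k) l a"
  have into: "?m a \<in> inverse_limit F \<phi> u" if "a \<in> F l" for a
    unfolding inverse_limit_def
  proof (intro CollectI conjI allI impI)
    show "\<phi> (u k) l a \<in> F (u k)" for k
      using \<phi>_linear[OF us l le(1)] that unfolding linear_between_def by blast
    show "\<phi> (u j) (u k) (\<phi> (u k) l a) = \<phi> (u j) l a" if "j \<le> k" for j k
      by (rule \<phi>_comp[OF us us l le(2)[OF that] le(1) \<open>a \<in> F l\<close>])
  qed
  have inj: "inj_on ?m (F l)"
  proof (rule inj_onI)
    fix a b assume a: "a \<in> F l" and b: "b \<in> F l" and eq: "?m a = ?m b"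
    have ab: "a - b \<in> HP n (pt l)"
      using vs.subspace_diff[OF F_subspace[OF l] a b] unfolding Fl .
    have "a - b = 0"
    proof (rule relative_limit_injective[OF hyps, of "a - b" n, unfolded UA UB])
      show "a - b \<in> HP n (pt l)" by (rule ab)
      show "resP n (pt l) (w k) (a - b) = 0" for k
        using res_diff[OF sub_pair_P[OF ls ws wl] a[unfolded Fl] b[unfolded Fl]] fun_cong[OF eq, of "k + K"]
        unfolding \<phi>l by simp
    qed
    then show "a = b" by simp
  qed
  have surj: "c \<in> ?m ` F l" if c: "c \<in> inverse_limit F \<phi> u" for c
  proof -
    have cF: "c k \<in> F (u k)" and cc: "j \<le> k \<Longrightarrow> \<phi> (u j) (u k) (c k) = c j" for j k
      using c unfolding inverse_limit_def by auto
    have c1: "c (k + K) \<in> HP n (w k)" for k using cF[of "k + K"] unfolding Fu .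
    have c2: "resP n (w (Suc k)) (w k) (c (Suc k + K)) = c (k + K)" for k
      using cc[of "k + K" "Suc k + K"] unfolding \<phi>S by simp
    have "\<exists>a. a \<in> HP n (pt l) \<and> (\<forall>k. resP n (pt l) (w k) a = c (k + K))"
    proof (rule relative_limit_surjective[OF hyps, of "\<lambda>k. c (k + K)" n, unfolded UA UB, OF c1 c2])
      fix a assume "a \<in> HP n (pt l)" "\<And>k. resP n (pt l) (w k) a = c (k + K)"
      then show ?thesis by blast
    qed
    then obtain a where a: "a \<in> HP n (pt l)" "\<And>k. resP n (pt l) (w k) a = c (k + K)" by blast
    have aF: "a \<in> F l" using a(1) unfolding Fl .
    \<comment> \<open>The class \<open>a\<close> was found from the tail of the thread only; an
      arbitrary term is reached by mapping down from index \<open>k + K\<close>.\<close>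
    have "?m a k = c k" for k
    proof -
      have "\<phi> (u k) l a = \<phi> (u k) (u (k + K)) (\<phi> (u (k + K)) l a)"
        by (rule \<phi>_comp[OF us us l le(2) le(1) aF, symmetric]) simp
      also have "\<dots> = \<phi> (u k) (u (k + K)) (c (k + K))" unfolding \<phi>l a(2) ..
      also have "\<dots> = c k" by (rule cc) simp
      finally show ?thesis .
    qed
    then have "c = ?m a" by auto
    then show ?thesis using aF by (rule image_eqI)
  qed
  show "bij_betw ?m (F l) (inverse_limit F \<phi> u)"
    by (rule bij_betw_imageI[OF inj]) (use into surj in blast)
qed

end

theorem proposition2p5:
  fixes h :: "('k::field, 'v::ab_group_add, 'u) cohomology_data"
    and code :: "'u \<times> real \<Rightarrow> 'u"
    and X :: "'u topology"
    and f :: "'u \<Rightarrow> real"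
  assumes "cohomology_theory h"
    and "inj code"
    and "continuous_map X euclideanreal f"
    and "tame h X f"
  shows "strip_functor_vect (scale h) (h_space h X f) (h_map h code X f) \<and>
         sequentially_continuous (h_space h X f) (h_map h code X f)"
proof -
  interpret tame_function h code X f
    using assms
    by (intro tame_function.intro cylinder_theory.intro cylinder_theory_axioms.intro tame_function_axioms.intro)
  show ?thesis
    using strip_functor_vect_h sequentially_continuous_h ..
qed

end
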